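(* Each multiview variety appears as an irreducible component in the special fiber of a Mustafin variety. That is: let $n>2$, let $A_1,\dots,A_n$ be nonzero $3\times4$ matrices over $k$, and let $Y$ be the closure of the image of the rational map $\mathbb{P}^3_k\dashrightarrow\prod_{i=1}^n\mathbb{P}^2_k$, $x\mapsto(A_1x,\dots,A_nx)$. Then there are a finite-dimensional $K$-vector space $V$ and a finite set $\Gamma$ of homothety classes of lattices in $V$ such that $Y$ is isomorphic to an irreducible component of $\mathcal{M}(\Gamma)_k$.
   Context: Setting: $R$ is a discrete valuation ring with quotient field $K$ and residue field $k$, which is assumed algebraically closed. For a $K$-vector space $V$ of dimension $d$, a lattice is a free $R$-submodule $L\subset V$ of rank $d$; lattices are considered up to homothety ($L\sim cL$, $c\in K^\times$). Put $\mathbb{P}(V)=\mathrm{Proj}\,\mathrm{Sym}(V^* )$ and $\mathbb{P}(L)=\mathrm{Proj}\,\mathrm{Sym}(L^* )$ with $L^*=\mathrm{Hom}_R(L,R)$ (parametrising lines). Mustafin variety: for $\Gamma=\{[L_1],\dots,[L_m]\}$, the open immersions $\mathbb{P}(V)\hookrightarrow\mathbb{P}(L_i)$ give a map $\mathbb{P}(V)\to\mathbb{P}(L_1)\times_R\cdots\times_R\mathbb{P}(L_m)$; $\mathcal{M}(\Gamma)$ is the closure of its image with the reduced scheme structure, and $\mathcal{M}(\Gamma)_k$ is its special fiber. Multiview variety: the variety $Y$ described in the claim, with its reduced structure. *)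

theory Defs
  imports
    "HOL-Analysis.Abstract_Topology"
    "HOL-Library.Poly_Mapping"
    "HOL-Computational_Algebra.Polynomial_Factorial"
    "HOL-Algebra.Ring_Divisibility"
    "Jordan_Normal_Form.VS_Connect"
begin

section \<open>The base ring\<close>

text \<open>
  The type \<open>'r\<close> is a discrete valuation ring: a principal ideal domain with exactly one
  nonzero prime ideal. Its quotient field \<open>K\<close> is the type \<open>'r fract\<close>.
\<close>

definition is_dvr :: "'r::idom itself \<Rightarrow> bool" where
  "is_dvr _ \<longleftrightarrow> principal_domain (class_ring :: 'r ring) \<and>
     (\<exists>!P. primeideal P (class_ring :: 'r ring) \<and> P \<noteq> {0})"

text \<open>
  A surjective ring homomorphism \<open>res\<close> onto a field \<open>'k\<close> has a maximal ideal as its kernel.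
  For a discrete valuation ring this is the maximal ideal, so \<open>res\<close> identifies \<open>'k\<close>
  with the residue field.
\<close>

definition residue_map :: "('r::idom \<Rightarrow> 'k::field) \<Rightarrow> bool" where
  "residue_map res \<longleftrightarrow> comm_ring_hom res \<and> surj res"


section \<open>Multigraded polynomial rings\<close>

text \<open>The variable \<open>(i, j)\<close> is the \<open>j\<close>-th homogeneous coordinate on the \<open>i\<close>-th factor.\<close>

type_synonym 'a mpoly = "((nat \<times> nat) \<Rightarrow>\<^sub>0 nat) \<Rightarrow>\<^sub>0 'a"

definition Const :: "'a::comm_ring_1 \<Rightarrow> 'a mpoly" where
  "Const c = Poly_Mapping.single 0 c"

definition Var :: "nat \<times> nat \<Rightarrow> 'a::comm_ring_1 mpoly" where
  "Var v = Poly_Mapping.single (Poly_Mapping.single v 1) 1"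

definition mpoly_ring :: "nat \<Rightarrow> nat \<Rightarrow> 'a::comm_ring_1 mpoly ring" where
  "mpoly_ring m d = class_ring
     \<lparr>carrier := {p. \<forall>\<mu>\<in>Poly_Mapping.keys p. Poly_Mapping.keys \<mu> \<subseteq> {..<m} \<times> {..<d}}\<rparr>"

definition mpoly_eval ::
    "('a::comm_ring_1 \<Rightarrow> 'b::comm_ring_1) \<Rightarrow> (nat \<times> nat \<Rightarrow> 'b) \<Rightarrow> 'a mpoly \<Rightarrow> 'b" where
  "mpoly_eval h x p = (\<Sum>\<mu>\<in>Poly_Mapping.keys p.
     h (Poly_Mapping.lookup p \<mu>) * (\<Prod>v\<in>Poly_Mapping.keys \<mu>. x v ^ Poly_Mapping.lookup \<mu> v))"

definition multihomogeneous ::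
    "nat \<Rightarrow> nat \<Rightarrow> (nat \<Rightarrow> nat) \<Rightarrow> 'a::comm_ring_1 mpoly \<Rightarrow> bool" where
  "multihomogeneous m d e p \<longleftrightarrow> p \<in> carrier (mpoly_ring m d) \<and>
     (\<forall>\<mu>\<in>Poly_Mapping.keys p. \<forall>i<m. (\<Sum>j<d. Poly_Mapping.lookup \<mu> (i, j)) = e i)"

definition multiforms :: "nat \<Rightarrow> nat \<Rightarrow> 'a::comm_ring_1 mpoly set" where
  "multiforms m d = {p. \<exists>e. multihomogeneous m d e p}"


section \<open>Products of projective spaces as topological spaces of prime ideals\<close>

text \<open>
  The underlying space of the scheme \<open>P \<times> \<dots> \<times> P\<close>, the \<open>m\<close>-fold fibre product over \<open>Spec A\<close> of
  \<open>P = Proj A[x_0, \<dots>, x_{d-1}]\<close>: the prime ideals of the multigraded coordinate ring that are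
  generated by multihomogeneous elements and do not contain all coordinates of any factor.
  The Zariski topology has the sets where a multihomogeneous element does not vanish as a basis.
\<close>

definition multiproj :: "nat \<Rightarrow> nat \<Rightarrow> 'a::idom mpoly set set" where
  "multiproj m d = {P. primeideal P (mpoly_ring m d) \<and>
     P = Idl\<^bsub>mpoly_ring m d\<^esub> (P \<inter> multiforms m d) \<and>
     (\<forall>i<m. \<exists>j<d. Var (i, j) \<notin> P)}"

definition multiproj_zariski :: "nat \<Rightarrow> nat \<Rightarrow> 'a::idom mpoly set topology" where
  "multiproj_zariski m d = topology_generated_by
     {{P \<in> multiproj m d. f \<notin> P} | f. f \<in> multiforms m d}"


section \<open>Irreducible components\<close>

definition irreducible_in :: "'a topology \<Rightarrow> 'a set \<Rightarrow> bool" where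
  "irreducible_in T S \<longleftrightarrow> S \<subseteq> topspace T \<and> S \<noteq> {} \<and>
     (\<forall>C D. closedin T C \<and> closedin T D \<and> S \<subseteq> C \<union> D \<longrightarrow> S \<subseteq> C \<or> S \<subseteq> D)"

definition irreducible_component_of :: "'a topology \<Rightarrow> 'a set \<Rightarrow> bool" where
  "irreducible_component_of T Z \<longleftrightarrow> irreducible_in T Z \<and>
     (\<forall>Z'. irreducible_in T Z' \<and> Z \<subseteq> Z' \<longrightarrow> Z' = Z)"


section \<open>Lattices\<close>

text \<open>
  The columns of \<open>B\<close> form an \<open>R\<close>-basis of \<open>M \<subseteq> K^d\<close>, that is, \<open>M\<close> is the image of the injective
  \<open>R\<close>-linear map \<open>R^d \<rightarrow> K^d\<close> given by \<open>B\<close>.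
\<close>

definition is_lattice_basis :: "nat \<Rightarrow> 'r::idom fract vec set \<Rightarrow> 'r fract mat \<Rightarrow> bool" where
  "is_lattice_basis d M B \<longleftrightarrow> B \<in> carrier_mat d d \<and>
     inj_on (\<lambda>c. B *\<^sub>v map_vec to_fract c) (carrier_vec d) \<and>
     M = (\<lambda>c. B *\<^sub>v map_vec to_fract c) ` carrier_vec d"

definition is_lattice :: "nat \<Rightarrow> 'r::idom fract vec set \<Rightarrow> bool" where
  "is_lattice d L \<longleftrightarrow> (\<exists>B. is_lattice_basis d L B)"

definition homothety_class :: "'r::idom fract vec set \<Rightarrow> 'r fract vec set set" where
  "homothety_class L = {(\<lambda>v. c \<cdot>\<^sub>v v) ` L | c. c \<noteq> 0}"

text \<open>
  \<open>L\<^sup>* = Hom_R(L, R)\<close>, whose elements extend uniquely to \<open>K\<close>-linear functionals on \<open>K^d\<close>; these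
  are written as vectors via the dot product.
\<close>

definition dual_lattice :: "nat \<Rightarrow> 'r::idom fract vec set \<Rightarrow> 'r fract vec set" where
  "dual_lattice d L = {\<phi> \<in> carrier_vec d. \<forall>v\<in>L. \<phi> \<bullet> v \<in> range to_fract}"

definition dual_basis :: "nat \<Rightarrow> 'r::idom fract vec set \<Rightarrow> 'r fract mat" where
  "dual_basis d L = (SOME B. is_lattice_basis d (dual_lattice d L) B)"


section \<open>Mustafin varieties\<close>

text \<open>
  For lattices \<open>L_0, \<dots>, L_{m-1}\<close> in \<open>V = K^d\<close>, the chosen basis of \<open>L_i\<^sup>*\<close> identifies
  \<open>Sym(L_i\<^sup>*)\<close> with \<open>R[x_{i0}, \<dots>, x_{i,d-1}]\<close> and hence \<open>P(L_0) \<times>_R \<dots> \<times>_R P(L_{m-1})\<close> with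
  \<^term>\<open>multiproj m d\<close>. The map \<open>P(V) \<rightarrow> P(L_0) \<times>_R \<dots> \<times>_R P(L_{m-1})\<close> comes from the
  inclusions \<open>Sym(L_i\<^sup>*) \<subseteq> Sym(V\<^sup>*)\<close>, which send \<open>x_{ij}\<close> to the \<open>j\<close>-th basis element of \<open>L_i\<^sup>*\<close>,
  regarded as a linear form on \<open>V\<close>. A point of \<open>P(V)\<close>, i.e. a homogeneous prime ideal \<open>q\<close>, is
  sent to the ideal generated by the multihomogeneous elements whose image lies in \<open>q\<close>.
\<close>

definition linear_form :: "nat \<Rightarrow> 'a::comm_ring_1 vec \<Rightarrow> 'a mpoly" where
  "linear_form d \<phi> = (\<Sum>l<d. Const (\<phi> $ l) * Var (0, l))"

definition pullback :: "nat \<Rightarrow> 'r::idom fract vec set list \<Rightarrow> 'r mpoly \<Rightarrow> 'r fract mpoly" where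
  "pullback d Ls = mpoly_eval (\<lambda>c. Const (to_fract c))
     (\<lambda>(i, j). linear_form d (col (dual_basis d (Ls ! i)) j))"

definition diagonal_map ::
    "nat \<Rightarrow> 'r::idom fract vec set list \<Rightarrow> 'r fract mpoly set \<Rightarrow> 'r mpoly set" where
  "diagonal_map d Ls q = Idl\<^bsub>mpoly_ring (length Ls) d\<^esub>
     {f \<in> multiforms (length Ls) d. pullback d Ls f \<in> q}"

text \<open>
  The Mustafin variety carries the reduced scheme structure, so it is determined by its underlying
  closed set. The underlying space of its special fibre consists of the points over the closed
  point of \<open>Spec R\<close>, with the subspace topology.
\<close>

definition mustafin_variety :: "nat \<Rightarrow> 'r::idom fract vec set list \<Rightarrow> 'r mpoly set set" where
  "mustafin_variety d Ls =
     multiproj_zariski (length Ls) d closure_of (diagonal_map d Ls ` multiproj 1 d)"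

definition special_fiber ::
    "('r::idom \<Rightarrow> 'k::field) \<Rightarrow> nat \<Rightarrow> 'r fract vec set list \<Rightarrow> 'r mpoly set topology" where
  "special_fiber res d Ls = subtopology (multiproj_zariski (length Ls) d)
     {P \<in> mustafin_variety d Ls. {a. Const a \<in> P} = {a. res a = 0}}"


section \<open>Varieties in products of projective spaces over the residue field\<close>

text \<open>
  Over the algebraically closed field \<open>k\<close> a reduced closed subscheme is treated as a variety in the
  classical sense: the set of its \<open>k\<close>-rational points with the Zariski topology and the sheaf of
  regular functions. A \<open>k\<close>-point of the \<open>m\<close>-fold product of \<open>(d-1)\<close>-dimensional projective
  spaces is the set of all its homogeneous coordinate tuples; only the entries \<open>x i\<close> with \<open>i < m\<close>
  of a tuple matter, the others are unconstrained.
\<close>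

definition coord_tuples :: "nat \<Rightarrow> nat \<Rightarrow> (nat \<Rightarrow> 'k::field vec) set" where
  "coord_tuples m d = {x. \<forall>i<m. x i \<in> carrier_vec d \<and> x i \<noteq> 0\<^sub>v d}"

definition proj_point :: "nat \<Rightarrow> (nat \<Rightarrow> 'k::field vec) \<Rightarrow> (nat \<Rightarrow> 'k vec) set" where
  "proj_point m x = {y. \<forall>i<m. \<exists>c. c \<noteq> 0 \<and> y i = c \<cdot>\<^sub>v x i}"

definition proj_product :: "nat \<Rightarrow> nat \<Rightarrow> (nat \<Rightarrow> 'k::field vec) set set" where
  "proj_product m d = proj_point m ` coord_tuples m d"

definition form_at :: "'k::field mpoly \<Rightarrow> (nat \<Rightarrow> 'k vec) \<Rightarrow> 'k" where
  "form_at f x = mpoly_eval (\<lambda>c. c) (\<lambda>(i, j). x i $ j) f"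

definition proj_zariski :: "nat \<Rightarrow> nat \<Rightarrow> (nat \<Rightarrow> 'k::field vec) set topology" where
  "proj_zariski m d = topology_generated_by
     {{p \<in> proj_product m d. \<forall>x\<in>p. form_at f x \<noteq> 0} | f. f \<in> multiforms m d}"

text \<open>
  A function on an open subset \<open>U\<close> of a closed set is regular if it is locally a quotient of two
  multihomogeneous polynomials of the same multidegree.
\<close>

definition regular_on ::
    "nat \<Rightarrow> nat \<Rightarrow> (nat \<Rightarrow> 'k::field vec) set set \<Rightarrow> ((nat \<Rightarrow> 'k vec) set \<Rightarrow> 'k) \<Rightarrow> bool" where
  "regular_on m d U f \<longleftrightarrow> (\<forall>p\<in>U. \<exists>W e g h.
     openin (proj_zariski m d) W \<and> p \<in> W \<and> multihomogeneous m d e g \<and> multihomogeneous m d e h \<and>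
     (\<forall>q\<in>U \<inter> W. \<forall>x\<in>q. form_at h x \<noteq> 0 \<and> f q = form_at g x / form_at h x))"

definition isomorphic_varieties ::
    "nat \<Rightarrow> nat \<Rightarrow> (nat \<Rightarrow> 'k::field vec) set set \<Rightarrow>
     nat \<Rightarrow> nat \<Rightarrow> (nat \<Rightarrow> 'k vec) set set \<Rightarrow> bool" where
  "isomorphic_varieties m d X m' d' X' \<longleftrightarrow> (\<exists>\<phi>.
     homeomorphic_map (subtopology (proj_zariski m d) X) (subtopology (proj_zariski m' d') X') \<phi> \<and>
     (\<forall>U f. openin (subtopology (proj_zariski m' d') X') U \<longrightarrow>
        (regular_on m' d' U f \<longleftrightarrow> regular_on m d {p \<in> X. \<phi> p \<in> U} (f \<circ> \<phi>))))"

text \<open>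
  The image of the morphism from \<open>Spec k\<close> to the product of the projective spaces over \<open>R\<close> given
  by a coordinate tuple over \<open>k\<close>.
\<close>

definition residue_point ::
    "('r::idom \<Rightarrow> 'k::field) \<Rightarrow> nat \<Rightarrow> nat \<Rightarrow> (nat \<Rightarrow> 'k vec) \<Rightarrow> 'r mpoly set" where
  "residue_point res m d x = Idl\<^bsub>mpoly_ring m d\<^esub>
     {f \<in> multiforms m d. mpoly_eval res (\<lambda>(i, j). x i $ j) f = 0}"

definition rational_points ::
    "('r::idom \<Rightarrow> 'k::field) \<Rightarrow> nat \<Rightarrow> nat \<Rightarrow> 'r mpoly set set \<Rightarrow> (nat \<Rightarrow> 'k vec) set set" where
  "rational_points res m d Z =
     {proj_point m x | x. x \<in> coord_tuples m d \<and> residue_point res m d x \<in> Z}"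


section \<open>Multiview varieties\<close>

definition multiview_variety :: "nat \<Rightarrow> (nat \<Rightarrow> 'k::field mat) \<Rightarrow> (nat \<Rightarrow> 'k vec) set set" where
  "multiview_variety n A = proj_zariski n 3 closure_of
     {proj_point n (\<lambda>i. A i *\<^sub>v x) | x. x \<in> carrier_vec 4 \<and> (\<forall>i<n. A i *\<^sub>v x \<noteq> 0\<^sub>v 3)}"

end

theory Submission
  imports
    Defs
    "HOL-Library.Function_Algebras"
    "Jordan_Normal_Form.Char_Poly"
begin

text \<open>
  Choose a linear map \<open>W : k^d \<rightarrow> k^4\<close> with \<open>d\<close> maximal such that, for some point of the image of
  \<open>W\<close>, the fibre of \<open>x \<mapsto> (A_1 x, \<dots>, A_n x)\<close> through it meets the image of \<open>W\<close> nowhere else. By maximality the maps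
  \<open>P_i = A_i W\<close> have the same closed image \<open>Y\<close> as the \<open>A_i\<close>, and they map \<open>P^{d-1}\<close> birationally to it.

  Replace \<open>P_i\<close> by a \<open>d \<times> d\<close> matrix with the same row space and lift that to a matrix over \<open>R\<close> which
  is invertible over \<open>K\<close>. Its rows span the dual of a lattice \<open>L_i\<close>. Homothetic lattices obtained in
  this way have reductions with equal row spaces, so one lattice of each homothety class suffices.

  The closure \<open>Z\<close> of the image of \<open>P^{d-1}\<close> under the reductions lies in \<open>M(\<Gamma>)_k\<close>, because forms that
  vanish on the image of \<open>P(V)\<close> reduce to forms that vanish on \<open>Z\<close>. By birationality, Cramer's rule
  provides forms \<open>C\<close> over \<open>R\<close> such that \<open>C(y)\<close> is proportional to \<open>x\<close> whenever \<open>y\<close> is the image of \<open>x\<close>.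
  The relations \<open>y_i \<sim> b_i C(y)\<close>, where the \<open>b_i\<close> are the lifted matrices, hold on \<open>M(\<Gamma>)\<close>, and where all
  \<open>b_i C(y)\<close> are nonzero they put a point of the special fibre into \<open>Z\<close>. Hence \<open>Z\<close> contains a nonempty
  open subset of the special fibre and is a component, without any dimension theory.
\<close>

section \<open>Evaluation of multigraded polynomials\<close>

text \<open>The restriction to K^d is forced by dimensions. The special fibre for lattices in K^4
  has components of dimension 3 only, whereas Y has smaller dimension when the map has
  positive-dimensional fibres. Restricting to a linear subspace suffices because the closed fibre
  through x, all z with \<open>A i z = s i * A i x\<close> for some scalars s, is itself a linear
  space, and a general linear space of complementary dimension meets it in one point.

  Primes are handled through evaluation at points with coordinates in K or k. Both fields are
  infinite, so forms are determined by their values; irreducibility becomes the possibility to join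
  two points by a polynomial curve, and density becomes the finiteness of the roots on it.

  The basis of a dual lattice is an arbitrary choice, so the reduction of the chosen basis is known
  only up to a base change. This is treated together with homothety: both alter the reductions by
  linear maps which are mutually inverse on the images, though not as matrices, and equations valid
  on an image pass to its closure.\<close>

abbreviation "lookup \<equiv> Poly_Mapping.lookup"
abbreviation "keys \<equiv> Poly_Mapping.keys"

definition mon_eval :: "('v \<Rightarrow> 'b::comm_semiring_1) \<Rightarrow> ('v \<Rightarrow>\<^sub>0 nat) \<Rightarrow> 'b" where
  "mon_eval x \<mu> = (\<Prod>v\<in>keys \<mu>. x v ^ lookup \<mu> v)"

lemma mon_eval_superset:
  assumes "finite V" "keys \<mu> \<subseteq> V"
  shows "mon_eval x \<mu> = (\<Prod>v\<in>V. x v ^ lookup \<mu> v)"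
  unfolding mon_eval_def
  by (rule prod.mono_neutral_left) (use assms in \<open>auto simp: not_in_keys_iff_lookup_eq_zero\<close>)

lemma mon_eval_zero [simp]: "mon_eval x 0 = 1"
  by (simp add: mon_eval_def)

lemma mon_eval_add: "mon_eval x (\<mu> + \<nu>) = mon_eval x \<mu> * mon_eval x \<nu>"
proof -
  let ?V = "keys \<mu> \<union> keys \<nu>"
  have "mon_eval x (\<mu> + \<nu>) = (\<Prod>v\<in>?V. x v ^ lookup (\<mu> + \<nu>) v)"
    by (rule mon_eval_superset) (simp_all add: keys_add)
  also have "\<dots> = (\<Prod>v\<in>?V. x v ^ lookup \<mu> v) * (\<Prod>v\<in>?V. x v ^ lookup \<nu> v)"
    by (simp add: lookup_add power_add prod.distrib)
  also have "\<dots> = mon_eval x \<mu> * mon_eval x \<nu>"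
    by (subst (1 2) mon_eval_superset[of ?V]) auto
  finally show ?thesis .
qed

lemma mon_eval_single [simp]: "mon_eval x (Poly_Mapping.single v e) = x v ^ e"
  by (simp add: mon_eval_def)

lemma mon_eval_mult: "mon_eval (\<lambda>v. x v * y v) \<mu> = mon_eval x \<mu> * mon_eval y \<mu>"
  by (simp add: mon_eval_def power_mult_distrib prod.distrib)

lemma mon_eval_one [simp]: "mon_eval (\<lambda>v. 1) \<mu> = 1"
  by (simp add: mon_eval_def)

lemma mon_eval_cong: "(\<And>v. v \<in> keys \<mu> \<Longrightarrow> x v = y v) \<Longrightarrow> mon_eval x \<mu> = mon_eval y \<mu>"
  by (simp add: mon_eval_def)

lemma mpoly_eval_mon_eval:
  "mpoly_eval h x p = (\<Sum>\<mu>\<in>keys p. h (lookup p \<mu>) * mon_eval x \<mu>)"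
  by (simp add: mpoly_eval_def mon_eval_def)

abbreviation poly_at :: "(nat \<times> nat \<Rightarrow> 'a) \<Rightarrow> 'a::comm_ring_1 mpoly \<Rightarrow> 'a" where
  "poly_at \<equiv> mpoly_eval (\<lambda>c. c)"

lemma mpoly_eval_superset:
  assumes "h 0 = 0" "finite V" "keys p \<subseteq> V"
  shows "mpoly_eval h x p = (\<Sum>\<mu>\<in>V. h (lookup p \<mu>) * mon_eval x \<mu>)"
  unfolding mpoly_eval_mon_eval
  by (rule sum.mono_neutral_left) (use assms in \<open>auto simp: not_in_keys_iff_lookup_eq_zero\<close>)

lemma mpoly_eval_single:
  assumes "h 0 = 0"
  shows "mpoly_eval h x (Poly_Mapping.single \<mu> c) = h c * mon_eval x \<mu>"
  by (cases "c = 0") (auto simp: mpoly_eval_mon_eval assms)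

lemma sum_singles: "(\<Sum>\<mu>\<in>keys p. Poly_Mapping.single \<mu> (lookup p \<mu>)) = p"
  by (intro poly_mapping_eqI)
     (simp add: lookup_sum lookup_single when_def sum.delta not_in_keys_iff_lookup_eq_zero)

lemma mpoly_eval_hom:
  assumes "comm_ring_hom h"
  shows "comm_ring_hom (mpoly_eval h x)"
proof -
  interpret comm_ring_hom h by fact
  have add: "mpoly_eval h x (p + q) = mpoly_eval h x p + mpoly_eval h x q" for p q
  proof -
    let ?V = "keys p \<union> keys q"
    have "mpoly_eval h x (p + q) = (\<Sum>\<mu>\<in>?V. h (lookup (p + q) \<mu>) * mon_eval x \<mu>)"
      by (rule mpoly_eval_superset) (auto simp: keys_add)
    also have "\<dots> = (\<Sum>\<mu>\<in>?V. h (lookup p \<mu>) * mon_eval x \<mu>) +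
        (\<Sum>\<mu>\<in>?V. h (lookup q \<mu>) * mon_eval x \<mu>)"
      by (simp add: lookup_add hom_add distrib_right sum.distrib)
    also have "\<dots> = mpoly_eval h x p + mpoly_eval h x q"
      by (subst (1 2) mpoly_eval_superset[of h ?V]) auto
    finally show ?thesis .
  qed
  have zero: "mpoly_eval h x 0 = 0"
    by (simp add: mpoly_eval_def)
  have sum: "mpoly_eval h x (\<Sum>i\<in>I. f i) = (\<Sum>i\<in>I. mpoly_eval h x (f i))" if "finite I"
    for I :: "((nat \<times> nat) \<Rightarrow>\<^sub>0 nat) set" and f
    using that by induction (simp_all add: zero add)
  have mult: "mpoly_eval h x (p * q) = mpoly_eval h x p * mpoly_eval h x q" for p q
  proof -
    have "p * q = (\<Sum>\<mu>\<in>keys p. \<Sum>\<nu>\<in>keys q.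
        Poly_Mapping.single (\<mu> + \<nu>) (lookup p \<mu> * lookup q \<nu>))"
      by (subst sum_singles[of p, symmetric], subst sum_singles[of q, symmetric])
         (simp add: sum_product mult_single)
    then have "mpoly_eval h x (p * q) = (\<Sum>\<mu>\<in>keys p. \<Sum>\<nu>\<in>keys q.
        h (lookup p \<mu> * lookup q \<nu>) * mon_eval x (\<mu> + \<nu>))"
      by (simp add: sum mpoly_eval_single)
    also have "\<dots> = mpoly_eval h x p * mpoly_eval h x q"
      by (simp add: mpoly_eval_mon_eval sum_product hom_mult mon_eval_add ac_simps)
    finally show ?thesis .
  qed
  have one: "mpoly_eval h x 1 = 1"
    using mpoly_eval_single[of h x 0 1] by (simp add: single_one)
  show ?thesis
    by unfold_locales (fact zero one add mult)+
qed

lemma mpoly_eval_Const: "h 0 = 0 \<Longrightarrow> mpoly_eval h x (Const c) = h c"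
  by (simp add: Const_def mpoly_eval_single)

lemma mpoly_eval_Var: "h 0 = 0 \<Longrightarrow> h 1 = 1 \<Longrightarrow> mpoly_eval h x (Var v) = x v"
  by (simp add: Var_def mpoly_eval_single)

lemma Const_hom: "comm_ring_hom Const"
  by unfold_locales
     (auto simp: Const_def single_add mult_single[of 0 _ 0, simplified] single_one)

lemma id_hom: "comm_ring_hom (\<lambda>c::'a::comm_ring_1. c)"
  by unfold_locales auto

lemma to_fract_hom: "comm_ring_hom to_fract"
  by unfold_locales auto

lemma hom_mpoly_eval:
  assumes "comm_ring_hom g"
  shows "g (mpoly_eval h x p) = mpoly_eval (\<lambda>c. g (h c)) (\<lambda>v. g (x v)) p"
proof -
  interpret comm_ring_hom g by fact
  show ?thesis
    by (simp add: mpoly_eval_def hom_sum hom_mult hom_prod hom_power)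
qed

lemma mpoly_eval_cong:
  assumes "p \<in> carrier (mpoly_ring m d)" "\<And>i j. i < m \<Longrightarrow> j < d \<Longrightarrow> x (i, j) = y (i, j)"
  shows "mpoly_eval h x p = mpoly_eval h y p"
  unfolding mpoly_eval_mon_eval
proof (intro sum.cong refl arg_cong2[where f="(*)"] mon_eval_cong)
  fix \<mu> v assume "\<mu> \<in> keys p" "v \<in> keys \<mu>"
  with assms(1) have "v \<in> {..<m} \<times> {..<d}" by (auto simp: mpoly_ring_def)
  then show "x v = y v" using assms(2) by auto
qed

lemma Const_single: "Const c * Poly_Mapping.single \<mu> 1 = Poly_Mapping.single \<mu> c"
  by (simp add: Const_def mult_single)

lemma single_eq_mon_eval: "Poly_Mapping.single \<mu> 1 = mon_eval Var \<mu>"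
proof -
  have *: "Var v ^ e = Poly_Mapping.single (Poly_Mapping.single v e) 1" for v :: "nat \<times> nat" and e
    by (induction e) (auto simp: Var_def mult_single single_add[symmetric] single_one)
  have "(\<Prod>v\<in>V. Var v ^ lookup \<mu> v) =
      Poly_Mapping.single (\<Sum>v\<in>V. Poly_Mapping.single v (lookup \<mu> v)) (1::'a)"
    if "finite V" for V
    using that by induction (auto simp: * mult_single single_one)
  from this[of "keys \<mu>"] show ?thesis
    by (simp add: mon_eval_def sum_singles)
qed

lemma mpoly_eval_Const_Var: "mpoly_eval Const Var p = p"
proof -
  have "mpoly_eval Const Var p =
      (\<Sum>\<mu>\<in>keys p. Poly_Mapping.single \<mu> (lookup p \<mu>))"
    by (simp add: mpoly_eval_mon_eval single_eq_mon_eval[symmetric] Const_single)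
  then show ?thesis by (simp add: sum_singles)
qed

section \<open>Multihomogeneous polynomials\<close>

lemma carrier_mpoly_ring:
  "carrier (mpoly_ring m d) =
     {p. \<forall>\<mu>\<in>keys p. keys \<mu> \<subseteq> {..<m} \<times> {..<d}}"
  by (simp add: mpoly_ring_def)

lemma mpoly_ring_simps [simp]:
  "mult (mpoly_ring m d) = (*)" "one (mpoly_ring m d) = 1"
  "zero (mpoly_ring m d) = 0" "add (mpoly_ring m d) = (+)"
  by (simp_all add: mpoly_ring_def ring_record_simps)

lemma mpoly_ring_closed [simp, intro]:
  shows "0 \<in> carrier (mpoly_ring m d)" "1 \<in> carrier (mpoly_ring m d)"
    "p \<in> carrier (mpoly_ring m d) \<Longrightarrow> q \<in> carrier (mpoly_ring m d) \<Longrightarrow> p + q \<in> carrier (mpoly_ring m d)"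
    "p \<in> carrier (mpoly_ring m d) \<Longrightarrow> q \<in> carrier (mpoly_ring m d) \<Longrightarrow> p * q \<in> carrier (mpoly_ring m d)"
    "p \<in> carrier (mpoly_ring m d) \<Longrightarrow> - p \<in> carrier (mpoly_ring m d)"
    "p \<in> carrier (mpoly_ring m d) \<Longrightarrow> q \<in> carrier (mpoly_ring m d) \<Longrightarrow> p - q \<in> carrier (mpoly_ring m d)"
    "Const c \<in> carrier (mpoly_ring m d)"
    "i < m \<Longrightarrow> j < d \<Longrightarrow> Var (i, j) \<in> carrier (mpoly_ring m d)"
proof -
  show add: "p + q \<in> carrier (mpoly_ring m d)" if "p \<in> carrier (mpoly_ring m d)" "q
      \<in> carrier (mpoly_ring m d)" for p q
    using that keys_add[of p q] unfolding carrier_mpoly_ring by blast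
  show "p * q \<in> carrier (mpoly_ring m d)" if pq: "p \<in> carrier (mpoly_ring m d)" "q
      \<in> carrier (mpoly_ring m d)" for p q
    unfolding carrier_mpoly_ring
  proof (intro CollectI ballI)
    fix \<mu> assume "\<mu> \<in> keys (p * q)"
    then obtain a b where ab: "\<mu> = a + b" "a \<in> keys p" "b \<in> keys q"
      using keys_mult[of p q] by auto
    with pq keys_add[of a b] show "keys \<mu> \<subseteq> {..<m} \<times> {..<d}"
      unfolding carrier_mpoly_ring by blast
  qed
  show uminus: "- p \<in> carrier (mpoly_ring m d)" if "p \<in> carrier (mpoly_ring m d)" for p
    using that unfolding carrier_mpoly_ring by (auto simp: in_keys_iff)
  show "p - q \<in> carrier (mpoly_ring m d)" if "p \<in> carrier (mpoly_ring m d)" "q \<in> carrier (mpoly_ring m d)"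
    using add[OF that(1) uminus[OF that(2)]] by simp
qed (auto simp: carrier_mpoly_ring Const_def Var_def)

lemma mpoly_ring_cring: "cring (mpoly_ring m d)"
proof (rule cringI)
  show "abelian_group (mpoly_ring m d)"
    by (rule abelian_groupI) (auto simp: add.assoc add.commute intro: bexI[of _ "- _"])
  show "Group.comm_monoid (mpoly_ring m d)"
    by (rule Group.comm_monoidI) (auto simp: mult.assoc mult.commute)
qed (auto simp: distrib_right)

lemma multihomogeneous_carrier: "multihomogeneous m d e p \<Longrightarrow> p \<in> carrier (mpoly_ring m d)"
  by (simp add: multihomogeneous_def)

lemma multiforms_carrier: "p \<in> multiforms m d \<Longrightarrow> p \<in> carrier (mpoly_ring m d)"
  by (auto simp: multiforms_def multihomogeneous_def)

lemma multihomogeneous_0: "multihomogeneous m d e 0"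
  by (auto simp: multihomogeneous_def)

lemma multihomogeneous_add:
  assumes "multihomogeneous m d e p" "multihomogeneous m d e q"
  shows "multihomogeneous m d e (p + q)"
  using assms keys_add[of p q] unfolding multihomogeneous_def by blast

lemma multihomogeneous_sum:
  "(\<And>a. a \<in> S \<Longrightarrow> multihomogeneous m d e (f a)) \<Longrightarrow> multihomogeneous m d e (\<Sum>a\<in>S. f a)"
  by (induction S rule: infinite_finite_induct) (auto simp: multihomogeneous_0 multihomogeneous_add)

lemma multihomogeneous_uminus: "multihomogeneous m d e p \<Longrightarrow> multihomogeneous m d e (- p)"
  by (auto simp: multihomogeneous_def in_keys_iff)

lemma multihomogeneous_diff:
  "multihomogeneous m d e p \<Longrightarrow> multihomogeneous m d e q \<Longrightarrow> multihomogeneous m d e (p - q)"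
  using multihomogeneous_add[OF _ multihomogeneous_uminus] by fastforce

lemma multihomogeneous_Const: "(\<And>i. i < m \<Longrightarrow> e i = 0) \<Longrightarrow> multihomogeneous m d e (Const c)"
  unfolding multihomogeneous_def carrier_mpoly_ring by (auto simp: Const_def split: if_splits)

lemma multihomogeneous_Var:
  assumes "i < m" "j < d" "\<And>i'. i' < m \<Longrightarrow> e i' = (if i' = i then 1 else 0)"
  shows "multihomogeneous m d e (Var (i, j))"
proof -
  have "(\<Sum>l<d. lookup (Poly_Mapping.single (i, j) (Suc 0)) (i', l)) = (if i' = i then 1 else 0)" for i'
    using assms(2) by (cases "i' = i") (auto simp: lookup_single when_def)
  with assms show ?thesis
    unfolding multihomogeneous_def carrier_mpoly_ring by (auto simp: Var_def)
qed

lemma multihomogeneous_mult: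
  assumes p: "multihomogeneous m d e p" and q: "multihomogeneous m d e' q"
    and e: "\<And>i. i < m \<Longrightarrow> e'' i = e i + e' i"
  shows "multihomogeneous m d e'' (p * q)"
  unfolding multihomogeneous_def
proof (intro conjI ballI allI impI)
  show "p * q \<in> carrier (mpoly_ring m d)"
    using p q by (simp add: multihomogeneous_def mpoly_ring_closed(4))
  fix \<mu> i assume \<mu>: "\<mu> \<in> keys (p * q)" and i: "i < m"
  obtain a b where ab: "\<mu> = a + b" "a \<in> keys p" "b \<in> keys q"
    using keys_mult[of p q] \<mu> by auto
  have "(\<Sum>j<d. lookup a (i, j)) = e i" "(\<Sum>j<d. lookup b (i, j)) = e' i"
    using p q ab i by (auto simp: multihomogeneous_def)
  then show "(\<Sum>j<d. lookup \<mu> (i, j)) = e'' i"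
    using ab e[OF i] by (simp add: lookup_add sum.distrib)
qed

lemma multihomogeneous_prod:
  assumes "\<And>a. a \<in> S \<Longrightarrow> multihomogeneous m d (e a) (f a)"
    "\<And>i. i < m \<Longrightarrow> e' i = (\<Sum>a\<in>S. e a i)"
  shows "multihomogeneous m d e' (\<Prod>a\<in>S. f a)"
  using assms
proof (induction S arbitrary: e' rule: infinite_finite_induct)
  case (insert x F)
  show ?case
    using multihomogeneous_mult[OF insert.prems(1)[of x] insert.IH, of "\<lambda>i. \<Sum>a\<in>F. e a i"] insert
    by simp
qed (use multihomogeneous_Const[of m _ d 1] in \<open>auto simp: Const_def single_one\<close>)

lemma multihomogeneous_power:
  assumes "multihomogeneous m d e f" "\<And>i. i < m \<Longrightarrow> e' i = r * e i"
  shows "multihomogeneous m d e' (f ^ r)"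
  using multihomogeneous_prod[of "{..<r}" m d "\<lambda>_. e" "\<lambda>_. f" e'] assms by simp

lemma multihomogeneous_Const_mult:
  "multihomogeneous m d e p \<Longrightarrow> multihomogeneous m d e (Const c * p)"
  by (rule multihomogeneous_mult[OF multihomogeneous_Const[of m "\<lambda>_. 0"]]) auto

lemma multiforms_mult: "p \<in> multiforms m d \<Longrightarrow> q \<in> multiforms m d \<Longrightarrow> p * q \<in> multiforms m d"
  unfolding multiforms_def using multihomogeneous_mult[of m d _ p _ q "\<lambda>i. _ i + _ i"] by blast

lemma multiforms_Const: "Const c \<in> multiforms m d"
  unfolding multiforms_def using multihomogeneous_Const[of m "\<lambda>_. 0"] by blast

lemma multiforms_1: "1 \<in> multiforms m d"
  using multiforms_Const[of 1] by (simp add: Const_def single_one)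

lemma mon_eval_scale:
  fixes \<mu> :: "(nat \<times> nat) \<Rightarrow>\<^sub>0 nat"
  assumes "keys \<mu> \<subseteq> {..<m} \<times> {..<d}"
  shows "mon_eval (\<lambda>(i, j). s i * x (i, j)) \<mu> =
    (\<Prod>i<m. s i ^ (\<Sum>j<d. lookup \<mu> (i, j))) * mon_eval x \<mu>"
proof -
  have "mon_eval (\<lambda>(i, j). s i * x (i, j)) \<mu> = mon_eval (\<lambda>v. s (fst v)) \<mu> * mon_eval x \<mu>"
    by (simp add: mon_eval_mult[symmetric] case_prod_unfold)
  also have "mon_eval (\<lambda>v. s (fst v)) \<mu> =
      (\<Prod>v\<in>{..<m} \<times> {..<d}. s (fst v) ^ lookup \<mu> v)"
    by (rule mon_eval_superset) (use assms in auto)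
  also have "\<dots> = (\<Prod>i<m. \<Prod>j<d. s i ^ lookup \<mu> (i, j))"
    by (simp add: prod.cartesian_product case_prod_unfold)
  also have "\<dots> = (\<Prod>i<m. s i ^ (\<Sum>j<d. lookup \<mu> (i, j)))"
    by (simp add: power_sum)
  finally show ?thesis .
qed

text \<open>This is multihomogeneity in the form used throughout: scaling factor \<open>i\<close> by
  \<open>s i\<close> multiplies the value by a character of \<open>s\<close> that depends on the
  multidegree alone. The scalars live in any commutative ring and are later also
  polynomials.\<close>

lemma mpoly_eval_scale:
  assumes "multihomogeneous m d e f"
  shows "mpoly_eval h (\<lambda>(i, j). s i * x (i, j)) f = (\<Prod>i<m. s i ^ e i) * mpoly_eval h x f"
proof -
  have "mon_eval (\<lambda>(i, j). s i * x (i, j)) \<mu> = (\<Prod>i<m. s i ^ e i) * mon_eval x \<mu>"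
    if "\<mu> \<in> keys f" for \<mu>
    using that assms by (subst mon_eval_scale[of _ m d])
      (auto simp: multihomogeneous_def carrier_mpoly_ring intro!: prod.cong arg_cong2[where f="(*)"])
  then show ?thesis
    unfolding mpoly_eval_mon_eval sum_distrib_left
    by (intro sum.cong) (auto simp: ac_simps)
qed

text \<open>Row \<open>\<epsilon> i\<close> is the multidegree of everything that is substituted for
  the variables of factor \<open>i\<close>, so \<open>e\<close> gets multiplied by the matrix
  \<open>\<epsilon>\<close>. Substitutions of variables, of linear forms and of the eliminating
  forms are instances.\<close>

lemma multihomogeneous_mpoly_eval:
  assumes f: "multihomogeneous m' d' e f"
    and u: "\<And>i j. i < m' \<Longrightarrow> j < d' \<Longrightarrow> multihomogeneous m d (\<epsilon> i) (u (i, j))"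
    and e': "\<And>a. a < m \<Longrightarrow> e' a = (\<Sum>i<m'. e i * \<epsilon> i a)"
  shows "multihomogeneous m d e' (mpoly_eval (\<lambda>c. Const (h c)) u f)"
  unfolding mpoly_eval_mon_eval
proof (intro multihomogeneous_sum multihomogeneous_Const_mult)
  fix \<mu> assume \<mu>: "\<mu> \<in> keys f"
  with f have k: "keys \<mu> \<subseteq> {..<m'} \<times> {..<d'}"
    and e: "\<And>i. i < m' \<Longrightarrow> (\<Sum>j<d'. lookup \<mu> (i, j)) = e i"
    by (auto simp: multihomogeneous_def carrier_mpoly_ring)
  have *: "mon_eval u \<mu> = (\<Prod>v\<in>{..<m'} \<times> {..<d'}. u v ^ lookup \<mu> v)"
    by (rule mon_eval_superset) (use k in auto)
  show "multihomogeneous m d e' (mon_eval u \<mu>)"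
    unfolding *
  proof (rule multihomogeneous_prod)
    fix v assume "v \<in> {..<m'} \<times> {..<d'}"
    then show "multihomogeneous m d (\<lambda>a. lookup \<mu> v * \<epsilon> (fst v) a) (u v ^ lookup \<mu> v)"
      by (cases v) (auto intro!: multihomogeneous_power u)
  next
    fix a assume a: "a < m"
    have "(\<Sum>v\<in>{..<m'} \<times> {..<d'}. lookup \<mu> v * \<epsilon> (fst v) a)
       = (\<Sum>i<m'. \<Sum>j<d'. lookup \<mu> (i, j) * \<epsilon> i a)"
      by (simp add: sum.cartesian_product case_prod_unfold)
    also have "\<dots> = e' a" by (simp add: sum_distrib_right[symmetric] e e' a)
    finally show "e' a = (\<Sum>v\<in>{..<m'} \<times> {..<d'}. lookup \<mu> v * \<epsilon> (fst v) a)" ..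
  qed
qed

lemma multihomogeneous_map_coeffs:
  assumes "multihomogeneous m d e f"
  shows "multihomogeneous m d e (mpoly_eval (\<lambda>c. Const (h c)) Var f)"
proof (rule multihomogeneous_mpoly_eval[OF assms, where \<epsilon> = "\<lambda>i a. if a = i then 1 else 0"])
  show "multihomogeneous m d (\<lambda>a. if a = i then 1 else 0) (Var (i, j))" if "i < m" "j < d" for i j
    using that by (intro multihomogeneous_Var) auto
qed (simp add: if_distrib cong: if_cong)

section \<open>Polynomial functions over an infinite field\<close>

text \<open>Dedekind's independence of characters, with \<open>cmp\<close> as the operation. It
  serves twice: monomials are characters of coordinate functions under the pointwise product, and
  multidegrees are characters of the scalars of the factors.\<close>

lemma characters_independent:
  fixes \<chi> :: "'a \<Rightarrow> 'x \<Rightarrow> 'b::idom"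
  assumes "finite K"
    and mult: "\<And>k x y. k \<in> K \<Longrightarrow> \<chi> k (cmp x y) = \<chi> k x * \<chi> k y"
    and one: "\<And>k. k \<in> K \<Longrightarrow> \<chi> k e = 1"
    and dist: "\<And>k l. k \<in> K \<Longrightarrow> l \<in> K \<Longrightarrow> k \<noteq> l \<Longrightarrow> \<exists>x. \<chi> k x \<noteq> \<chi> l x"
    and zero: "\<And>x. (\<Sum>k\<in>K. c k * \<chi> k x) = 0"
  shows "\<forall>k\<in>K. c k = 0"
  using assms
proof (induction K arbitrary: c rule: finite_induct)
  case (insert a F)
  have F: "c b = 0" if b: "b \<in> F" for b
  proof -
    obtain x where x: "\<chi> b x \<noteq> \<chi> a x"
      using insert.prems(3)[of b a] insert.hyps b by auto
    \<comment> \<open>Subtracting \<open>\<chi> a x\<close> times the relation at \<open>y\<close>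
      from the relation at \<open>cmp x y\<close> removes the character \<open>a\<close>.\<close>
    have "\<forall>k\<in>F. c k * (\<chi> k x - \<chi> a x) = 0"
    proof (rule insert.IH)
      fix y
      have "(\<Sum>k\<in>insert a F. c k * \<chi> k (cmp x y)) - \<chi> a x * (\<Sum>k\<in>insert a F. c k * \<chi> k y) = 0"
        using insert.prems(4) by simp
      also have "(\<Sum>k\<in>insert a F. c k * \<chi> k (cmp x y)) = (\<Sum>k\<in>insert a F. c k * (\<chi> k x * \<chi> k y))"
        using insert.prems(1) by (intro sum.cong) auto
      also have "\<dots> - \<chi> a x * (\<Sum>k\<in>insert a F. c k * \<chi> k y) =
          (\<Sum>k\<in>F. c k * (\<chi> k x - \<chi> a x) * \<chi> k y)"
        using insert.hyps by (simp add: sum_distrib_left sum_subtractf algebra_simps)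
      finally show "(\<Sum>k\<in>F. c k * (\<chi> k x - \<chi> a x) * \<chi> k y) = 0" .
    qed (use insert.prems in auto)
    with b x show ?thesis by auto
  qed
  have "(\<Sum>k\<in>insert a F. c k * \<chi> k e) = c a"
    using insert.hyps insert.prems(2)[of a] F by simp
  with insert.prems(4) F show ?case by auto
qed simp

lemma powers_distinct:
  assumes "infinite (UNIV :: 'b::field set)" "a \<noteq> b"
  shows "\<exists>t::'b. t ^ a \<noteq> t ^ b"
proof (rule ccontr)
  assume "\<not> ?thesis"
  then have "{t::'b. poly (Polynomial.monom 1 a - Polynomial.monom 1 b) t = 0} = UNIV"
    by (auto simp: poly_monom)
  moreover have "Polynomial.monom (1::'b) a - Polynomial.monom 1 b \<noteq> 0"
    using assms(2) by (auto simp: Polynomial.monom_eq_iff')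
  ultimately show False using poly_roots_finite assms(1) by metis
qed

text \<open>Distinct monomials are distinct characters over an infinite field. The coefficient map
  may have a kernel: for \<open>res\<close> the conclusion is that all coefficients lie in the
  maximal ideal.\<close>

lemma mpoly_eval_all_zero:
  fixes h :: "'a::comm_ring_1 \<Rightarrow> 'b::field"
  assumes inf: "infinite (UNIV :: 'b set)" and zero: "\<And>x. mpoly_eval h x p = 0" and h: "h 0 = 0"
  shows "h (lookup p \<mu>) = 0"
proof (cases "\<mu> \<in> keys p")
  case True
  have "\<forall>\<mu>\<in>keys p. h (lookup p \<mu>) = 0"
  proof (rule characters_independent[where \<chi> = "\<lambda>\<mu> x. mon_eval x \<mu>"
        and cmp = "\<lambda>x y v. x v * y v" and e = "\<lambda>v. 1"])
    fix \<mu> \<nu> :: "(nat \<times> nat) \<Rightarrow>\<^sub>0 nat" assume "\<mu> \<noteq> \<nu>"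
    then obtain v where "lookup \<mu> v \<noteq> lookup \<nu> v"
      by (meson poly_mapping_eqI)
    then obtain t :: 'b where t: "t ^ lookup \<mu> v \<noteq> t ^ lookup \<nu> v"
      using powers_distinct[OF inf] by blast
    \<comment> \<open>Setting all variables but \<open>v\<close> to 1 reads off the exponent of
      \<open>v\<close>.\<close>
    have "mon_eval (\<lambda>u. if u = v then t else 1) \<kappa> = t ^ lookup \<kappa> v" for \<kappa>
    proof -
      have "mon_eval (\<lambda>u. if u = v then t else 1) \<kappa> =
          (\<Prod>u\<in>insert v (keys \<kappa>). (if u = v then t else 1) ^ lookup \<kappa> u)"
        by (rule mon_eval_superset) auto
      also have "\<dots> = (\<Prod>u\<in>insert v (keys \<kappa>). if u = v then t ^ lookup \<kappa> u else 1)"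
        by (intro prod.cong) auto
      finally show ?thesis by simp
    qed
    with t show "\<exists>x::nat \<times> nat \<Rightarrow> 'b. mon_eval x \<mu> \<noteq> mon_eval x \<nu>" by metis
  next
    fix x show "(\<Sum>\<mu>\<in>keys p. h (lookup p \<mu>) * mon_eval x \<mu>) = 0"
      using zero[of x] by (simp add: mpoly_eval_mon_eval)
  qed (simp_all add: mon_eval_mult)
  with True show ?thesis by blast
qed (simp add: in_keys_iff h)

section \<open>Polynomial functions of one parameter\<close>

definition polyfun :: "('b::comm_ring_1 \<Rightarrow> 'b) \<Rightarrow> bool" where
  "polyfun \<phi> \<longleftrightarrow> (\<exists>p. \<forall>t. \<phi> t = poly p t)"

lemma polyfun_const: "polyfun (\<lambda>t. c)"
  unfolding polyfun_def by (rule exI[of _ "[:c:]"]) simp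

lemma polyfun_id: "polyfun (\<lambda>t. t)"
  unfolding polyfun_def by (rule exI[of _ "[:0, 1:]"]) simp

lemma polyfun_add: "polyfun f \<Longrightarrow> polyfun g \<Longrightarrow> polyfun (\<lambda>t. f t + g t)"
  unfolding polyfun_def by (metis poly_add)

lemma polyfun_mult: "polyfun f \<Longrightarrow> polyfun g \<Longrightarrow> polyfun (\<lambda>t. f t * g t)"
  unfolding polyfun_def by (metis poly_mult)

lemma polyfun_uminus: "polyfun f \<Longrightarrow> polyfun (\<lambda>t. - f t)"
  unfolding polyfun_def by (metis poly_minus)

lemma polyfun_sum: "(\<And>a. a \<in> S \<Longrightarrow> polyfun (f a)) \<Longrightarrow> polyfun (\<lambda>t. \<Sum>a\<in>S. f a t)"
  by (induction S rule: infinite_finite_induct) (auto intro: polyfun_const polyfun_add)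

lemma polyfun_prod: "(\<And>a. a \<in> S \<Longrightarrow> polyfun (f a)) \<Longrightarrow> polyfun (\<lambda>t. \<Prod>a\<in>S. f a t)"
  by (induction S rule: infinite_finite_induct) (auto intro: polyfun_const polyfun_mult)

lemma polyfun_power: "polyfun f \<Longrightarrow> polyfun (\<lambda>t. f t ^ r)"
  by (induction r) (auto intro: polyfun_const polyfun_mult)

lemma polyfun_mpoly_eval: "(\<And>v. polyfun (\<lambda>t. x t v)) \<Longrightarrow> polyfun (\<lambda>t. mpoly_eval h (x t) p)"
  unfolding mpoly_eval_def
  by (intro polyfun_sum polyfun_mult polyfun_const polyfun_prod polyfun_power)

lemma polyfun_det:
  assumes "\<And>t. M t \<in> carrier_mat N N"
    "\<And>i j. i < N \<Longrightarrow> j < N \<Longrightarrow> polyfun (\<lambda>t. M t $$ (i, j))"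
  shows "polyfun (\<lambda>t. det (M t))"
proof -
  have "polyfun (\<lambda>t. \<Sum>p\<in>{p. p permutes {0..<N}}. signof p * (\<Prod>i = 0..<N. M t $$ (i, p i)))"
    by (intro polyfun_sum polyfun_mult polyfun_const polyfun_prod assms) (auto simp: permutes_in_image)
  then show ?thesis by (simp add: det_def'[OF assms(1)])
qed

lemmas polyfun_intros = polyfun_const polyfun_id polyfun_add polyfun_mult polyfun_uminus
  polyfun_sum polyfun_prod polyfun_power

text \<open>Each of the finitely many nonzero polynomials has finitely many roots, and the field is
  infinite. General position of points is obtained from this by restriction to a line or a
  curve.\<close>

lemma polyfun_prod_nonzero:
  fixes f :: "'a \<Rightarrow> 'b::field \<Rightarrow> 'b"
  assumes inf: "infinite (UNIV :: 'b set)" and "finite I"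
    and f: "\<And>i. i \<in> I \<Longrightarrow> polyfun (f i)" "\<And>i. i \<in> I \<Longrightarrow> \<exists>t. f i t \<noteq> 0"
  shows "\<exists>t. \<forall>i\<in>I. f i t \<noteq> 0"
proof -
  obtain p where p: "\<And>i t. i \<in> I \<Longrightarrow> f i t = poly (p i) t"
    using f(1) unfolding polyfun_def by metis
  have "finite (\<Union>i\<in>I. {t. poly (p i) t = 0})"
    using assms(2) f(2) p by (intro finite_UN_I poly_roots_finite) fastforce+
  then obtain t where "t \<notin> (\<Union>i\<in>I. {t. poly (p i) t = 0})"
    using inf by (metis ex_new_if_finite)
  then show ?thesis using p by auto
qed

lemma polyfun_both_nonzero:
  fixes f g :: "'b::field \<Rightarrow> 'b"
  assumes "infinite (UNIV :: 'b set)" "polyfun f" "polyfun g" "f a \<noteq> 0" "g b \<noteq> 0"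
  shows "\<exists>t. f t \<noteq> 0 \<and> g t \<noteq> 0"
proof -
  have "\<exists>t. \<forall>i\<in>{True, False}. (if i then f else g) t \<noteq> 0"
    by (rule polyfun_prod_nonzero) (use assms in auto)
  then show ?thesis by auto
qed

section \<open>Homogeneous ideals of sets of points\<close>

lemma ideal_mpoly_ringI:
  fixes I :: "'a::comm_ring_1 mpoly set"
  assumes "I \<subseteq> carrier (mpoly_ring m d)" "0 \<in> I" "\<And>p q. p \<in> I \<Longrightarrow> q \<in> I \<Longrightarrow> p + q \<in> I"
    and m: "\<And>p q. p \<in> carrier (mpoly_ring m d) \<Longrightarrow> q \<in> I \<Longrightarrow> p * q \<in> I"
  shows "ideal I (mpoly_ring m d)"
proof (rule idealI)
  interpret cring "mpoly_ring m d" by (rule mpoly_ring_cring)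
  show "ring (mpoly_ring m d)" by (rule ring_axioms)
  have "- p \<in> I" if "p \<in> I" for p
    using m[of "- 1" p] that by auto
  moreover have "\<ominus>\<^bsub>mpoly_ring m d\<^esub> p = - p" if "p \<in> I" for p
    using that assms(1) by (intro minus_equality) auto
  ultimately show "subgroup I (add_monoid (mpoly_ring m d))"
    using assms by (intro add.subgroupI) (auto simp: a_inv_def[symmetric])
  fix p q :: "'a mpoly" assume "p \<in> I" "q \<in> carrier (mpoly_ring m d)"
  then have "q * p \<in> I" by (rule m[rotated])
  then show "q \<otimes>\<^bsub>mpoly_ring m d\<^esub> p \<in> I" "p \<otimes>\<^bsub>mpoly_ring m d\<^esub> q \<in> I"
    by (simp_all add: mult.commute)
qed

lemma ideal_mpoly_ringD:
  assumes "ideal I (mpoly_ring m d)"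
  shows "I \<subseteq> carrier (mpoly_ring m d)" "0 \<in> I"
    "p \<in> I \<Longrightarrow> q \<in> I \<Longrightarrow> p + q \<in> I"
    "p \<in> carrier (mpoly_ring m d) \<Longrightarrow> q \<in> I \<Longrightarrow> p * q \<in> I"
    "q \<in> I \<Longrightarrow> - q \<in> I"
    "p \<in> I \<Longrightarrow> q \<in> I \<Longrightarrow> p - q \<in> I"
proof -
  interpret ideal I "mpoly_ring m d" by fact
  show sub: "I \<subseteq> carrier (mpoly_ring m d)" using a_subset .
  show "0 \<in> I" using additive_subgroup.zero_closed[OF is_additive_subgroup] by simp
  show add: "p + q \<in> I" if "p \<in> I" "q \<in> I" for p q
    using additive_subgroup.a_closed[OF is_additive_subgroup that] by simp
  show mult: "p * q \<in> I" if "p \<in> carrier (mpoly_ring m d)" "q \<in> I" for p q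
    using I_l_closed that by simp
  show neg: "- q \<in> I" if "q \<in> I" for q
    using mult[of "- 1" q] that by auto
  show "p - q \<in> I" if "p \<in> I" "q \<in> I"
    using add[OF that(1) neg[OF that(2)]] by simp
qed

lemma ideal_mpoly_ring_sum:
  assumes "ideal I (mpoly_ring m d)" "\<And>a. a \<in> S \<Longrightarrow> f a \<in> I"
  shows "(\<Sum>a\<in>S. f a) \<in> I"
  using assms(2)
  by (induction S rule: infinite_finite_induct) (auto simp: ideal_mpoly_ringD[OF assms(1)])

text \<open>The free scalar for each factor replaces \<open>S\<close> by its multicone; otherwise a
  polynomial that is not multihomogeneous could vanish on \<open>S\<close> although its parts do
  not. With \<open>h = res\<close> these ideals contain the maximal ideal of R and describe the
  special fibre, with \<open>h = to_fract\<close> they describe the generic fibre.\<close>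

definition vanishing_ideal ::
    "('a::comm_ring_1 \<Rightarrow> 'b::field) \<Rightarrow> nat \<Rightarrow> nat \<Rightarrow> (nat \<times> nat \<Rightarrow> 'b) set \<Rightarrow> 'a mpoly set" where
  "vanishing_ideal h m d S = {f \<in> carrier (mpoly_ring m d).
     \<forall>x\<in>S. \<forall>s. mpoly_eval h (\<lambda>(i, j). s i * x (i, j)) f = 0}"

lemma vanishing_ideal_form:
  assumes "f \<in> multiforms m d"
  shows "f \<in> vanishing_ideal h m d S \<longleftrightarrow> (\<forall>x\<in>S. mpoly_eval h x f = 0)"
proof -
  obtain e where e: "multihomogeneous m d e f" using assms by (auto simp: multiforms_def)
  have "mpoly_eval h x f = 0" if "\<forall>s. mpoly_eval h (\<lambda>(i, j). s i * x (i, j)) f = 0" for x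
    using that[rule_format, of "\<lambda>_. 1"] by simp
  then show ?thesis
    unfolding vanishing_ideal_def using multihomogeneous_carrier[OF e] mpoly_eval_scale[OF e, of h] by auto
qed

lemma vanishing_ideal_ideal:
  assumes "comm_ring_hom h"
  shows "ideal (vanishing_ideal h m d S) (mpoly_ring m d)"
proof (rule ideal_mpoly_ringI)
  have *: "comm_ring_hom (mpoly_eval h x)" for x by (rule mpoly_eval_hom[OF assms])
  show "0 \<in> vanishing_ideal h m d S"
    by (auto simp: vanishing_ideal_def mpoly_eval_def)
  show "p + q \<in> vanishing_ideal h m d S" if "p \<in> vanishing_ideal h m d S" "q \<in> vanishing_ideal h m d S"
      for p q
  proof -
    have "mpoly_eval h x (p + q) = mpoly_eval h x p + mpoly_eval h x q" for x
    proof - interpret comm_ring_hom "mpoly_eval h x" by (rule *) show ?thesis by (rule hom_add) qed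
    with that show ?thesis by (auto simp: vanishing_ideal_def)
  qed
  show "p * q \<in> vanishing_ideal h m d S" if "p \<in> carrier (mpoly_ring m d)" "q \<in> vanishing_ideal h m d S"
      for p q
  proof -
    have "mpoly_eval h x (p * q) = mpoly_eval h x p * mpoly_eval h x q" for x
    proof - interpret comm_ring_hom "mpoly_eval h x" by (rule *) show ?thesis by (rule hom_mult) qed
    with that show ?thesis by (auto simp: vanishing_ideal_def)
  qed
qed (auto simp: vanishing_ideal_def)

definition homogeneous_part :: "nat \<Rightarrow> nat \<Rightarrow> (nat \<Rightarrow> nat) \<Rightarrow> 'a::comm_ring_1 mpoly \<Rightarrow> 'a mpoly" where
  "homogeneous_part m d e p = (\<Sum>\<mu> | \<mu> \<in> keys p \<and>
     (\<forall>i<m. (\<Sum>j<d. lookup \<mu> (i, j)) = e i). Poly_Mapping.single \<mu> (lookup p \<mu>))"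

lemma multihomogeneous_part:
  assumes "p \<in> carrier (mpoly_ring m d)"
  shows "multihomogeneous m d e (homogeneous_part m d e p)"
  unfolding homogeneous_part_def
proof (rule multihomogeneous_sum)
  fix \<mu> assume "\<mu> \<in> {\<mu> \<in> keys p. \<forall>i<m. (\<Sum>j<d. lookup \<mu> (i, j)) = e i}"
  with assms show "multihomogeneous m d e (Poly_Mapping.single \<mu> (lookup p \<mu>))"
    unfolding multihomogeneous_def carrier_mpoly_ring by auto
qed

text \<open>Multidegrees are normalised to vanish from index \<open>m\<close> on. Two different ones
  then differ at an actual factor, on which the independence of their characters rests.\<close>

lemma homogeneous_decomposition:
  fixes p :: "'a::comm_ring_1 mpoly"
  assumes "p \<in> carrier (mpoly_ring m d)"
  obtains D where "finite D" "\<And>e i. e \<in> D \<Longrightarrow> i \<ge> m \<Longrightarrow> e i = 0"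
    "p = (\<Sum>e\<in>D. homogeneous_part m d e p)"
proof
  define deg :: "(nat \<times> nat \<Rightarrow>\<^sub>0 nat) \<Rightarrow> nat \<Rightarrow> nat" where
    "deg \<mu> = (\<lambda>i. if i < m then \<Sum>j<d. lookup \<mu> (i, j) else 0)" for \<mu>
  define D where "D = deg ` keys p"
  show "finite D" by (simp add: D_def)
  show D: "e i = 0" if "e \<in> D" "i \<ge> m" for e i using that by (auto simp: D_def deg_def)
  have "p = (\<Sum>\<mu>\<in>keys p. Poly_Mapping.single \<mu> (lookup p \<mu>))"
    by (rule sum_singles[symmetric])
  also have "\<dots> = (\<Sum>e\<in>D. \<Sum>\<mu> | \<mu> \<in> keys p \<and> deg \<mu> = e. Poly_Mapping.single \<mu> (lookup p \<mu>))"
    unfolding D_def by (rule sum.image_gen) simp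
  also have "\<dots> = (\<Sum>e\<in>D. homogeneous_part m d e p)"
    unfolding homogeneous_part_def
  proof (intro sum.cong refl Collect_cong conj_cong)
    fix e \<mu> assume "e \<in> D"
    with D show "deg \<mu> = e \<longleftrightarrow> (\<forall>i<m. (\<Sum>j<d. lookup \<mu> (i, j)) = e i)"
      by (fastforce simp: deg_def fun_eq_iff)
  qed
  finally show "p = (\<Sum>e\<in>D. homogeneous_part m d e p)" .
qed

text \<open>For fixed \<open>x\<close> the value at the scaled point is a combination of the
  characters \<open>\<Prod>i<m. s i ^ e i\<close> with the values of the parts as coefficients. It
  is zero for all \<open>s\<close>, so by independence each coefficient is zero.\<close>

lemma homogeneous_part_vanishing:
  fixes h :: "'a::comm_ring_1 \<Rightarrow> 'b::field"
  assumes inf: "infinite (UNIV :: 'b set)" and h: "comm_ring_hom h"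
    and p: "p \<in> vanishing_ideal h m d S" and D: "finite D" "\<And>e i. e \<in> D \<Longrightarrow> i \<ge> m \<Longrightarrow> e i = 0"
    "p = (\<Sum>e\<in>D. homogeneous_part m d e p)"
    and e: "e \<in> D"
  shows "homogeneous_part m d e p \<in> vanishing_ideal h m d S"
proof -
  have c: "p \<in> carrier (mpoly_ring m d)" using p by (simp add: vanishing_ideal_def)
  note hp = multihomogeneous_part[OF c]
  have "mpoly_eval h x (homogeneous_part m d e p) = 0" if x: "x \<in> S" for x
  proof -
    have "\<forall>e\<in>D. mpoly_eval h x (homogeneous_part m d e p) = 0"
    proof (rule characters_independent[where \<chi> = "\<lambda>e s. \<Prod>i<m. s i ^ e i" and cmp = "\<lambda>x y v. x v * y v"
      and e = "\<lambda>_. 1"])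
      fix k l assume "k \<in> D" "l \<in> D" "k \<noteq> l"
      then obtain i where i: "i < m" "k i \<noteq> l i" using D(2) by (metis ext linorder_not_le)
      obtain t :: 'b where t: "t ^ k i \<noteq> t ^ l i" using powers_distinct[OF inf i(2)] by blast
      have "(\<Prod>i'<m. (if i' = i then t else 1) ^ r i') = t ^ r i" for r :: "nat \<Rightarrow> nat"
      proof -
        have "(\<Prod>i'<m. (if i' = i then t else 1) ^ r i') = (\<Prod>i'<m. if i' = i then t ^ r i' else 1)"
          by (intro prod.cong) auto
        then show ?thesis using i by simp
      qed
      with t show "\<exists>s::nat \<Rightarrow> 'b. (\<Prod>i<m. s i ^ k i) \<noteq> (\<Prod>i<m. s i ^ l i)" by metis
    next
      fix s :: "nat \<Rightarrow> 'b"
      interpret E: comm_ring_hom "mpoly_eval h (\<lambda>(i, j). s i * x (i, j))" by (rule mpoly_eval_hom[OF h])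
      have "0 = mpoly_eval h (\<lambda>(i, j). s i * x (i, j)) p"
        using p x by (simp add: vanishing_ideal_def)
      also have "\<dots> = (\<Sum>e\<in>D. mpoly_eval h (\<lambda>(i, j). s i * x (i, j)) (homogeneous_part m d e p))"
        by (subst D(3)) (rule E.hom_sum)
      also have "\<dots> = (\<Sum>e\<in>D. mpoly_eval h x (homogeneous_part m d e p) * (\<Prod>i<m. s i ^ e i))"
        by (simp add: mpoly_eval_scale[OF hp] mult.commute)
      finally show "(\<Sum>e\<in>D. mpoly_eval h x (homogeneous_part m d e p) * (\<Prod>i<m. s i ^ e i)) = 0" by simp
    qed (simp_all add: D power_mult_distrib prod.distrib)
    with e show ?thesis by blast
  qed
  moreover have "homogeneous_part m d e p \<in> multiforms m d"
    using hp by (auto simp: multiforms_def)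
  ultimately show ?thesis by (simp add: vanishing_ideal_form)
qed

text \<open>This gives vanishing ideals the shape demanded by \<open>multiproj\<close>,
  \<open>diagonal_map\<close> and \<open>residue_point\<close>, which all speak of ideals generated
  by forms.\<close>

lemma vanishing_ideal_generated:
  fixes h :: "'a::comm_ring_1 \<Rightarrow> 'b::field"
  assumes inf: "infinite (UNIV :: 'b set)" and h: "comm_ring_hom h"
  shows "vanishing_ideal h m d S = Idl\<^bsub>mpoly_ring m d\<^esub> {f \<in> multiforms m d. \<forall>x\<in>S. mpoly_eval h x f = 0}"
proof (rule antisym)
  interpret cring "mpoly_ring m d" by (rule mpoly_ring_cring)
  let ?F = "{f \<in> multiforms m d. \<forall>x\<in>S. mpoly_eval h x f = 0}"
  show "Idl\<^bsub>mpoly_ring m d\<^esub> ?F \<subseteq> vanishing_ideal h m d S"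
    by (rule genideal_minimal) (auto simp: vanishing_ideal_ideal[OF h] vanishing_ideal_form)
  have F: "?F \<subseteq> carrier (mpoly_ring m d)" by (auto dest: multiforms_carrier)
  note I = genideal_ideal[OF F] and self = genideal_self[OF F]
  show "vanishing_ideal h m d S \<subseteq> Idl\<^bsub>mpoly_ring m d\<^esub> ?F"
  proof
    fix p assume p: "p \<in> vanishing_ideal h m d S"
    then have c: "p \<in> carrier (mpoly_ring m d)" by (simp add: vanishing_ideal_def)
    obtain D where D: "finite D" "\<And>e i. e \<in> D \<Longrightarrow> i \<ge> m \<Longrightarrow> e i = 0"
      "p = (\<Sum>e\<in>D. homogeneous_part m d e p)"
      using homogeneous_decomposition[OF c] by blast
    have "homogeneous_part m d e p \<in> ?F" if "e \<in> D" for e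
    proof -
      have "homogeneous_part m d e p \<in> multiforms m d"
        using multihomogeneous_part[OF c] by (auto simp: multiforms_def)
      moreover have "homogeneous_part m d e p \<in> vanishing_ideal h m d S"
        by (rule homogeneous_part_vanishing[OF inf h p, of D]) (use D that in auto)
      ultimately show ?thesis
        by (simp add: vanishing_ideal_form)
    qed
    then have "(\<Sum>e\<in>D. homogeneous_part m d e p) \<in> Idl\<^bsub>mpoly_ring m d\<^esub> ?F"
      using self by (intro ideal_mpoly_ring_sum[OF I]) auto
    with D(3) show "p \<in> Idl\<^bsub>mpoly_ring m d\<^esub> ?F" by simp
  qed
qed

text \<open>An elementary substitute for irreducibility of the closure of \<open>S\<close>: along
  such a curve a polynomial that is nonzero somewhere has only finitely many zeros.\<close>

definition line_connected :: "(nat \<times> nat \<Rightarrow> 'b::field) set \<Rightarrow> bool" where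
  "line_connected S \<longleftrightarrow> S \<noteq> {} \<and> (\<forall>x\<in>S. \<forall>y\<in>S. \<exists>\<gamma>. \<gamma> 0 = x \<and> \<gamma> 1 = y \<and> (\<forall>t. \<gamma> t \<in> S) \<and>
     (\<forall>v. polyfun (\<lambda>t. \<gamma> t v)))"

lemma line_connected_singleton: "line_connected {x}"
  unfolding line_connected_def by (auto intro!: exI[of _ "\<lambda>t. x"] polyfun_const)

text \<open>If \<open>f\<close> is nonzero at one point of the multicone and \<open>g\<close> at
  another, then along a curve joining them both become nonzero polynomials in the parameter, so some
  parameter is a root of neither.\<close>

lemma vanishing_ideal_prime:
  fixes h :: "'a::comm_ring_1 \<Rightarrow> 'b::field"
  assumes inf: "infinite (UNIV :: 'b set)" and h: "comm_ring_hom h" and S: "line_connected S"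
  shows "primeideal (vanishing_ideal h m d S) (mpoly_ring m d)"
proof (rule primeidealI)
  have one: "mpoly_eval h x 1 = 1" for x
  proof - interpret comm_ring_hom "mpoly_eval h x" by (rule mpoly_eval_hom[OF h]) show ?thesis
      by (rule hom_one) qed
  have "1 \<notin> vanishing_ideal h m d S"
    using S by (auto simp: vanishing_ideal_def one line_connected_def)
  then show "carrier (mpoly_ring m d) \<noteq> vanishing_ideal h m d S" by auto
  fix f g
  assume f: "f \<in> carrier (mpoly_ring m d)" and g: "g \<in> carrier (mpoly_ring m d)"
    and fg: "f \<otimes>\<^bsub>mpoly_ring m d\<^esub> g \<in> vanishing_ideal h m d S"
  show "f \<in> vanishing_ideal h m d S \<or> g \<in> vanishing_ideal h m d S"
  proof (rule ccontr)
    assume "\<not> ?thesis"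
    then obtain x s y r where x: "x \<in> S" "mpoly_eval h (\<lambda>(i, j). s i * x (i, j)) f \<noteq> 0"
      and y: "y \<in> S" "mpoly_eval h (\<lambda>(i, j). r i * y (i, j)) g \<noteq> 0"
      using f g by (auto simp: vanishing_ideal_def)
    obtain \<gamma> where \<gamma>: "\<gamma> 0 = x" "\<gamma> 1 = y" "\<And>t. \<gamma> t \<in> S" "\<And>v. polyfun (\<lambda>t. \<gamma> t v)"
      using S x(1) y(1) unfolding line_connected_def by metis
    \<comment> \<open>The scalars are interpolated linearly along with the points, so the curve
      stays in the multicone.\<close>
    define z where "z t = (\<lambda>(i, j). (s i + t * (r i - s i)) * \<gamma> t (i, j))" for t
    have z: "polyfun (\<lambda>t. z t v)" for v
      by (cases v) (auto simp: z_def intro!: polyfun_intros \<gamma>(4))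
    have z01: "z 0 = (\<lambda>(i, j). s i * x (i, j))" "z 1 = (\<lambda>(i, j). r i * y (i, j))"
      using \<gamma>(1,2) by (simp_all add: z_def)
    have "\<exists>t. mpoly_eval h (z t) f \<noteq> 0 \<and> mpoly_eval h (z t) g \<noteq> 0"
      by (rule polyfun_both_nonzero[OF inf, of _ _ 0 1])
         (use x(2) y(2) in \<open>simp_all add: z01 polyfun_mpoly_eval z\<close>)
    then obtain t where t: "mpoly_eval h (z t) f \<noteq> 0" "mpoly_eval h (z t) g \<noteq> 0" by blast
    interpret E: comm_ring_hom "mpoly_eval h (z t)" by (rule mpoly_eval_hom[OF h])
    have "\<forall>s. mpoly_eval h (\<lambda>(i, j). s i * \<gamma> t (i, j)) (f * g) = 0"
      using fg \<gamma>(3)[of t] by (simp add: vanishing_ideal_def)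
    from spec[OF this, of "\<lambda>i. s i + t * (r i - s i)"]
    have "mpoly_eval h (z t) (f * g) = 0" by (simp add: z_def)
    with t show False by (simp add: E.hom_mult)
  qed
qed (simp_all add: mpoly_ring_cring vanishing_ideal_ideal[OF h])

lemma vanishing_ideal_multiproj:
  fixes h :: "'a::idom \<Rightarrow> 'b::field"
  assumes inf: "infinite (UNIV :: 'b set)" and h: "comm_ring_hom h" and S: "line_connected S"
    and nz: "\<And>i. i < m \<Longrightarrow> \<exists>j<d. \<exists>x\<in>S. x (i, j) \<noteq> 0"
  shows "vanishing_ideal h m d S \<in> multiproj m d"
proof -
  interpret comm_ring_hom h by fact
  have "{f \<in> multiforms m d. \<forall>x\<in>S. mpoly_eval h x f = 0} = vanishing_ideal h m d S \<inter> multiforms m d"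
    using vanishing_ideal_form by blast
  then have "vanishing_ideal h m d S = Idl\<^bsub>mpoly_ring m d\<^esub> (vanishing_ideal h m d S \<inter> multiforms m d)"
    using vanishing_ideal_generated[OF inf h, of m d S] by simp
  moreover have "\<exists>j<d. Var (i, j) \<notin> vanishing_ideal h m d S" if i: "i < m" for i
  proof -
    obtain j x where jx: "j < d" "x \<in> S" "x (i, j) \<noteq> 0" using nz[OF i] by blast
    have "(Var (i, j) :: 'a mpoly) \<in> multiforms m d"
      using multihomogeneous_Var[of i m j d "\<lambda>i'. if i' = i then 1 else 0"] i jx(1)
      unfolding multiforms_def by blast
    then have "Var (i, j) \<notin> vanishing_ideal h m d S"
      using jx by (auto simp: vanishing_ideal_form mpoly_eval_Var)
    with jx(1) show ?thesis by blast
  qed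
  ultimately show ?thesis
    unfolding multiproj_def using vanishing_ideal_prime[OF inf h S] by blast
qed

section \<open>The Zariski topologies\<close>

text \<open>Closure under intersections turns the generating sets from a subbasis into a
  basis.\<close>

lemma generated_topology_base:
  assumes "openin (topology_generated_by B) W" "p \<in> W"
    and B: "\<And>a b. a \<in> B \<Longrightarrow> b \<in> B \<Longrightarrow> a \<inter> b \<in> B"
  shows "\<exists>b\<in>B. p \<in> b \<and> b \<subseteq> W"
  using openin_topology_generated_by[OF assms(1)] assms(2)
proof (induction arbitrary: p rule: generate_topology_on.induct)
  case (Int a b)
  obtain u where "u \<in> B" "p \<in> u" "u \<subseteq> a" using Int.IH(1)[of p] Int.prems by auto
  moreover obtain v where "v \<in> B" "p \<in> v" "v \<subseteq> b" using Int.IH(2)[of p] Int.prems by auto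
  ultimately show ?case using B[of u v] by (intro bexI[of _ "u \<inter> v"]) auto
next
  case (UN K)
  then obtain k where k: "k \<in> K" "p \<in> k" by auto
  from UN.IH[OF this] show ?case using k(1) by (meson Union_upper order.trans)
qed auto

lemma multiproj_prime: "P \<in> multiproj m d \<Longrightarrow> primeideal P (mpoly_ring m d)"
  by (simp add: multiproj_def)

lemma multiproj_ideal: "P \<in> multiproj m d \<Longrightarrow> ideal P (mpoly_ring m d)"
  by (rule primeideal.axioms(1)[OF multiproj_prime])

lemma multiproj_one_notin: "P \<in> multiproj m d \<Longrightarrow> 1 \<notin> P"
proof
  assume P: "P \<in> multiproj m d" and "1 \<in> P"
  interpret primeideal P "mpoly_ring m d" by (rule multiproj_prime[OF P])
  show False using I_notcarr one_imp_carrier \<open>1 \<in> P\<close> by auto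
qed

lemma multiproj_mult_mem:
  assumes "P \<in> multiproj m d" "f * g \<in> P" "f \<in> carrier (mpoly_ring m d)" "g \<in> carrier (mpoly_ring m d)"
  shows "f \<in> P \<or> g \<in> P"
proof -
  interpret primeideal P "mpoly_ring m d" by (rule multiproj_prime[OF assms(1)])
  show ?thesis using I_prime[of f g] assms by simp
qed

lemma topspace_multiproj_zariski [simp]: "topspace (multiproj_zariski m d) = multiproj m d"
proof -
  have "multiproj m d = {P \<in> multiproj m d. 1 \<notin> P}" using multiproj_one_notin by auto
  then have "multiproj m d \<in> {{P \<in> multiproj m d. f \<notin> P} |f. f \<in> multiforms m d}"
    using multiforms_1 by blast
  then show ?thesis unfolding multiproj_zariski_def topology_generated_by_topspace by auto
qed

text \<open>A form missing from \<open>P\<close> is missing from every smaller prime. Read for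
  complements: a closed set contains with a prime all larger ones, so one prime can control a whole
  component.\<close>

lemma multiproj_zariski_generization:
  assumes "openin (multiproj_zariski m d) W" "P \<in> W" "P' \<in> multiproj m d" "P' \<subseteq> P"
  shows "P' \<in> W"
  using openin_topology_generated_by[OF assms(1)[unfolded multiproj_zariski_def]] assms(2-4)
proof (induction rule: generate_topology_on.induct)
  case (UN K)
  from UN.prems(1) obtain k where k: "k \<in> K" "P \<in> k" by (rule UnionE)
  with UN.IH[OF k UN.prems(2,3)] show ?case by (intro UnionI)
next
  case (Int a b)
  then show ?case by simp
next
  case (Basis s)
  then show ?case by (elim CollectE exE conjE) (simp add: subset_iff, metis)
qed simp

lemma openin_multiproj_basic:
  "f \<in> multiforms m d \<Longrightarrow> openin (multiproj_zariski m d) {P \<in> multiproj m d. f \<notin> P}"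
  unfolding multiproj_zariski_def by (rule topology_generated_by_Basis) blast

lemma closedin_multiproj_forms:
  assumes "F \<subseteq> multiforms m d"
  shows "closedin (multiproj_zariski m d) {P \<in> multiproj m d. F \<subseteq> P}"
proof -
  have "multiproj m d - {P \<in> multiproj m d. F \<subseteq> P} = (\<Union>f\<in>F. {P \<in> multiproj m d. f \<notin> P})" by auto
  moreover have "openin (multiproj_zariski m d) (\<Union>f\<in>F. {P \<in> multiproj m d. f \<notin> P})"
    using assms openin_multiproj_basic by (intro openin_Union) blast
  ultimately show ?thesis
    unfolding closedin_def by simp
qed

text \<open>As the ideal is generated by its forms, containments are checked on forms, for which
  membership means vanishing on \<open>S\<close> itself, without the auxiliary scalars.\<close>

lemma vanishing_ideal_subset_iff:
  fixes h :: "'a::comm_ring_1 \<Rightarrow> 'b::field"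
  assumes inf: "infinite (UNIV :: 'b set)" and h: "comm_ring_hom h" and P: "ideal P (mpoly_ring m d)"
  shows "vanishing_ideal h m d S \<subseteq> P \<longleftrightarrow> {f \<in> multiforms m d. \<forall>x\<in>S. mpoly_eval h x f = 0} \<subseteq> P"
proof -
  interpret cring "mpoly_ring m d" by (rule mpoly_ring_cring)
  have "{f \<in> multiforms m d. \<forall>x\<in>S. mpoly_eval h x f = 0} \<subseteq> carrier (mpoly_ring m d)"
    by (auto dest: multiforms_carrier)
  from Idl_subset_ideal[OF P this] show ?thesis
    by (simp add: vanishing_ideal_generated[OF inf h])
qed

section \<open>Linear algebra with coordinate functions\<close>

lemma sum_apply_fun: "(\<Sum>a\<in>S. f a) x = (\<Sum>a\<in>S. f a x)"
  by (induction S rule: infinite_finite_induct) simp_all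

text \<open>In matrix notation \<open>M G M = M\<close>, where \<open>G\<close> comes from a linear
  map inverting \<open>f\<close> on its image. It yields left inverses of injective matrices and, as
  \<open>G M\<close>, a square matrix with the row space of \<open>M\<close>.\<close>

lemma generalized_inverse:
  fixes M :: "'i \<Rightarrow> 'j \<Rightarrow> 'b::field"
  assumes I: "finite I" and J: "finite J"
  shows "\<exists>G. \<forall>r\<in>I. \<forall>b\<in>J. (\<Sum>a\<in>J. \<Sum>s\<in>I. M r a * G a s * M s b) = M r b"
proof -
  define s1 :: "'b \<Rightarrow> ('j \<Rightarrow> 'b) \<Rightarrow> 'j \<Rightarrow> 'b" where "s1 c f = (\<lambda>i. c * f i)" for c f
  define s2 :: "'b \<Rightarrow> ('i \<Rightarrow> 'b) \<Rightarrow> 'i \<Rightarrow> 'b" where "s2 c f = (\<lambda>i. c * f i)" for c f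
  interpret V: vector_space_pair s1 s2
    by unfold_locales (auto simp: s1_def s2_def algebra_simps fun_eq_iff)
  \<comment> \<open>Values outside \<open>I\<close> are set to 0, so that \<open>f z\<close> is a
    finite combination of the unit functions \<open>\<delta> r\<close> with
    \<open>r \<in> I\<close>.\<close>
  define f where "f z = (\<lambda>r. if r \<in> I then \<Sum>b\<in>J. M r b * z b else 0)" for z
  have lin: "Vector_Spaces.linear s1 s2 f"
    by unfold_locales
       (auto simp: f_def s1_def s2_def fun_eq_iff algebra_simps sum.distrib sum_distrib_left)
  obtain g where g: "Vector_Spaces.linear s2 s1 g" and fg: "\<And>z. f (g (f z)) = f z"
    using V.linear_exists_right_inverse_on[OF lin V.vs1.subspace_UNIV] by auto
  interpret g: Vector_Spaces.linear s2 s1 g by (rule g)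
  define \<delta> :: "'i \<Rightarrow> 'i \<Rightarrow> 'b" where "\<delta> r = (\<lambda>s. if s = r then 1 else 0)" for r
  have g_sum: "g (\<lambda>s. if s \<in> I then y s else 0) a = (\<Sum>s\<in>I. y s * g (\<delta> s) a)" for y a
  proof -
    have "(\<lambda>s. if s \<in> I then y s else 0) = (\<Sum>s\<in>I. s2 (y s) (\<delta> s))"
      using I by (auto simp: fun_eq_iff s2_def \<delta>_def sum_apply_fun if_distrib cong: if_cong)
    then have "g (\<lambda>s. if s \<in> I then y s else 0) a = (\<Sum>s\<in>I. s1 (y s) (g (\<delta> s))) a"
      by (simp add: g.sum g.scale)
    also have "\<dots> = (\<Sum>s\<in>I. y s * g (\<delta> s) a)"
      by (simp add: s1_def sum_apply_fun)
    finally show ?thesis .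
  qed
  show ?thesis
  proof (intro exI[of _ "\<lambda>a s. g (\<delta> s) a"] ballI)
    fix r b assume r: "r \<in> I" and b: "b \<in> J"
    define z :: "'j \<Rightarrow> 'b" where "z = (\<lambda>a. if a = b then 1 else 0)"
    have fz: "f z = (\<lambda>s. if s \<in> I then M s b else 0)"
      using J b by (auto simp: f_def z_def fun_eq_iff if_distrib cong: if_cong)
    have fapp: "f u r = (\<Sum>a\<in>J. M r a * u a)" for u using r by (simp add: f_def)
    have "M r b = f z r" using r by (simp add: fz)
    also have "\<dots> = f (g (f z)) r" by (simp only: fg)
    also have "\<dots> = (\<Sum>a\<in>J. M r a * (\<Sum>s\<in>I. M s b * g (\<delta> s) a))"
      unfolding fapp fz g_sum ..
    also have "\<dots> = (\<Sum>a\<in>J. \<Sum>s\<in>I. M r a * g (\<delta> s) a * M s b)"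
      by (simp add: sum_distrib_left mult_ac)
    finally show "(\<Sum>a\<in>J. \<Sum>s\<in>I. M r a * g (\<delta> s) a * M s b) = M r b" ..
  qed
qed

text \<open>The columns of \<open>G M - 1\<close> are killed by \<open>M\<close>, because
  \<open>M G M = M\<close>; injectivity of \<open>M\<close> makes them zero.\<close>

lemma left_inverse:
  fixes M :: "'i \<Rightarrow> nat \<Rightarrow> 'b::field"
  assumes I: "finite I" and inj: "\<And>z. (\<And>r. r \<in> I \<Longrightarrow> (\<Sum>b<N. M r b * z b) = 0) \<Longrightarrow> \<forall>b<N. z b = 0"
  shows "\<exists>Q. \<forall>a<N. \<forall>b<N. (\<Sum>r\<in>I. Q a r * M r b) = (if a = b then 1 else 0)"
proof -
  obtain G where G: "\<And>r b. r \<in> I \<Longrightarrow> b < N \<Longrightarrow> (\<Sum>a<N. \<Sum>s\<in>I. M r a * G a s * M s b) = M r b"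
    using generalized_inverse[OF I, of "{..<N}" M] by auto
  show ?thesis
  proof (intro exI[of _ G] allI impI)
    fix a b assume a: "a < N" and b: "b < N"
    have "\<forall>a<N. (\<Sum>s\<in>I. G a s * M s b) - (if a = b then 1 else 0) = 0"
    proof (rule inj)
      fix r assume r: "r \<in> I"
      have "(\<Sum>a<N. M r a * ((\<Sum>s\<in>I. G a s * M s b) - (if a = b then 1 else 0))) =
          (\<Sum>a<N. (\<Sum>s\<in>I. M r a * G a s * M s b) - (if a = b then M r a else 0))"
        by (intro sum.cong) (auto simp: sum_distrib_left right_diff_distrib mult_ac)
      also have "\<dots> = (\<Sum>a<N. \<Sum>s\<in>I. M r a * G a s * M s b) - (\<Sum>a<N. if a = b then M r a else 0)"
        by (rule sum_subtractf)
      also have "\<dots> = 0" using G[OF r b] b by simp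
      finally show "(\<Sum>a<N. M r a * ((\<Sum>s\<in>I. G a s * M s b) - (if a = b then 1 else 0))) = 0" .
    qed
    with a show "(\<Sum>r\<in>I. G a r * M r b) = (if a = b then 1 else 0)" by auto
  qed
qed

text \<open>A point of a product of projective spaces is a function of (factor, coordinate), and
  \<open>M i\<close> is the matrix of the linear map to factor \<open>i\<close>. Of the function
  \<open>w\<close> only the first \<open>d\<close> values count.\<close>

definition lin :: "nat \<Rightarrow> (nat \<Rightarrow> nat \<Rightarrow> nat \<Rightarrow> 'a::comm_ring_1) \<Rightarrow> (nat \<Rightarrow> 'a) \<Rightarrow> nat \<times> nat \<Rightarrow> 'a" where
  "lin d M w = (\<lambda>(i, j). \<Sum>l<d. M i j l * w l)"

lemma lin_apply: "lin d M w (i, j) = (\<Sum>l<d. M i j l * w l)"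
  by (simp add: lin_def)

lemma lin_hom: "comm_ring_hom h \<Longrightarrow> h (lin d M w v) = lin d (\<lambda>i j l. h (M i j l)) (\<lambda>l. h (w l)) v"
proof -
  assume "comm_ring_hom h"
  then interpret comm_ring_hom h .
  show ?thesis by (simp add: lin_def case_prod_unfold hom_sum hom_mult)
qed

lemma lin_scale: "lin d M (\<lambda>l. c * w l) v = c * lin d M w v"
  by (simp add: lin_def case_prod_unfold sum_distrib_left mult_ac)

lemma lin_cong: "(\<And>l. l < d \<Longrightarrow> w l = w' l) \<Longrightarrow> lin d M w = lin d M w'"
  by (simp add: lin_def)

lemma line_connected_lin: "line_connected (range (lin d M))"
proof -
  have "\<exists>\<gamma>. \<gamma> 0 = lin d M a \<and> \<gamma> 1 = lin d M c \<and> (\<forall>t. \<gamma> t \<in> range (lin d M)) \<and> (\<forall>v. polyfun (\<lambda>t. \<gamma> t v))"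
      for a c
    by (rule exI[of _ "\<lambda>t. lin d M (\<lambda>l. a l + t * (c l - a l))"])
       (auto simp: lin_def case_prod_unfold intro!: polyfun_intros)
  then show ?thesis unfolding line_connected_def by blast
qed

section \<open>Recovering a point from its images\<close>

text \<open>
  For \<open>y = (b_0 w, \<dots>, b_{m-1} w)\<close> the vector \<open>(w, 1, \<dots>, 1)\<close> solves the linear equations
  \<open>b_i w - t_i y_i = 0\<close> in the unknowns \<open>(w, t_0, \<dots>, t_{m-1})\<close>. The row \<open>(m, 0)\<close> stands for the
  normalisation \<open>t_0 y_{0,j_0} = y_{0,j_0}\<close>, which is homogeneous in \<open>y\<close>. The matrix \<open>Q\<close>
  combines the rows to a square system, to which Cramer's rule applies.
\<close>

definition image_row ::
    "nat \<Rightarrow> nat \<Rightarrow> nat \<Rightarrow> (nat \<Rightarrow> nat \<Rightarrow> nat \<Rightarrow> 'a::comm_ring_1) \<Rightarrow> (nat \<times> nat \<Rightarrow> 'a) \<Rightarrow> nat \<times> nat \<Rightarrow> nat \<Rightarrow> 'a" where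
  "image_row d m j0 b y r c =
     (if fst r < m then (if c < d then b (fst r) (snd r) c else if c = d + fst r then - y r else 0)
      else if c = d then y (0, j0) else 0)"

definition image_rows :: "nat \<Rightarrow> nat \<Rightarrow> (nat \<times> nat) set" where
  "image_rows d m = insert (m, 0) ({..<m} \<times> {..<d})"

definition elim_mat ::
    "nat \<Rightarrow> nat \<Rightarrow> nat \<Rightarrow> (nat \<Rightarrow> nat \<times> nat \<Rightarrow> 'a::comm_ring_1) \<Rightarrow> (nat \<Rightarrow> nat \<Rightarrow> nat \<Rightarrow> 'a) \<Rightarrow>
      (nat \<times> nat \<Rightarrow> 'a) \<Rightarrow> 'a mat" where
  "elim_mat d m j0 Q b y = mat (d + m) (d + m)
     (\<lambda>(a, c). \<Sum>r\<in>image_rows d m. Q a r * image_row d m j0 b y r c)"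

definition elim_form ::
    "nat \<Rightarrow> nat \<Rightarrow> nat \<Rightarrow> (nat \<Rightarrow> nat \<times> nat \<Rightarrow> 'a::comm_ring_1) \<Rightarrow> (nat \<Rightarrow> nat \<Rightarrow> nat \<Rightarrow> 'a) \<Rightarrow>
      (nat \<times> nat \<Rightarrow> 'a) \<Rightarrow> nat \<Rightarrow> 'a" where
  "elim_form d m j0 Q b y l = det (replace_col (elim_mat d m j0 Q b y)
     (vec (d + m) (\<lambda>a. Q a (m, 0) * y (0, j0))) l)"

lemma finite_image_rows [simp]: "finite (image_rows d m)"
  by (simp add: image_rows_def)

lemma elim_mat_carrier [simp]: "elim_mat d m j0 Q b y \<in> carrier_mat (d + m) (d + m)"
  by (simp add: elim_mat_def)

lemma elim_form_hom:
  assumes "comm_ring_hom g"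
  shows "g (elim_form d m j0 Q b y l) =
    elim_form d m j0 (\<lambda>a r. g (Q a r)) (\<lambda>i j l. g (b i j l)) (\<lambda>v. g (y v)) l"
proof -
  interpret comm_ring_hom g by fact
  have row: "g (image_row d m j0 b y r c) = image_row d m j0 (\<lambda>i j l. g (b i j l)) (\<lambda>v. g (y v)) r c"
      for r c
    by (simp add: image_row_def hom_uminus)
  have "map_mat g (replace_col (elim_mat d m j0 Q b y) (vec (d + m) (\<lambda>a. Q a (m, 0) * y (0, j0))) l) =
      replace_col (elim_mat d m j0 (\<lambda>a r. g (Q a r)) (\<lambda>i j l. g (b i j l)) (\<lambda>v. g (y v)))
        (vec (d + m) (\<lambda>a. g (Q a (m, 0)) * g (y (0, j0)))) l"
    by (rule eq_matI) (auto simp: replace_col_def elim_mat_def hom_sum hom_mult row)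
  then show ?thesis unfolding elim_form_def by (simp add: hom_det[symmetric])
qed

text \<open>Cramer's rule returns the entries of the solution \<open>(x, 1, ..., 1)\<close> times
  the determinant, whatever \<open>Q\<close> is. So the forms recover \<open>x\<close> up to one
  common factor.\<close>

lemma elim_form_cramer:
  assumes y: "\<And>i j. i < m \<Longrightarrow> j < d \<Longrightarrow> y (i, j) = lin d b x (i, j)" and m: "m > 0" and j0: "j0 < d"
      and l: "l < d"
  shows "elim_form d m j0 Q b y l = x l * det (elim_mat d m j0 Q b y)"
proof -
  let ?N = "d + m"
  define v where "v = vec ?N (\<lambda>c. if c < d then x c else 1)"
  have row: "(\<Sum>c<?N. image_row d m j0 b y r c * v $ c) = (if r = (m, 0) then y (0, j0) else 0)"
    if rr: "r \<in> image_rows d m" for r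
  proof (cases "r = (m, 0)")
    case True
    have "(\<Sum>c<?N. image_row d m j0 b y r c * v $ c) = (\<Sum>c<?N. if c = d then y (0, j0) else 0)"
      by (intro sum.cong) (auto simp: True image_row_def v_def)
    with m True show ?thesis by simp
  next
    case False
    then obtain i j where r: "r = (i, j)" "i < m" "j < d" using rr by (auto simp: image_rows_def)
    have "(\<Sum>c<?N. image_row d m j0 b y r c * v $ c) =
        (\<Sum>c<?N. (if c < d then b i j c * x c else 0) + (if c = d + i then - y (i, j) else 0))"
      using r(2,3) by (intro sum.cong) (auto simp: r(1) image_row_def v_def)
    also have "\<dots> = (\<Sum>c<?N. if c < d then b i j c * x c else 0) - y (i, j)"
      using r by (simp add: sum.distrib)
    also have "(\<Sum>c<?N. if c < d then b i j c * x c else 0) = (\<Sum>c<d. b i j c * x c)"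
      by (rule sum.mono_neutral_cong_right) auto
    also have "\<dots> = y (i, j)" using y r by (simp add: lin_apply)
    finally show ?thesis using False by simp
  qed
  have "elim_mat d m j0 Q b y *\<^sub>v v = vec ?N (\<lambda>a. Q a (m, 0) * y (0, j0))"
  proof (rule eq_vecI)
    fix a assume "a < dim_vec (vec ?N (\<lambda>a. Q a (m, 0) * y (0, j0)))"
    then have a: "a < ?N" by simp
    have "(elim_mat d m j0 Q b y *\<^sub>v v) $ a =
        (\<Sum>c<?N. (\<Sum>r\<in>image_rows d m. Q a r * image_row d m j0 b y r c) * v $ c)"
      using a by (simp add: elim_mat_def scalar_prod_def v_def atLeast0LessThan)
    also have "\<dots> = (\<Sum>r\<in>image_rows d m. Q a r * (\<Sum>c<?N. image_row d m j0 b y r c * v $ c))"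
      unfolding sum_distrib_right sum_distrib_left by (subst sum.swap) (simp add: mult_ac)
    also have "\<dots> = (\<Sum>r\<in>image_rows d m. if r = (m, 0) then Q a r * y (0, j0) else 0)"
      by (intro sum.cong) (auto simp: row)
    also have "\<dots> = Q a (m, 0) * y (0, j0)"
      by (simp add: image_rows_def)
    finally show "(elim_mat d m j0 Q b y *\<^sub>v v) $ a = vec ?N (\<lambda>a. Q a (m, 0) * y (0, j0)) $ a"
      using a by simp
  qed (simp add: elim_mat_def)
  then show ?thesis
    unfolding elim_form_def
    using cramer_lemma_mat[OF elim_mat_carrier, of v d m l j0 Q b y] l by (simp add: v_def)
qed

text \<open>A kernel vector \<open>(z, s)\<close> of the rows satisfies \<open>b z = s b w\<close>,
  hence is a multiple of \<open>(w, 1, ..., 1)\<close>, and the normalising row makes that multiple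
  zero. So the rows have a left inverse \<open>Q\<close>, for which the determinant at the image of
  \<open>w\<close> is 1.\<close>

lemma elim_mat_normalize:
  fixes b :: "nat \<Rightarrow> nat \<Rightarrow> nat \<Rightarrow> 'b::field"
  assumes m: "m > 0"
    and nz: "\<And>i. i < m \<Longrightarrow> \<exists>j<d. lin d b w (i, j) \<noteq> 0"
    and inj: "\<And>z s. (\<And>i j. i < m \<Longrightarrow> j < d \<Longrightarrow> lin d b z (i, j) = s i * lin d b w (i, j)) \<Longrightarrow>
      \<exists>c. \<forall>l<d. z l = c * w l"
    and j0: "j0 < d" "lin d b w (0, j0) \<noteq> 0"
  shows "\<exists>Q. elim_mat d m j0 Q b (lin d b w) = 1\<^sub>m (d + m)"
proof -
  let ?y = "lin d b w" and ?N = "d + m"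
  have "\<exists>Q. \<forall>a<?N. \<forall>c<?N. (\<Sum>r\<in>image_rows d m. Q a r * image_row d m j0 b ?y r c) = (if a = c then 1 else 0)"
  proof (rule left_inverse)
    fix z :: "nat \<Rightarrow> 'b"
    assume zero: "\<And>r. r \<in> image_rows d m \<Longrightarrow> (\<Sum>c<?N. image_row d m j0 b ?y r c * z c) = 0"
    have eq: "lin d b z (i, j) = z (d + i) * ?y (i, j)" if ij: "i < m" "j < d" for i j
    proof -
      have "0 = (\<Sum>c<?N. image_row d m j0 b ?y (i, j) c * z c)"
        using zero[of "(i, j)"] ij by (simp add: image_rows_def)
      also have "\<dots> = (\<Sum>c<?N. (if c < d then b i j c * z c else 0) + (if c = d +
        i then - ?y (i, j) * z c else 0))"
        using ij by (intro sum.cong) (auto simp: image_row_def)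
      also have "\<dots> = (\<Sum>c<?N. if c < d then b i j c * z c else 0) - z (d + i) * ?y (i, j)"
        using ij by (simp add: sum.distrib mult.commute)
      also have "(\<Sum>c<?N. if c < d then b i j c * z c else 0) = lin d b z (i, j)"
        unfolding lin_apply by (rule sum.mono_neutral_cong_right) auto
      finally show ?thesis by simp
    qed
    then obtain c where c: "\<And>l. l < d \<Longrightarrow> z l = c * w l"
      using inj[of z "\<lambda>i. z (d + i)", OF eq] by blast
    have zc: "z (d + i) = c" if i: "i < m" for i
    proof -
      obtain j where j: "j < d" "?y (i, j) \<noteq> 0" using nz[OF i] by blast
      have "lin d b z (i, j) = c * ?y (i, j)" using c by (simp add: lin_scale[symmetric] cong: lin_cong)
      with eq[OF i j(1)] j(2) show ?thesis by simp
    qed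
    have "0 = (\<Sum>c<?N. image_row d m j0 b ?y (m, 0) c * z c)"
      using zero[of "(m, 0)"] by (simp add: image_rows_def)
    also have "\<dots> = (\<Sum>c<?N. if c = d then ?y (0, j0) * z d else 0)"
      by (intro sum.cong) (auto simp: image_row_def)
    also have "\<dots> = ?y (0, j0) * z d" using m by simp
    finally have "c = 0" using j0(2) zc[OF m] by simp
    show "\<forall>b<?N. z b = 0"
    proof (intro allI impI)
      fix a assume a: "a < ?N"
      show "z a = 0"
      proof (cases "a < d")
        case True
        then show ?thesis using c \<open>c = 0\<close> by simp
      next
        case False
        then show ?thesis using zc[of "a - d"] a \<open>c = 0\<close> by simp
      qed
    qed
  qed simp
  then obtain Q where Q: "\<And>a c. a < ?N \<Longrightarrow> c < ?N \<Longrightarrow>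
      (\<Sum>r\<in>image_rows d m. Q a r * image_row d m j0 b ?y r c) = (if a = c then 1 else 0)"
    by blast
  show ?thesis
    by (rule exI[of _ Q], rule eq_matI) (auto simp: elim_mat_def Q)
qed

text \<open>All entries of one column have the same multidegree \<open>\<delta> c\<close>, whichever
  rows \<open>Q\<close> combines; this would fail for the normalisation \<open>t_0 = 1\<close>.
  Column \<open>d + i\<close> contributes degree 1 in factor \<open>i\<close>, and the right-hand
  side put into column \<open>l\<close> contributes one more in factor 0, whence the 2.\<close>

lemma elim_form_multihomogeneous:
  assumes m: "m > 0" and j0: "j0 < d" and l: "l < d"
  shows "multihomogeneous m d (\<lambda>i. if i = 0 then 2 else 1)
    (elim_form d m j0 (\<lambda>a r. Const (Q a r)) (\<lambda>i j l. Const (b i j l)) Var l)"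
proof -
  let ?N = "d + m"
  define M :: "'a mpoly mat" where "M = replace_col (elim_mat d m j0 (\<lambda>a r. Const (Q a r)) (\<lambda>i j l.
      Const (b i j l)) Var)
     (vec ?N (\<lambda>a. Const (Q a (m, 0)) * Var (0, j0))) l"
  have M: "M \<in> carrier_mat ?N ?N" by (simp add: M_def replace_col_def elim_mat_def)
  define \<delta> :: "nat \<Rightarrow> nat \<Rightarrow> nat" where
    "\<delta> c i = (if c = l \<and> i = 0 then 1 else 0) + (if c = d + i then 1 else 0)" for c i
  have row: "multihomogeneous m d (\<delta> c) (image_row d m j0 (\<lambda>i j l. Const (b i j l)) Var r c)"
    if r: "r \<in> image_rows d m" and c: "c < ?N" "c \<noteq> l" for r c
  proof -
    consider "c < d" | i where "c = d + i" "i < m"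
      using c(1) by (cases "c < d") (auto dest: le_Suc_ex simp: not_less)
    then show ?thesis
    proof cases
      case 1
      then show ?thesis using c
        by (auto simp: image_row_def \<delta>_def intro!: multihomogeneous_Const multihomogeneous_0)
    next
      case 2
      then show ?thesis using r c m j0 l
        by (auto simp: image_row_def image_rows_def \<delta>_def
            intro!: multihomogeneous_0 multihomogeneous_uminus multihomogeneous_Var)
    qed
  qed
  have ent: "multihomogeneous m d (\<delta> c) (M $$ (a, c))" if a: "a < ?N" and c: "c < ?N" for a c
  proof (cases "c = l")
    case True
    then show ?thesis using a c l m j0
      by (auto simp: M_def replace_col_def elim_mat_def \<delta>_def
          intro!: multihomogeneous_Const_mult multihomogeneous_Var)
  next
    case False
    then show ?thesis using a c row[OF _ c False]
      by (auto simp: M_def replace_col_def elim_mat_def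
          intro!: multihomogeneous_Const_mult multihomogeneous_sum)
  qed
  have "multihomogeneous m d (\<lambda>i. if i = 0 then 2 else 1)
      (\<Sum>p\<in>{p. p permutes {0..<?N}}. signof p * (\<Prod>a = 0..<?N. M $$ (a, p a)))"
  proof (rule multihomogeneous_sum)
    fix p assume "p \<in> {p. p permutes {0..<?N}}"
    then have p: "p permutes {0..<?N}" by simp
    have "multihomogeneous m d (\<lambda>i. if i = 0 then 2 else 1) (\<Prod>a = 0..<?N. M $$ (a, p a))"
    proof (rule multihomogeneous_prod)
      show "multihomogeneous m d (\<delta> (p a)) (M $$ (a, p a))" if "a \<in> {0..<?N}" for a
        using ent[of a "p a"] that p by (auto simp: permutes_in_image)
      fix i assume i: "i < m"
      have "(\<Sum>a\<in>{0..<?N}. \<delta> (p a) i) = (\<Sum>c\<in>{0..<?N}. \<delta> c i)"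
        using sum.permute[OF p, of "\<lambda>c. \<delta> c i"] by (simp add: comp_def)
      also have "\<dots> = (\<Sum>c\<in>{0..<?N}. if c = l then (if i = 0 then 1 else 0) else 0) + (\<Sum>c\<in>{0..<?N}.
        if c = d + i then 1 else 0)"
        unfolding \<delta>_def sum.distrib by (intro arg_cong2[where f="(+)"] sum.cong) auto
      also have "\<dots> = (if i = 0 then 2 else 1)" using i l by simp
      finally show "(if i = 0 then 2 else 1) = (\<Sum>a = 0..<?N. \<delta> (p a) i)" by simp
    qed
    then have "multihomogeneous m d (\<lambda>i. if i = 0 then 2 else 1) (Const (signof p) * (\<Prod>a =
      0..<?N. M $$ (a, p a)))"
      by (rule multihomogeneous_Const_mult)
    moreover have "Const (signof p) = (signof p :: 'a mpoly)"
    proof -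
      interpret comm_ring_hom "Const :: 'a \<Rightarrow> 'a mpoly" by (rule Const_hom)
      show ?thesis by (rule hom_signof)
    qed
    ultimately show "multihomogeneous m d (\<lambda>i. if i = 0 then 2 else 1) (signof p * (\<Prod>a =
      0..<?N. M $$ (a, p a)))"
      by simp
  qed
  then show ?thesis unfolding elim_form_def M_def[symmetric] by (simp add: det_def'[OF M])
qed

section \<open>A component of the special fibre\<close>

lemma ideal_mult_congruent:
  assumes P: "ideal P (mpoly_ring m d)"
    and c: "a \<in> carrier (mpoly_ring m d)" "d' \<in> carrier (mpoly_ring m d)"
    and ab: "a - b \<in> P" "c - d' \<in> P"
  shows "a * c - b * d' \<in> P"
proof -
  have "a * c - b * d' = a * (c - d') + d' * (a - b)" by (simp add: algebra_simps)
  also have "\<dots> \<in> P"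
    by (intro ideal_mpoly_ringD(3)[OF P] ideal_mpoly_ringD(4)[OF P] c ab)
  finally show ?thesis .
qed

lemma mpoly_ring_closed_prod:
  "(\<And>a. a \<in> S \<Longrightarrow> f a \<in> carrier (mpoly_ring m d)) \<Longrightarrow> (\<Prod>a\<in>S. f a) \<in> carrier (mpoly_ring m d)"
  by (induction S rule: infinite_finite_induct) auto

lemma mpoly_ring_closed_power:
  "f \<in> carrier (mpoly_ring m d) \<Longrightarrow> f ^ r \<in> carrier (mpoly_ring m d)"
  by (induction r) auto

lemma ideal_prod_congruent:
  assumes P: "ideal P (mpoly_ring m d)"
    and uv: "\<And>a. a \<in> S \<Longrightarrow> u a - v a \<in> P" "\<And>a. a \<in> S \<Longrightarrow> u a \<in> carrier (mpoly_ring m d)"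
      "\<And>a. a \<in> S \<Longrightarrow> v a \<in> carrier (mpoly_ring m d)"
  shows "(\<Prod>a\<in>S. u a) - (\<Prod>a\<in>S. v a) \<in> P"
  using uv
proof (induction S rule: infinite_finite_induct)
  case (insert x F)
  have "u x * prod u F - v x * prod v F \<in> P"
    by (rule ideal_mult_congruent[OF P]) (use insert in \<open>auto intro!: mpoly_ring_closed_prod\<close>)
  then show ?case using insert.hyps by simp
qed (use ideal_mpoly_ringD(2)[OF P] in auto)

lemma ideal_mpoly_eval_congruent:
  assumes P: "ideal P (mpoly_ring m d)" and f: "f \<in> carrier (mpoly_ring m d)"
    and uv: "\<And>i j. i < m \<Longrightarrow> j < d \<Longrightarrow> u (i, j) - v (i, j) \<in> P"
      "\<And>i j. i < m \<Longrightarrow> j < d \<Longrightarrow> u (i, j) \<in> carrier (mpoly_ring m d)"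
      "\<And>i j. i < m \<Longrightarrow> j < d \<Longrightarrow> v (i, j) \<in> carrier (mpoly_ring m d)"
  shows "mpoly_eval Const u f - mpoly_eval Const v f \<in> P"
proof -
  have "mpoly_eval Const u f - mpoly_eval Const v f =
      (\<Sum>\<mu>\<in>keys f. Const (lookup f \<mu>) * (mon_eval u \<mu> - mon_eval v \<mu>))"
    by (simp add: mpoly_eval_mon_eval sum_subtractf right_diff_distrib)
  also have "\<dots> \<in> P"
  proof (intro ideal_mpoly_ring_sum[OF P] ideal_mpoly_ringD(4)[OF P] mpoly_ring_closed)
    fix \<mu> assume "\<mu> \<in> keys f"
    with f have \<mu>: "keys \<mu> \<subseteq> {..<m} \<times> {..<d}" by (auto simp: carrier_mpoly_ring)
    have "(\<Prod>x\<in>{..<r}. u w) - (\<Prod>x\<in>{..<r}. v w) \<in> P" if "w \<in> keys \<mu>" for w and r :: nat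
      by (rule ideal_prod_congruent[OF P]) (use that \<mu> uv in \<open>cases w; auto\<close>)+
    then show "mon_eval u \<mu> - mon_eval v \<mu> \<in> P"
      unfolding mon_eval_def
      by (intro ideal_prod_congruent[OF P]) (use \<mu> uv in \<open>auto intro!: mpoly_ring_closed_power\<close>)
  qed
  finally show ?thesis .
qed

lemma multiproj_prod_mem:
  assumes P: "P \<in> multiproj m d" and "finite S" "\<And>a. a \<in> S \<Longrightarrow> f a \<in> carrier (mpoly_ring m d)"
    "(\<Prod>a\<in>S. f a) \<in> P"
  shows "\<exists>a\<in>S. f a \<in> P"
  using assms(2-4)
proof (induction S rule: finite_induct)
  case (insert x F)
  then have "f x \<in> P \<or> prod f F \<in> P"
    by (intro multiproj_mult_mem[OF P]) (auto intro!: mpoly_ring_closed_prod)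
  with insert show ?case by auto
qed (use multiproj_one_notin[OF P] in auto)

lemma multiproj_power_mem:
  assumes P: "P \<in> multiproj m d" and "f \<in> carrier (mpoly_ring m d)" "f ^ r \<in> P"
  shows "f \<in> P"
  using multiproj_prod_mem[OF P, of "{..<r}" "\<lambda>_. f"] assms by simp

lemma coeffs_in_ideal_imp_mem:
  assumes P: "ideal P (mpoly_ring m d)" and f: "f \<in> carrier (mpoly_ring m d)"
    and c: "\<And>\<mu>. Const (lookup f \<mu>) \<in> P"
  shows "f \<in> P"
proof -
  have "(\<Sum>\<mu>\<in>keys f. Poly_Mapping.single \<mu> 1 * Const (lookup f \<mu>)) \<in> P"
    by (intro ideal_mpoly_ring_sum[OF P] ideal_mpoly_ringD(4)[OF P] c)
       (use f in \<open>auto simp: carrier_mpoly_ring\<close>)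
  then show ?thesis by (simp add: mult.commute[of _ "Const _"] Const_single sum_singles)
qed

definition coords :: "(nat \<Rightarrow> 'a vec) \<Rightarrow> nat \<times> nat \<Rightarrow> 'a" where
  "coords x = (\<lambda>(i, j). x i $ j)"

lemma form_at_coords: "form_at f x = poly_at (coords x) f"
  by (simp add: form_at_def coords_def)

lemma residue_point_vanishing_ideal:
  fixes res :: "'r::idom \<Rightarrow> 'k::field"
  assumes "infinite (UNIV :: 'k set)" "comm_ring_hom res"
  shows "residue_point res m d x = vanishing_ideal res m d {coords x}"
  unfolding residue_point_def coords_def by (simp add: vanishing_ideal_generated[OF assms])

text \<open>The closure of the image of \<open>w \<mapsto> lin q M w\<close>, given by its
  equations. In this form it can be compared both with the closure of an actual image and with the
  rational points of a component.\<close>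

definition image_variety :: "nat \<Rightarrow> nat \<Rightarrow> nat \<Rightarrow> (nat \<Rightarrow> nat \<Rightarrow> nat \<Rightarrow> 'k::field) \<Rightarrow> (nat \<Rightarrow> 'k vec) set set" where
  "image_variety q m d M = {proj_point m x | x. x \<in> coord_tuples m d \<and>
     (\<forall>f\<in>multiforms m d. (\<forall>w. poly_at (lin q M w) f = 0) \<longrightarrow> form_at f x = 0)}"

text \<open>The matrices \<open>b i\<close> are integral, and \<open>w0\<close> certifies that their
  reductions define a map that is birational onto its image. Since \<open>s i = 0\<close> is
  allowed, \<open>unique\<close> concerns the closed fibre through the image of
  \<open>w0\<close>.\<close>

locale linear_reduction =
  fixes res :: "'r::idom \<Rightarrow> 'k::field" and d m :: nat and b :: "nat \<Rightarrow> nat \<Rightarrow> nat \<Rightarrow> 'r" and w0 :: "nat \<Rightarrow> 'k"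
  assumes res_hom: "comm_ring_hom res" and res_surj: "surj res" and inf: "infinite (UNIV :: 'k set)"
    and m_pos: "m > 0"
    and nonzero: "\<And>i. i < m \<Longrightarrow> \<exists>j<d. lin d (\<lambda>i j l. res (b i j l)) w0 (i, j) \<noteq> 0"
    and unique: "\<And>z s. (\<And>i j. i < m \<Longrightarrow> j < d \<Longrightarrow> lin d (\<lambda>i j l. res (b i j l)) z (i, j) =
       s i * lin d (\<lambda>i j l. res (b i j l)) w0 (i, j)) \<Longrightarrow> \<exists>c. \<forall>l<d. z l = c * w0 l"
begin

interpretation res: comm_ring_hom res by (rule res_hom)

abbreviation "rb \<equiv> \<lambda>i j l. res (b i j l)"
abbreviation "fb \<equiv> \<lambda>i j l. to_fract (b i j l)"

text \<open>The matrix \<open>Q\<close> is found over the residue field, where the determinant at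
  the image of \<open>w0\<close> becomes 1, and is then lifted to R. Over K the forms still return
  \<open>x\<close> times a factor \<open>F\<close>, and their reductions return \<open>w0\<close>
  itself.\<close>

lemma elim_forms:
  obtains C E where "\<And>l. l < d \<Longrightarrow> multihomogeneous m d E (C l)"
    "\<And>x. \<exists>F. \<forall>l<d. mpoly_eval to_fract (lin d fb x) (C l) = x l * F"
    "\<And>l. l < d \<Longrightarrow> mpoly_eval res (lin d rb w0) (C l) = w0 l"
proof -
  obtain j0 where j0: "j0 < d" "lin d rb w0 (0, j0) \<noteq> 0" using nonzero[OF m_pos] by blast
  have "\<exists>Q. elim_mat d m j0 Q rb (lin d rb w0) = 1\<^sub>m (d + m)"
  proof (rule elim_mat_normalize[OF m_pos _ _ j0])
    show "\<exists>j<d. lin d rb w0 (i, j) \<noteq> 0" if "i < m" for i using that by (rule nonzero)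
    fix z s assume "\<And>i j. i < m \<Longrightarrow> j < d \<Longrightarrow> lin d rb z (i, j) = s i * lin d rb w0 (i, j)"
    then show "\<exists>c. \<forall>l<d. z l = c * w0 l" by (rule unique)
  qed
  then obtain Qk where Qk: "elim_mat d m j0 Qk rb (lin d rb w0) = 1\<^sub>m (d + m)" ..
  define Q where "Q a r = inv_into UNIV res (Qk a r)" for a r
  have Q: "res (Q a r) = Qk a r" for a r
    unfolding Q_def by (rule surj_f_inv_f[OF res_surj])
  define C where "C l = elim_form d m j0 (\<lambda>a r. Const (Q a r)) (\<lambda>i j l. Const (b i j l)) Var l" for l
  have eval: "mpoly_eval h y (C l) = elim_form d m j0 (\<lambda>a r. h (Q a r)) (\<lambda>i j l. h (b i j l)) y l"
    if "comm_ring_hom h" for h :: "'r \<Rightarrow> 'c::comm_ring_1" and y l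
  proof -
    interpret comm_ring_hom h by fact
    show ?thesis
      unfolding C_def by (subst elim_form_hom[OF mpoly_eval_hom[OF that]])
        (simp add: mpoly_eval_Const mpoly_eval_Var)
  qed
  show thesis
  proof
    show "multihomogeneous m d (\<lambda>i. if i = 0 then 2 else 1) (C l)" if "l < d" for l
      unfolding C_def by (rule elim_form_multihomogeneous[OF m_pos j0(1) that])
    show "\<exists>F. \<forall>l<d. mpoly_eval to_fract (lin d fb x) (C l) = x l * F" for x
      using elim_form_cramer[of m d "lin d fb x" fb x j0] m_pos j0(1)
      by (auto simp: eval[OF to_fract_hom])
    show "mpoly_eval res (lin d rb w0) (C l) = w0 l" if "l < d" for l
      using elim_form_cramer[of m d "lin d rb w0" rb w0 j0 l Qk] m_pos j0(1) that
      by (simp add: eval[OF res_hom] Q Qk)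
  qed
qed

text \<open>The generic point of Z, as a prime of the coordinate ring over R.\<close>

definition "generic_point = vanishing_ideal res m d (range (lin d rb))"

lemma generic_point_multiproj: "generic_point \<in> multiproj m d"
  unfolding generic_point_def
  by (rule vanishing_ideal_multiproj[OF inf res_hom line_connected_lin]) (use nonzero in blast)

lemma Const_generic_point: "Const a \<in> generic_point \<longleftrightarrow> res a = 0"
  unfolding generic_point_def
  by (subst vanishing_ideal_form[OF multiforms_Const]) (simp add: mpoly_eval_Const)

text \<open>Suppose \<open>P\<close> satisfies \<open>y_i ~ b_i C(y)\<close> for the eliminating forms \<open>C\<close>. Then a form \<open>f\<close> agrees
  modulo \<open>P\<close>, up to invertible factors, with \<open>f(b C)\<close>, which vanishes over the residue field.\<close>

lemma generic_point_subset:
  obtains g where "g \<in> multiforms m d" "g \<notin> generic_point"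
    "\<And>P. P \<in> multiproj m d \<Longrightarrow> (\<And>a. res a = 0 \<Longrightarrow> Const a \<in> P) \<Longrightarrow>
      (\<And>f. f \<in> multiforms m d \<Longrightarrow> (\<forall>x. mpoly_eval to_fract (lin d fb x) f = 0) \<Longrightarrow> f \<in> P) \<Longrightarrow>
      g \<notin> P \<Longrightarrow> generic_point \<subseteq> P"
proof -
  obtain C E where C: "\<And>l. l < d \<Longrightarrow> multihomogeneous m d E (C l)"
    "\<And>x. \<exists>F. \<forall>l<d. mpoly_eval to_fract (lin d fb x) (C l) = x l * F"
    "\<And>l. l < d \<Longrightarrow> mpoly_eval res (lin d rb w0) (C l) = w0 l"
    by (rule elim_forms, rule that)
  \<comment> \<open>\<open>G i j\<close> is coordinate \<open>j\<close> of
    \<open>b_i C(y)\<close>.\<close>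
  define G where "G i j = (\<Sum>l<d. Const (b i j l) * C l)" for i j
  have G: "multihomogeneous m d E (G i j)" for i j
    unfolding G_def by (intro multihomogeneous_sum multihomogeneous_Const_mult C) auto
  have Gc: "G i j \<in> carrier (mpoly_ring m d)" for i j by (rule multihomogeneous_carrier[OF G])
  have evalG: "mpoly_eval h y (G i j) = lin d (\<lambda>i j l. h (b i j l)) (\<lambda>l. mpoly_eval h y (C l)) (i, j)"
    if h: "comm_ring_hom h" for h :: "'r \<Rightarrow> 'c::comm_ring_1" and y i j
  proof -
    interpret h: comm_ring_hom h by fact
    interpret e: comm_ring_hom "mpoly_eval h y" by (rule mpoly_eval_hom[OF h])
    show ?thesis by (simp add: G_def lin_apply e.hom_sum e.hom_mult mpoly_eval_Const)
  qed
  have "\<forall>i. \<exists>j. i < m \<longrightarrow> j < d \<and> lin d rb w0 (i, j) \<noteq> 0" using nonzero by blast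
  then obtain jj where jj: "\<And>i. i < m \<Longrightarrow> jj i < d" "\<And>i. i < m \<Longrightarrow> lin d rb w0 (i, jj i) \<noteq> 0"
    by metis
  \<comment> \<open>At the image of \<open>w0\<close> the coordinate \<open>jj i\<close> of
    \<open>b_i C(y)\<close> is nonzero for each \<open>i\<close>. So the open set where
    \<open>g\<close> does not vanish contains the generic point of Z.\<close>
  define g where "g = (\<Prod>i<m. G i (jj i))"
  have "multihomogeneous m d (\<lambda>i. \<Sum>a<m. E i) g"
    unfolding g_def by (rule multihomogeneous_prod[of _ m d "\<lambda>_. E"]) (use G in auto)
  then have g: "g \<in> multiforms m d" by (auto simp: multiforms_def)
  have "mpoly_eval res (lin d rb w0) g \<noteq> 0"
  proof -
    interpret e: comm_ring_hom "mpoly_eval res (lin d rb w0)" by (rule mpoly_eval_hom[OF res_hom])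
    have "mpoly_eval res (lin d rb w0) (G i j) = lin d rb w0 (i, j)" for i j
      unfolding evalG[OF res_hom] by (simp add: lin_apply C(3))
    then show ?thesis using jj by (simp add: g_def e.hom_prod)
  qed
  then have g': "g \<notin> generic_point"
    unfolding generic_point_def by (subst vanishing_ideal_form[OF g]) blast
  have "generic_point \<subseteq> P"
    if P: "P \<in> multiproj m d" and k: "\<And>a. res a = 0 \<Longrightarrow> Const a \<in> P"
      and rel: "\<And>f. f \<in> multiforms m d \<Longrightarrow> (\<forall>x. mpoly_eval to_fract (lin d fb x) f = 0) \<Longrightarrow> f \<in> P"
      and gP: "g \<notin> P" for P
  proof -
    note I = multiproj_ideal[OF P]
    have GP: "G i (jj i) \<notin> P" if i: "i < m" for i
    proof
      assume "G i (jj i) \<in> P"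
      then have "(\<Prod>a\<in>{..<m} - {i}. G a (jj a)) * G i (jj i) \<in> P"
        by (intro ideal_mpoly_ringD(4)[OF I] mpoly_ring_closed_prod Gc)
      also have "(\<Prod>a\<in>{..<m} - {i}. G a (jj a)) * G i (jj i) = g"
        unfolding g_def using i by (subst prod.remove[of _ i]) (auto simp: mult.commute)
      finally show False using gP by simp
    qed
    \<comment> \<open>These minors express that \<open>y_i\<close> and \<open>b_i C(y)\<close> are
      proportional. They vanish on the generic fibre, because \<open>C(b x) = F x\<close>
      there.\<close>
    have minor: "Var (i, j) * G i j' - Var (i, j') * G i j \<in> P" if i: "i < m" and j: "j < d" "j' < d"
      for i j j'
    proof (rule rel)
      have "multihomogeneous m d (\<lambda>a. (if a = i then 1 else 0) + E a) (Var (i, j) * G i j')"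
        if "j < d" for j j'
        by (rule multihomogeneous_mult[OF multihomogeneous_Var[of i m j d "\<lambda>a. if a = i then 1 else 0"] G])
          (use i that in auto)
      with j show "Var (i, j) * G i j' - Var (i, j') * G i j \<in> multiforms m d"
        unfolding multiforms_def by (blast intro: multihomogeneous_diff)
      show "\<forall>x. mpoly_eval to_fract (lin d fb x) (Var (i, j) * G i j' - Var (i, j') * G i j) = 0"
      proof
        fix x
        interpret e: comm_ring_hom "mpoly_eval to_fract (lin d fb x)"
          by (rule mpoly_eval_hom[OF to_fract_hom])
        obtain F where F: "\<And>l. l < d \<Longrightarrow> mpoly_eval to_fract (lin d fb x) (C l) = F * x l"
          using C(2)[of x] by (auto simp: mult.commute)
        have "mpoly_eval to_fract (lin d fb x) (G i j) = F * lin d fb x (i, j)" for i j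
          unfolding evalG[OF to_fract_hom] lin_scale[symmetric] by (rule fun_cong[OF lin_cong[OF F]])
        then show "mpoly_eval to_fract (lin d fb x) (Var (i, j) * G i j' - Var (i, j') * G i j) = 0"
          by (simp add: e.hom_minus e.hom_mult mpoly_eval_Var mult_ac)
      qed
    qed
    show ?thesis
      unfolding generic_point_def vanishing_ideal_subset_iff[OF inf res_hom I]
    proof
      fix f assume "f \<in> {f \<in> multiforms m d. \<forall>x\<in>range (lin d rb). mpoly_eval res x f = 0}"
      then have f: "f \<in> multiforms m d" and f0: "\<And>w. mpoly_eval res (lin d rb w) f = 0" by auto
      then obtain e where e: "multihomogeneous m d e f" by (auto simp: multiforms_def)
      note fc = multihomogeneous_carrier[OF e]
      define fG where "fG = mpoly_eval Const (\<lambda>(i, j). G i j) f"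
      have fGc: "fG \<in> carrier (mpoly_ring m d)"
        unfolding fG_def
        by (rule multihomogeneous_carrier, rule multihomogeneous_mpoly_eval[OF e, where \<epsilon> = "\<lambda>i. E"])
           (use G in auto)
      have "mpoly_eval res y fG = 0" for y
      proof -
        have "mpoly_eval res y fG = mpoly_eval res (\<lambda>v. mpoly_eval res y (case v of (i, j) \<Rightarrow> G i j)) f"
          unfolding fG_def by (simp add: hom_mpoly_eval[OF mpoly_eval_hom[OF res_hom]] mpoly_eval_Const)
        also have "(\<lambda>v. mpoly_eval res y (case v of (i, j) \<Rightarrow> G i j)) =
          lin d rb (\<lambda>l. mpoly_eval res y (C l))"
          by (auto simp: evalG[OF res_hom])
        finally show ?thesis by (simp add: f0)
      qed
      \<comment> \<open>Over the residue field \<open>fG\<close> evaluates \<open>f\<close> at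
        points of the form \<open>b w\<close>, where \<open>f\<close> vanishes; hence all
        coefficients of \<open>fG\<close> reduce to 0.\<close>
      then have "res (lookup fG \<mu>) = 0" for \<mu>
        by (rule mpoly_eval_all_zero[OF inf]) simp
      then have fGP: "fG \<in> P" by (intro coeffs_in_ideal_imp_mem[OF I fGc] k)
      \<comment> \<open>The minors make \<open>u\<close> and \<open>v\<close> congruent modulo
        \<open>P\<close>. By homogeneity \<open>f\<close> at \<open>u\<close> is \<open>f\<close>
        times powers of the \<open>G i (jj i)\<close>, none of which lies in \<open>P\<close>, and
        \<open>f\<close> at \<open>v\<close> is a multiple of \<open>fG\<close>.\<close>
      define u where "u = (\<lambda>(i, j). G i (jj i) * Var (i, j))"
      define v where "v = (\<lambda>(i, j). Var (i, jj i) * G i j)"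
      have "mpoly_eval Const u f - mpoly_eval Const v f \<in> P"
      proof (rule ideal_mpoly_eval_congruent[OF I fc])
        fix i j assume ij: "i < m" "j < d"
        show "u (i, j) - v (i, j) \<in> P"
          using minor[of i j "jj i"] ij jj(1) by (simp add: u_def v_def mult.commute)
        show "u (i, j) \<in> carrier (mpoly_ring m d)" "v (i, j) \<in> carrier (mpoly_ring m d)"
          using ij jj(1) Gc by (auto simp: u_def v_def)
      qed
      moreover have "mpoly_eval Const u f = (\<Prod>i<m. G i (jj i) ^ e i) * f"
        unfolding u_def using mpoly_eval_scale[OF e, of Const "\<lambda>i. G i (jj i)" Var]
        by (simp add: mpoly_eval_Const_Var)
      moreover have "mpoly_eval Const v f = (\<Prod>i<m. Var (i, jj i) ^ e i) * fG"
        unfolding v_def fG_def using mpoly_eval_scale[OF e, of Const "\<lambda>i. Var (i, jj i)" "\<lambda>(i, j). G i j"]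
        by simp
      moreover have "(\<Prod>i<m. Var (i, jj i) ^ e i) * fG \<in> P"
        using jj(1) by (intro ideal_mpoly_ringD(4)[OF I] mpoly_ring_closed_prod mpoly_ring_closed_power
          fGP) auto
      ultimately have "(\<Prod>i<m. G i (jj i) ^ e i) * f \<in> P"
        using ideal_mpoly_ringD(3)[OF I] by fastforce
      then have "(\<Prod>i<m. G i (jj i) ^ e i) \<in> P \<or> f \<in> P"
        by (rule multiproj_mult_mem[OF P]) (auto intro!: mpoly_ring_closed_prod mpoly_ring_closed_power
          Gc fc)
      moreover have "(\<Prod>i<m. G i (jj i) ^ e i) \<notin> P"
      proof
        assume "(\<Prod>i<m. G i (jj i) ^ e i) \<in> P"
        then have "\<exists>i\<in>{..<m}. G i (jj i) ^ e i \<in> P"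
          by (intro multiproj_prod_mem[OF P]) (auto intro!: mpoly_ring_closed_power Gc)
        then show False using multiproj_power_mem[OF P Gc] GP by blast
      qed
      ultimately show "f \<in> P" by blast
    qed
  qed
  with g g' show thesis by (intro that) auto
qed

end

section \<open>Generic points of the Mustafin variety and of its special fibre\<close>

lemma line_connected_UNIV: "line_connected (UNIV :: (nat \<times> nat \<Rightarrow> 'b::field) set)"
proof -
  have "\<exists>\<gamma>. \<gamma> 0 = x \<and> \<gamma> 1 = y \<and> (\<forall>v. polyfun (\<lambda>t. \<gamma> t v))" for x y :: "nat \<times> nat \<Rightarrow> 'b"
    by (rule exI[of _ "\<lambda>t v. x v + t * (y v - x v)"]) (auto intro!: polyfun_intros)
  then show ?thesis unfolding line_connected_def by simp
qed

lemma zero_ideal_multiproj: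
  assumes inf: "infinite (UNIV :: 'b::field set)" and d: "d > 0"
  shows "{0 :: 'b mpoly} \<in> multiproj m d"
proof -
  have "vanishing_ideal (\<lambda>c. c) m d UNIV = {0 :: 'b mpoly}"
  proof (rule antisym)
    show "vanishing_ideal (\<lambda>c. c) m d UNIV \<subseteq> {0 :: 'b mpoly}"
    proof
      fix p :: "'b mpoly" assume p: "p \<in> vanishing_ideal (\<lambda>c. c) m d UNIV"
      have "poly_at x p = 0" for x
      proof -
        have "\<forall>s. poly_at (\<lambda>(i, j). s i * x (i, j)) p = 0"
          using p by (simp add: vanishing_ideal_def)
        from spec[OF this, of "\<lambda>_. 1"] show ?thesis by simp
      qed
      from mpoly_eval_all_zero[OF inf this] show "p \<in> {0}" by (auto intro: poly_mapping_eqI)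
    qed
    show "{0} \<subseteq> vanishing_ideal (\<lambda>c. c) m d (UNIV :: (nat \<times> nat \<Rightarrow> 'b) set)"
      using ideal_mpoly_ringD(2)[OF vanishing_ideal_ideal[OF id_hom]] by blast
  qed
  moreover have "vanishing_ideal (\<lambda>c. c) m d (UNIV :: (nat \<times> nat \<Rightarrow> 'b) set) \<in> multiproj m d"
    by (rule vanishing_ideal_multiproj[OF inf id_hom line_connected_UNIV])
       (use d in \<open>auto intro!: exI[of _ 0] exI[of _ "\<lambda>_. 1"]\<close>)
  ultimately show ?thesis by simp
qed

text \<open>Row \<open>j\<close> of \<open>b i\<close> is vector number \<open>j\<close> of the
  chosen basis of the dual of \<open>Ls ! i\<close>, assumed to have entries in R. Pulling a form
  back to P(V) then amounts to evaluating it at the vectors \<open>b_i x\<close>.\<close>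

locale mustafin_reduction = linear_reduction res d m b w0
  for res :: "'r::idom \<Rightarrow> 'k::field" and d m b w0 +
  fixes Ls :: "'r fract vec set list"
  assumes length_Ls: "m = length Ls"
    and dual_carrier: "\<And>i. i < m \<Longrightarrow> dual_basis d (Ls ! i) \<in> carrier_mat d d"
    and dual_entries: "\<And>i j l. i < m \<Longrightarrow> j < d \<Longrightarrow> l < d \<Longrightarrow> dual_basis d (Ls ! i) $$ (l, j) = to_fract (b i j l)"
begin

interpretation res: comm_ring_hom res by (rule res_hom)

text \<open>R maps onto the infinite residue field and embeds into K.\<close>

lemma inf_fract: "infinite (UNIV :: 'r fract set)"
proof
  assume "finite (UNIV :: 'r fract set)"
  then have "finite (UNIV :: 'r set)"
    by (rule inj_on_finite[where f = to_fract, rotated 2]) (auto simp: inj_on_def)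
  then have "finite (range res)" by simp
  with inf res_surj show False by simp
qed

lemma d_pos: "d > 0" using nonzero[OF m_pos] by auto

lemma eval_pullback:
  assumes "f \<in> carrier (mpoly_ring m d)"
  shows "poly_at x (pullback d Ls f) = mpoly_eval to_fract (lin d fb (\<lambda>l. x (0, l))) f"
proof -
  interpret e: comm_ring_hom "poly_at x" by (rule mpoly_eval_hom[OF id_hom])
  have "poly_at x (pullback d Ls f) =
      mpoly_eval to_fract (\<lambda>v. poly_at x (case v of (i, j) \<Rightarrow> linear_form d (col (dual_basis d (Ls ! i))
        j))) f"
    unfolding pullback_def by (simp add: hom_mpoly_eval[OF e.comm_ring_hom_axioms] mpoly_eval_Const)
  also have "\<dots> = mpoly_eval to_fract (lin d fb (\<lambda>l. x (0, l))) f"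
  proof (rule mpoly_eval_cong[OF assms])
    fix i j assume ij: "i < m" "j < d"
    show "poly_at x (case (i, j) of (i, j) \<Rightarrow> linear_form d (col (dual_basis d (Ls ! i)) j)) =
        lin d fb (\<lambda>l. x (0, l)) (i, j)"
      using dual_carrier[OF ij(1)] ij
      by (simp add: linear_form_def lin_apply e.hom_sum e.hom_mult mpoly_eval_Const mpoly_eval_Var
        dual_entries)
  qed
  finally show ?thesis .
qed

lemma pullback_eq_0_iff:
  assumes "f \<in> carrier (mpoly_ring m d)"
  shows "pullback d Ls f = 0 \<longleftrightarrow> (\<forall>x. mpoly_eval to_fract (lin d fb x) f = 0)"
proof
  assume 0: "pullback d Ls f = 0"
  show "\<forall>x. mpoly_eval to_fract (lin d fb x) f = 0"
  proof
    fix x :: "nat \<Rightarrow> 'r fract"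
    show "mpoly_eval to_fract (lin d fb x) f = 0"
      using eval_pullback[OF assms, of "\<lambda>(i, l). x l"] 0 by (simp add: mpoly_eval_def[of _ _ 0])
  qed
next
  assume "\<forall>x. mpoly_eval to_fract (lin d fb x) f = 0"
  then have "poly_at x (pullback d Ls f) = 0" for x by (simp add: eval_pullback[OF assms])
  from mpoly_eval_all_zero[OF inf_fract this] show "pullback d Ls f = 0"
    by (auto intro: poly_mapping_eqI)
qed

definition "generic_fiber_point = vanishing_ideal to_fract m d (range (lin d fb))"

lemma generic_fiber_point_image: "generic_fiber_point \<in> diagonal_map d Ls ` multiproj 1 d"
proof -
  \<comment> \<open>The zero ideal is the generic point of P(V). That a pullback lies in it can be
    tested on points over the infinite field K.\<close>
  have "diagonal_map d Ls {0} = generic_fiber_point"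
    unfolding diagonal_map_def generic_fiber_point_def vanishing_ideal_generated[OF inf_fract
      to_fract_hom] length_Ls[symmetric]
    by (intro arg_cong[where f = "genideal _"] Collect_cong conj_cong refl)
       (auto simp: pullback_eq_0_iff multiforms_carrier)
  then show ?thesis using zero_ideal_multiproj[OF inf_fract d_pos] by (metis imageI)
qed

text \<open>Each residue vector \<open>w\<close> lifts to a vector over R. A form that vanishes on
  the generic fibre has value 0 in R at the image of the lift, and this value reduces to the one at
  the image of \<open>w\<close>.\<close>

lemma generic_fiber_point_subset: "generic_fiber_point \<subseteq> generic_point"
  unfolding generic_fiber_point_def
proof (subst vanishing_ideal_subset_iff[OF inf_fract to_fract_hom multiproj_ideal[OF
    generic_point_multiproj]], rule subsetI)
  fix f assume "f \<in> {f \<in> multiforms m d. \<forall>x\<in>range (lin d fb). mpoly_eval to_fract x f = 0}"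
  then have f: "f \<in> multiforms m d" and f0: "\<And>x. mpoly_eval to_fract (lin d fb x) f = 0" by auto
  have "mpoly_eval res (lin d rb w) f = 0" for w
  proof -
    define w' where "w' l = inv_into UNIV res (w l)" for l
    have w': "res (w' l) = w l" for l
      unfolding w'_def by (rule surj_f_inv_f[OF res_surj])
    have "to_fract (poly_at (lin d b w') f) = mpoly_eval to_fract (lin d fb (\<lambda>l. to_fract (w' l))) f"
      by (simp add: hom_mpoly_eval[OF to_fract_hom] lin_hom[OF to_fract_hom])
    then have "poly_at (lin d b w') f = 0" by (simp add: f0)
    then have "res (poly_at (lin d b w') f) = 0" by simp
    then show ?thesis by (simp add: hom_mpoly_eval[OF res_hom] lin_hom[OF res_hom] w')
  qed
  then show "f \<in> generic_point" unfolding generic_point_def by (simp add: vanishing_ideal_form[OF f])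
qed

lemma generic_fiber_point_multiproj: "generic_fiber_point \<in> multiproj m d"
  unfolding generic_fiber_point_def
proof (rule vanishing_ideal_multiproj[OF inf_fract to_fract_hom line_connected_lin])
  fix i assume i: "i < m"
  then obtain j where j: "j < d" "lin d rb w0 (i, j) \<noteq> 0" using nonzero by blast
  \<comment> \<open>A nonzero coordinate at \<open>w0\<close> forces an entry of \<open>b i\<close>
    with nonzero residue, which stays nonzero over K.\<close>
  then obtain l where l: "l < d" "res (b i j l) \<noteq> 0"
    unfolding lin_apply by (metis (no_types, lifting) lessThan_iff mult_zero_left sum.neutral)
  have "lin d fb (\<lambda>a. if a = l then 1 else 0) (i, j) = to_fract (b i j l)"
    using l(1) by (simp add: lin_apply if_distrib cong: if_cong)
  moreover have "b i j l \<noteq> 0" using l(2) by auto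
  ultimately have ne: "lin d fb (\<lambda>a. if a = l then 1 else 0) (i, j) \<noteq> 0" by simp
  show "\<exists>j<d. \<exists>x\<in>range (lin d fb). x (i, j) \<noteq> 0"
  proof (intro exI[of _ j] conjI j(1) bexI[OF _ rangeI])
    show "lin d fb (\<lambda>a. if a = l then 1 else 0) (i, j) \<noteq> 0" by (rule ne)
  qed
qed

text \<open>Every open set around \<open>P\<close> contains all smaller points of
  \<open>multiproj m d\<close>, among them \<open>generic_fiber_point\<close>, which is the image of
  a point of P(V).\<close>

lemma mustafin_varietyI:
  assumes "P \<in> multiproj m d" "generic_fiber_point \<subseteq> P"
  shows "P \<in> mustafin_variety d Ls"
  unfolding mustafin_variety_def length_Ls[symmetric] in_closure_of
proof (intro conjI allI impI)
  show "P \<in> topspace (multiproj_zariski m d)" using assms(1) by simp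
  fix T assume T: "P \<in> T \<and> openin (multiproj_zariski m d) T"
  show "\<exists>y. y \<in> diagonal_map d Ls ` multiproj 1 d \<and> y \<in> T"
    using T generic_fiber_point_image
      multiproj_zariski_generization[OF _ _ generic_fiber_point_multiproj assms(2)] by blast
qed

text \<open>A form that vanishes at all \<open>b x\<close> pulls back to 0, so it lies in the image
  of every point of P(V). The primes containing it form a closed set, which therefore contains the
  closure.\<close>

lemma mustafin_varietyD:
  assumes "P \<in> mustafin_variety d Ls"
  shows "P \<in> multiproj m d"
    "f \<in> multiforms m d \<Longrightarrow> \<forall>x. mpoly_eval to_fract (lin d fb x) f = 0 \<Longrightarrow> f \<in> P"
proof -
  show P: "P \<in> multiproj m d"
    using assms unfolding mustafin_variety_def length_Ls[symmetric] in_closure_of by simp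
  assume f: "f \<in> multiforms m d" and f0: "\<forall>x. mpoly_eval to_fract (lin d fb x) f = 0"
  show "f \<in> P"
  proof (rule ccontr)
    assume "f \<notin> P"
    with P have PT: "P \<in> {P \<in> multiproj m d. f \<notin> P}" by simp
    have "\<forall>T. P \<in> T \<and> openin (multiproj_zariski m d) T \<longrightarrow>
      (\<exists>y. y \<in> diagonal_map d Ls ` multiproj 1 d \<and> y \<in> T)"
      using assms unfolding mustafin_variety_def length_Ls[symmetric] in_closure_of by (rule conjunct2)
    from this[rule_format, OF conjI, OF PT openin_multiproj_basic[OF f]]
    obtain q where q: "q \<in> multiproj 1 d" "f \<notin> diagonal_map d Ls q" by (elim exE conjE imageE) simp
    have "pullback d Ls f \<in> q"
      using f0 pullback_eq_0_iff[OF multiforms_carrier[OF f]] ideal_mpoly_ringD(2)[OF multiproj_ideal[OF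
        q(1)]]
      by simp
    moreover interpret cring "mpoly_ring m d" by (rule mpoly_ring_cring)
    have "{f \<in> multiforms m d. pullback d Ls f \<in> q} \<subseteq> carrier (mpoly_ring m d)"
      by (auto dest: multiforms_carrier)
    note genideal_self[OF this]
    ultimately show False using q(2) f unfolding diagonal_map_def length_Ls[symmetric] by auto
  qed
qed

lemma topspace_special_fiber:
  "topspace (special_fiber res d Ls) = {P \<in> mustafin_variety d Ls. {a. Const a \<in> P} = {a. res a = 0}}"
  unfolding special_fiber_def length_Ls[symmetric] using mustafin_varietyD(1) by auto

definition "generic_component = {P \<in> topspace (special_fiber res d Ls). generic_point \<subseteq> P}"

lemma generic_point_component: "generic_point \<in> generic_component"
  unfolding generic_component_def topspace_special_fiber
  by (auto simp: Const_generic_point intro!: mustafin_varietyI generic_point_multiproj dest: subsetD[OF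
      generic_fiber_point_subset])

lemma closedin_special_fiber:
  assumes "F \<subseteq> multiforms m d"
  shows "closedin (special_fiber res d Ls) {P \<in> topspace (special_fiber res d Ls). F \<subseteq> P}"
proof -
  have "{P \<in> topspace (special_fiber res d Ls). F \<subseteq> P} =
      {P \<in> mustafin_variety d Ls. {a. Const a \<in> P} = {a. res a = 0}} \<inter> {P \<in> multiproj m d. F \<subseteq> P}"
    unfolding topspace_special_fiber using mustafin_varietyD(1) by auto
  then show ?thesis
    unfolding special_fiber_def length_Ls[symmetric]
    using closedin_subtopology_Int_closed[OF closedin_multiproj_forms[OF assms]] by simp
qed

text \<open>This makes \<open>generic_component\<close> the closure of \<open>generic_point\<close>
  inside the special fibre, hence irreducible.\<close>

lemma closedin_special_fiber_specialization:
  assumes C: "closedin (special_fiber res d Ls) C" "generic_point \<in> C" and P: "P \<in> generic_component"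
  shows "P \<in> C"
proof -
  let ?S = "{P \<in> mustafin_variety d Ls. {a. Const a \<in> P} = {a. res a = 0}}"
  obtain D where D: "closedin (multiproj_zariski m d) D" "C = ?S \<inter> D"
    using C(1) unfolding special_fiber_def length_Ls[symmetric] closedin_subtopology
      by (auto simp: Int_commute)
  have P': "P \<in> ?S" "generic_point \<subseteq> P" using P unfolding generic_component_def topspace_special_fiber
      by auto
  have "P \<in> D"
  proof (rule ccontr)
    assume "P \<notin> D"
    moreover have "P \<in> multiproj m d" using P'(1) by (intro mustafin_varietyD(1)) simp
    ultimately have "P \<in> topspace (multiproj_zariski m d) - D" by simp
    moreover have "openin (multiproj_zariski m d) (topspace (multiproj_zariski m d) - D)"
      using D(1) by (rule openin_diff[OF openin_topspace])
    ultimately have "generic_point \<in> topspace (multiproj_zariski m d) - D"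
      using multiproj_zariski_generization[OF _ _ generic_point_multiproj P'(2)] by blast
    then show False using C(2) D(2) by simp
  qed
  with P'(1) D(2) show ?thesis by blast
qed

lemma irreducible_generic_component:
  "irreducible_component_of (special_fiber res d Ls) generic_component"
  unfolding irreducible_component_of_def
proof (intro conjI allI impI)
  show "irreducible_in (special_fiber res d Ls) generic_component"
    unfolding irreducible_in_def
  proof (intro conjI allI impI)
    show "generic_component \<subseteq> topspace (special_fiber res d Ls)" by (auto simp: generic_component_def)
    show "generic_component \<noteq> {}" using generic_point_component by auto
    fix C D assume CD: "closedin (special_fiber res d Ls) C \<and> closedin (special_fiber res d Ls) D \<and>
      generic_component \<subseteq> C \<union> D"
    then have "generic_point \<in> C \<or> generic_point \<in> D" using generic_point_component by auto
    then show "generic_component \<subseteq> C \<or> generic_component \<subseteq> D"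
      using CD closedin_special_fiber_specialization by blast
  qed
  fix Z' assume Z': "irreducible_in (special_fiber res d Ls) Z' \<and> generic_component \<subseteq> Z'"
  show "Z' = generic_component"
  proof (rule generic_point_subset)
    fix g
    assume g: "g \<in> multiforms m d" "g \<notin> generic_point"
      and sub: "\<And>P. P \<in> multiproj m d \<Longrightarrow> (\<And>a. res a = 0 \<Longrightarrow> Const a \<in> P) \<Longrightarrow>
        (\<And>f. f \<in> multiforms m d \<Longrightarrow> (\<forall>x. mpoly_eval to_fract (lin d fb x) f = 0) \<Longrightarrow> f \<in> P) \<Longrightarrow>
        g \<notin> P \<Longrightarrow> generic_point \<subseteq> P"
    define F where "F = {f \<in> multiforms m d. \<forall>x\<in>range (lin d rb). mpoly_eval res x f = 0}"
    have comp: "generic_component = {P \<in> topspace (special_fiber res d Ls). F \<subseteq> P}"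
      unfolding generic_component_def
    proof (intro Collect_cong conj_cong refl)
      fix P assume "P \<in> topspace (special_fiber res d Ls)"
      then have "P \<in> multiproj m d" by (intro mustafin_varietyD(1)) (simp add: topspace_special_fiber)
      then show "generic_point \<subseteq> P \<longleftrightarrow> F \<subseteq> P"
        unfolding generic_point_def F_def by (intro vanishing_ideal_subset_iff[OF inf res_hom
          multiproj_ideal])
    qed
    \<comment> \<open>Both sets on the right are closed, so the irreducible \<open>Z'\<close> lies
      in one of them. The second is excluded, because \<open>generic_point\<close> belongs to
      \<open>Z'\<close> and does not contain \<open>g\<close>.\<close>
    have "Z' \<subseteq> {P \<in> topspace (special_fiber res d Ls). F \<subseteq> P} \<union> {P
      \<in> topspace (special_fiber res d Ls). {g} \<subseteq> P}"
    proof
      fix P assume "P \<in> Z'"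
      then have P: "P \<in> topspace (special_fiber res d Ls)" using Z' by (auto simp: irreducible_in_def)
      then have "P \<in> mustafin_variety d Ls" "\<And>a. res a = 0 \<Longrightarrow> Const a \<in> P"
        by (auto simp: topspace_special_fiber)
      then have "generic_point \<subseteq> P" if "g \<notin> P"
        using that by (intro sub) (rule mustafin_varietyD, assumption+)+
      with P show "P \<in> {P \<in> topspace (special_fiber res d Ls). F \<subseteq> P} \<union> {P
        \<in> topspace (special_fiber res d Ls). {g} \<subseteq> P}"
        unfolding comp[symmetric] by (auto simp: generic_component_def)
    qed
    moreover have "closedin (special_fiber res d Ls) {P \<in> topspace (special_fiber res d Ls). F \<subseteq> P}"
      "closedin (special_fiber res d Ls) {P \<in> topspace (special_fiber res d Ls). {g} \<subseteq> P}"
      using g(1) by (auto intro!: closedin_special_fiber[of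
        "{g}", simplified] closedin_special_fiber simp: F_def)
    ultimately have "Z' \<subseteq> generic_component \<or> Z' \<subseteq> {P \<in> topspace (special_fiber res d Ls). {g} \<subseteq> P}"
      using Z' unfolding comp irreducible_in_def by blast
    then show "Z' = generic_component" using Z' generic_point_component g(2) by auto
  qed
qed

text \<open>The primes involve forms over R, while \<open>image_variety\<close> uses forms over the
  residue field. Coefficients are moved by \<open>res\<close> in one direction and by a section of
  it in the other; the section need not be a homomorphism, since only multidegrees and values after
  reduction matter.\<close>

lemma rational_points_generic_component:
  "rational_points res m d generic_component = image_variety d m d rb"
proof -
  have "residue_point res m d x \<in> generic_component \<longleftrightarrow>
      (\<forall>f\<in>multiforms m d. (\<forall>w. poly_at (lin d rb w) f = 0) \<longrightarrow> form_at f x = 0)"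
    (is "?P \<in> _ \<longleftrightarrow> ?R") if x: "x \<in> coord_tuples m d" for x
  proof
    note pt = residue_point_vanishing_ideal[OF inf res_hom, of m d x]
    assume "?P \<in> generic_component"
    then have sub: "generic_point \<subseteq> ?P" by (simp add: generic_component_def)
    show ?R
    proof (intro ballI impI)
      fix f assume f: "f \<in> multiforms m d" and f0: "\<forall>w. poly_at (lin d rb w) f = 0"
      define sec where "sec = inv_into UNIV res"
      have sec: "res (sec c) = c" for c
        unfolding sec_def by (rule surj_f_inv_f[OF res_surj])
      define f' where "f' = mpoly_eval (\<lambda>c. Const (sec c)) Var f"
      have f': "f' \<in> multiforms m d"
        using f unfolding f'_def multiforms_def by (auto intro: multihomogeneous_map_coeffs)
      have ev: "mpoly_eval res y f' = poly_at y f" for y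
        unfolding f'_def by (simp add: hom_mpoly_eval[OF mpoly_eval_hom[OF res_hom]] mpoly_eval_Const
          mpoly_eval_Var sec)
      have "f' \<in> generic_point"
        unfolding generic_point_def by (simp add: vanishing_ideal_form[OF f'] ev f0)
      with sub have "f' \<in> vanishing_ideal res m d {coords x}" by (auto simp: pt)
      then show "form_at f x = 0" by (simp add: vanishing_ideal_form[OF f'] ev form_at_coords)
    qed
  next
    note pt = residue_point_vanishing_ideal[OF inf res_hom, of m d x]
    assume R: ?R
    have P: "?P \<in> multiproj m d"
      unfolding pt
    proof (rule vanishing_ideal_multiproj[OF inf res_hom line_connected_singleton])
      fix i assume i: "i < m"
      then have "x i \<in> carrier_vec d" "x i \<noteq> 0\<^sub>v d" using x by (auto simp: coord_tuples_def)
      then have "\<exists>j<d. x i $ j \<noteq> 0" by (metis carrier_vecD eq_vecI index_zero_vec(1) index_zero_vec(2))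
      then show "\<exists>j<d. \<exists>x\<in>{coords x}. x (i, j) \<noteq> 0" by (simp add: coords_def)
    qed
    have sub: "generic_point \<subseteq> ?P"
      unfolding generic_point_def vanishing_ideal_subset_iff[OF inf res_hom multiproj_ideal[OF P]]
    proof
      fix f assume "f \<in> {f \<in> multiforms m d. \<forall>x\<in>range (lin d rb). mpoly_eval res x f = 0}"
      then have f: "f \<in> multiforms m d" and f0: "\<And>w. mpoly_eval res (lin d rb w) f = 0" by auto
      define f' where "f' = mpoly_eval (\<lambda>c. Const (res c)) Var f"
      have f': "f' \<in> multiforms m d"
        using f unfolding f'_def multiforms_def by (auto intro: multihomogeneous_map_coeffs)
      have ev: "poly_at y f' = mpoly_eval res y f" for y
        unfolding f'_def by (simp add: hom_mpoly_eval[OF mpoly_eval_hom[OF id_hom]] mpoly_eval_Const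
          mpoly_eval_Var)
      have "form_at f' x = 0" using R f' f0 by (simp add: ev)
      then show "f \<in> ?P" by (simp add: pt vanishing_ideal_form[OF f] form_at_coords ev)
    qed
    have "Const a \<in> ?P \<longleftrightarrow> res a = 0" for a
      unfolding pt by (subst vanishing_ideal_form[OF multiforms_Const]) (simp add: mpoly_eval_Const)
    with P sub generic_fiber_point_subset show "?P \<in> generic_component"
      unfolding generic_component_def topspace_special_fiber by (auto intro!: mustafin_varietyI)
  qed
  then show ?thesis unfolding rational_points_def image_variety_def by blast
qed

end

section \<open>A linear subspace mapped birationally onto the image\<close>

definition poly_on_lines :: "((nat \<Rightarrow> 'b::comm_ring_1) \<Rightarrow> 'b) \<Rightarrow> bool" where
  "poly_on_lines \<phi> \<longleftrightarrow> (\<forall>x y. polyfun (\<lambda>t. \<phi> (\<lambda>l. x l + t * (y l - x l))))"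

text \<open>A point good for the earlier functions and a point good for the new one are joined by a
  line, on which every function is a polynomial that is nonzero somewhere.\<close>

lemma common_nonzero:
  fixes \<Phi> :: "((nat \<Rightarrow> 'b::field) \<Rightarrow> 'b) set"
  assumes inf: "infinite (UNIV :: 'b set)" and "finite \<Phi>"
    and "\<And>\<phi>. \<phi> \<in> \<Phi> \<Longrightarrow> poly_on_lines \<phi>" "\<And>\<phi>. \<phi> \<in> \<Phi> \<Longrightarrow> \<exists>x. \<phi> x \<noteq> 0"
  shows "\<exists>x. \<forall>\<phi>\<in>\<Phi>. \<phi> x \<noteq> 0"
  using assms(2-4)
proof (induction \<Phi> rule: finite_induct)
  case (insert \<psi> F)
  then obtain x where x: "\<forall>\<phi>\<in>F. \<phi> x \<noteq> 0" by auto
  obtain y where y: "\<psi> y \<noteq> 0" using insert.prems(2) by auto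
  have "\<exists>t. \<forall>\<phi>\<in>insert \<psi> F. \<phi> (\<lambda>l. x l + t * (y l - x l)) \<noteq> 0"
  proof (rule polyfun_prod_nonzero[OF inf])
    fix \<phi> assume \<phi>: "\<phi> \<in> insert \<psi> F"
    then show "polyfun (\<lambda>t. \<phi> (\<lambda>l. x l + t * (y l - x l)))"
      using insert.prems(1) unfolding poly_on_lines_def by blast
    show "\<exists>t. \<phi> (\<lambda>l. x l + t * (y l - x l)) \<noteq> 0"
    proof (cases "\<phi> = \<psi>")
      case True
      then show ?thesis using y by (intro exI[of _ 1]) simp
    next
      case False
      then show ?thesis using x \<phi> by (intro exI[of _ 0]) simp
    qed
  qed (use insert.hyps in auto)
  then show ?case by blast
qed simp

lemma polyfun_lin_line: "polyfun (\<lambda>t. lin q a (\<lambda>l. x l + t * (y l - x l)) v)"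
  unfolding lin_def case_prod_unfold diff_conv_add_uminus by (intro polyfun_intros)

lemma poly_on_lines_lin: "poly_on_lines (\<lambda>x. lin q a x v)"
  unfolding poly_on_lines_def by (intro allI polyfun_lin_line)

lemma poly_on_lines_form: "poly_on_lines (\<lambda>x. mpoly_eval h (lin q a x) f)"
  unfolding poly_on_lines_def by (intro allI polyfun_mpoly_eval polyfun_lin_line)

text \<open>If \<open>q < d\<close>, padding both factors with zeros to size \<open>d\<close> leaves
  a zero row in the second one, although the product of the determinants has to be 1.\<close>

lemma left_inverse_dim_le:
  fixes Q :: "nat \<Rightarrow> nat \<Rightarrow> 'b::field"
  assumes "\<And>a b. a < d \<Longrightarrow> b < d \<Longrightarrow> (\<Sum>r<q. Q a r * W r b) = (if a = b then 1 else 0)"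
  shows "d \<le> q"
proof (rule ccontr)
  assume "\<not> d \<le> q"
  then have q: "q < d" by simp
  define A where "A = mat d d (\<lambda>(a, r). if r < q then Q a r else 0)"
  define B where "B = mat d d (\<lambda>(r, b). if r < q then W r b else 0)"
  have "A * B = 1\<^sub>m d"
  proof (rule eq_matI)
    fix a b assume "a < dim_row (1\<^sub>m d :: 'b mat)" "b < dim_col (1\<^sub>m d :: 'b mat)"
    then have ab: "a < d" "b < d" by auto
    have "(A * B) $$ (a, b) = (\<Sum>r<d. if r < q then Q a r * W r b else 0)"
      using ab by (auto simp: A_def B_def scalar_prod_def atLeast0LessThan intro!: sum.cong)
    also have "\<dots> = (\<Sum>r<q. Q a r * W r b)"
      using q by (intro sum.mono_neutral_cong_right) auto
    finally show "(A * B) $$ (a, b) = 1\<^sub>m d $$ (a, b)" using assms ab by simp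
  qed (auto simp: A_def B_def)
  moreover have "A \<in> carrier_mat d d" "B \<in> carrier_mat d d" by (auto simp: A_def B_def)
  ultimately have "det A * det B = 1" by (metis det_mult det_one)
  moreover have "det B = 0"
  proof -
    have "(\<Prod>i = 0..<d. B $$ (i, p i)) = 0" if p: "p permutes {0..<d}" for p
      by (rule prod_zero) (use q p in \<open>auto simp: B_def permutes_in_image intro!: bexI[of _ q]\<close>)
    moreover have "B \<in> carrier_mat d d" by (simp add: B_def)
    ultimately show ?thesis by (subst det_def') (auto intro!: sum.neutral)
  qed
  ultimately show False by simp
qed

text \<open>The subspace spanned by the columns of \<open>W\<close> meets the closed fibre through \<open>W w\<close> of the rational
  map given by \<open>a\<close> in this one point only.\<close>

definition transversal ::
    "nat \<Rightarrow> nat \<Rightarrow> nat \<Rightarrow> (nat \<Rightarrow> nat \<Rightarrow> nat \<Rightarrow> 'b::field) \<Rightarrow> (nat \<Rightarrow> 'b) \<Rightarrow> bool" where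
  "transversal n r d P w \<longleftrightarrow> (\<forall>i<n. \<exists>j<r. lin d P w (i, j) \<noteq> 0) \<and>
     (\<forall>z s. (\<forall>i<n. \<forall>j<r. lin d P z (i, j) = s i * lin d P w (i, j)) \<longrightarrow> (\<exists>c. \<forall>l<d. z l = c * w l))"

lemma transversal_nonzero: "transversal n r d P w \<Longrightarrow> i < n \<Longrightarrow> \<exists>j<r. lin d P w (i, j) \<noteq> 0"
  by (simp add: transversal_def)

lemma transversal_unique:
  assumes "transversal n r d P w" "\<And>i j. i < n \<Longrightarrow> j < r \<Longrightarrow> lin d P z (i, j) = s i * lin d P w (i, j)"
  shows "\<exists>c. \<forall>l<d. z l = c * w l"
proof -
  have "\<forall>i<n. \<forall>j<r. lin d P z (i, j) = s i * lin d P w (i, j)" using assms(2) by blast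
  with conjunct2[OF assms(1)[unfolded transversal_def]] show ?thesis by blast
qed

definition restrict_maps ::
    "nat \<Rightarrow> (nat \<Rightarrow> nat \<Rightarrow> nat \<Rightarrow> 'b::comm_ring_1) \<Rightarrow> (nat \<Rightarrow> nat \<Rightarrow> 'b) \<Rightarrow> nat \<Rightarrow> nat \<Rightarrow> nat \<Rightarrow> 'b" where
  "restrict_maps q a W = (\<lambda>i j l. \<Sum>e<q. a i j e * W e l)"

lemma lin_restrict_maps: "lin d (restrict_maps q a W) w = lin q a (\<lambda>e. \<Sum>l<d. W e l * w l)"
proof (rule ext, clarify)
  fix i j
  have "lin d (restrict_maps q a W) w (i, j) = (\<Sum>l<d. \<Sum>e<q. a i j e * W e l * w l)"
    by (simp add: lin_apply restrict_maps_def sum_distrib_right)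
  also have "\<dots> = (\<Sum>e<q. \<Sum>l<d. a i j e * W e l * w l)" by (rule sum.swap)
  also have "\<dots> = lin q a (\<lambda>e. \<Sum>l<d. W e l * w l) (i, j)"
    by (simp add: lin_apply sum_distrib_left mult.assoc)
  finally show "lin d (restrict_maps q a W) w (i, j) = lin q a (\<lambda>e. \<Sum>l<d. W e l * w l) (i, j)" .
qed

lemma lin_zero: "(\<And>l. l < d \<Longrightarrow> w l = 0) \<Longrightarrow> lin d P w v = 0"
  by (simp add: lin_def case_prod_unfold)

text \<open>For \<open>s = 0\<close> the uniqueness in \<open>transversal\<close> says that a vector
  killed by all maps is a multiple of \<open>w\<close>, and \<open>w\<close> is not killed. So the
  columns of \<open>W\<close> are independent; this bounds the dimensions among which a maximum is
  taken.\<close>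

lemma transversal_dim_le:
  fixes a :: "nat \<Rightarrow> nat \<Rightarrow> nat \<Rightarrow> 'b::field"
  assumes n: "n > 0" and t: "transversal n r d (restrict_maps q a W) w"
  shows "d \<le> q"
proof -
  let ?P = "restrict_maps q a W"
  have "\<exists>Q. \<forall>c<d. \<forall>b<d. (\<Sum>e\<in>{..<q}. Q c e * W e b) = (if c = b then 1 else 0)"
  proof (rule left_inverse)
    fix z assume "\<And>e. e \<in> {..<q} \<Longrightarrow> (\<Sum>b<d. W e b * z b) = 0"
    then have 0: "lin d ?P z v = 0" for v
      unfolding lin_restrict_maps by (intro lin_zero) simp
    then have "\<exists>c. \<forall>l<d. z l = c * w l"
      by (intro transversal_unique[OF t, where s = "\<lambda>_. 0"]) simp
    then obtain c where c: "\<And>l. l < d \<Longrightarrow> z l = c * w l" by blast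
    obtain j where j: "lin d ?P w (0, j) \<noteq> 0" using transversal_nonzero[OF t n] by blast
    have "0 = lin d ?P (\<lambda>l. c * w l) (0, j)" using lin_cong[of d z "\<lambda>l. c * w l" ?P] c 0[of "(0, j)"]
      by simp
    then have "c = 0" using j by (simp add: lin_scale)
    with c show "\<forall>b<d. z b = 0" by simp
  qed simp
  then show ?thesis using left_inverse_dim_le by metis
qed

text \<open>The vector \<open>x\<close> becomes the new column, with index \<open>d\<close>, and
  also the new distinguished point. The hypothesis \<open>no\<close> says that the old subspace
  misses the closed fibre through \<open>x\<close>.\<close>

lemma transversal_extend:
  fixes a :: "nat \<Rightarrow> nat \<Rightarrow> nat \<Rightarrow> 'b::field"
  assumes x: "\<forall>i<n. \<exists>j<r. lin q a x (i, j) \<noteq> 0"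
    and no: "\<And>z s. (\<forall>i<n. \<forall>j<r. lin d (restrict_maps q a W) z (i, j) = s i * lin q a x (i, j)) \<Longrightarrow>
      \<forall>l<d. z l = 0"
  shows "\<exists>W w. transversal n r (Suc d) (restrict_maps q a W) w"
proof (intro exI)
  define W' where "W' e l = (if l = d then x e else W e l)" for e l
  define w where "w l = (if l = d then 1 else 0 :: 'b)" for l
  have split: "lin (Suc d) (restrict_maps q a W') z v = lin d (restrict_maps q a W) z v +
      z d * lin q a x v" for z v
    by (cases v) (simp add: lin_apply restrict_maps_def W'_def mult.commute)
  have w: "lin (Suc d) (restrict_maps q a W') w v = lin q a x v" for v
    unfolding split by (simp add: lin_zero w_def)
  show "transversal n r (Suc d) (restrict_maps q a W') w"
    unfolding transversal_def w
  proof (intro conjI allI impI)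
    fix z s assume eq: "\<forall>i<n. \<forall>j<r. lin (Suc d) (restrict_maps q a W') z (i, j) = s i * lin q a x (i, j)"
    \<comment> \<open>The contribution \<open>z d * x\<close> of the new column is proportional to
      \<open>x\<close> in every factor and is absorbed by the scalars.\<close>
    have "\<forall>l<d. z l = 0"
      by (rule no[of z "\<lambda>i. s i - z d"]) (use eq in \<open>auto simp: split algebra_simps\<close>)
    then show "\<exists>c. \<forall>l<Suc d. z l = c * w l"
      by (intro exI[of _ "z d"]) (auto simp: w_def less_Suc_eq)
  qed (use x in auto)
qed

text \<open>The pairs \<open>(z, s)\<close> with \<open>P z = s a x\<close> solve a linear system
  whose coefficients depend on \<open>x\<close>. At \<open>x0\<close> its solutions are the
  multiples of \<open>(w, 1, ..., 1)\<close>, so adding \<open>s k = 0\<close> leaves only 0, and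
  this persists wherever a suitable determinant \<open>\<delta>\<close> is nonzero.\<close>

lemma transversal_open:
  fixes a :: "nat \<Rightarrow> nat \<Rightarrow> nat \<Rightarrow> 'b::field"
  assumes t: "transversal n r d P w" and x0: "\<And>i j. i < n \<Longrightarrow> j < r \<Longrightarrow> lin q a x0 (i, j) = lin d P w (i, j)"
    and k: "k < n"
  shows "\<exists>\<delta>. poly_on_lines \<delta> \<and> \<delta> x0 \<noteq> 0 \<and> (\<forall>x. \<delta> x \<noteq> 0 \<longrightarrow> (\<forall>z s. s k = 0 \<longrightarrow>
    (\<forall>i<n. \<forall>j<r. lin d P z (i, j) = s i * lin q a x (i, j)) \<longrightarrow> (\<forall>l<d. z l = 0)))"
proof -
  let ?N = "d + n"
  \<comment> \<open>The row \<open>(n, 0)\<close> stands for the equation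
    \<open>s k = 0\<close>.\<close>
  define I where "I = insert (n, 0) ({..<n} \<times> {..<r})"
  have fin: "finite I" by (simp add: I_def)
  define L where "L x v c = (if fst v < n then (if c < d then P (fst v) (snd v) c else
      if c = d + fst v then - lin q a x v else 0)
      else if c = d + k then 1 else 0)" for x v c
  have L1: "(\<Sum>c<?N. L x (i, j) c * u c) = lin d P u (i, j) - u (d + i) * lin q a x (i, j)"
    if "i < n" for x i j u
  proof -
    have "(\<Sum>c<?N. L x (i, j) c * u c) =
        (\<Sum>c<?N. (if c < d then P i j c * u c else 0) + (if c = d + i then - lin q a x (i, j) * u c else 0))"
      using that by (intro sum.cong) (auto simp: L_def)
    also have "\<dots> = (\<Sum>c<?N. if c < d then P i j c * u c else 0) - u (d + i) * lin q a x (i, j)"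
      using that by (simp add: sum.distrib mult.commute)
    also have "(\<Sum>c<?N. if c < d then P i j c * u c else 0) = lin d P u (i, j)"
      unfolding lin_apply by (rule sum.mono_neutral_cong_right) auto
    finally show ?thesis .
  qed
  have L2: "(\<Sum>c<?N. L x (n, 0) c * u c) = u (d + k)" for x u
  proof -
    have "(\<Sum>c<?N. L x (n, 0) c * u c) = (\<Sum>c<?N. if c = d + k then u c else 0)"
      by (intro sum.cong) (auto simp: L_def)
    then show ?thesis using k by simp
  qed
  have "\<exists>Q. \<forall>c<?N. \<forall>b<?N. (\<Sum>v\<in>I. Q c v * L x0 v b) = (if c = b then 1 else 0)"
  proof (rule left_inverse[OF fin])
    fix u assume zero: "\<And>v. v \<in> I \<Longrightarrow> (\<Sum>c<?N. L x0 v c * u c) = 0"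
    have eq: "lin d P u (i, j) = u (d + i) * lin d P w (i, j)" if "i < n" "j < r" for i j
      using zero[of "(i, j)"] that by (simp add: I_def L1 x0)
    then have "\<exists>c. \<forall>l<d. u l = c * w l"
      by (rule transversal_unique[OF t, where s = "\<lambda>i. u (d + i)"])
    then obtain c where c: "\<And>l. l < d \<Longrightarrow> u l = c * w l" by blast
    have uc: "u (d + i) = c" if i: "i < n" for i
    proof -
      obtain j where j: "j < r" "lin d P w (i, j) \<noteq> 0" using transversal_nonzero[OF t i] by blast
      have "lin d P u (i, j) = c * lin d P w (i, j)" using c
        by (simp add: lin_scale[symmetric] cong: lin_cong)
      with eq[OF i j(1)] j(2) show ?thesis by simp
    qed
    have "c = 0" using zero[of "(n, 0)"] uc[OF k] by (simp add: I_def L2)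
    show "\<forall>b<?N. u b = 0"
    proof (intro allI impI)
      fix b assume b: "b < ?N"
      show "u b = 0"
        using c[of b] uc[of "b - d"] b \<open>c = 0\<close> by (cases "b < d") auto
    qed
  qed
  then obtain Q where Q: "\<And>c b. c < ?N \<Longrightarrow> b < ?N \<Longrightarrow> (\<Sum>v\<in>I. Q c v * L x0 v b) = (if c = b then 1 else 0)"
    by blast
  \<comment> \<open>\<open>Q\<close> is fixed as a left inverse at \<open>x0\<close>. Combining the
    rows with it gives a square system for every \<open>x\<close>, with the identity matrix at
    \<open>x0\<close>.\<close>
  define M where "M x = mat ?N ?N (\<lambda>(c, b). \<Sum>v\<in>I. Q c v * L x v b)" for x
  have M: "M x \<in> carrier_mat ?N ?N" for x by (simp add: M_def)
  show ?thesis
  proof (intro exI[of _ "\<lambda>x. det (M x)"] conjI allI impI)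
    show "poly_on_lines (\<lambda>x. det (M x))"
      unfolding poly_on_lines_def
    proof (intro allI, rule polyfun_det)
      fix x y :: "nat \<Rightarrow> 'b" and c b assume cb: "c < ?N" "b < ?N"
      have "polyfun (\<lambda>t. L (\<lambda>l. x l + t * (y l - x l)) v b)" for v
        unfolding L_def
        by (cases "fst v < n"; cases "b < d"; cases "b = d + fst v"; cases "b = d + k")
           (simp_all add: polyfun_uminus polyfun_lin_line polyfun_const)
      then have "polyfun (\<lambda>t. \<Sum>v\<in>I. Q c v * L (\<lambda>l. x l + t * (y l - x l)) v b)"
        by (intro polyfun_sum polyfun_mult polyfun_const)
      with cb show "polyfun (\<lambda>t. M (\<lambda>l. x l + t * (y l - x l)) $$ (c, b))"
        by (simp add: M_def)
    qed (rule M)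
    have "M x0 = 1\<^sub>m ?N"
      by (rule eq_matI) (auto simp: M_def Q)
    then show "det (M x0) \<noteq> 0" by simp
  next
    fix x z s l
    assume det: "det (M x) \<noteq> 0" and s: "s k = 0" and l: "l < d"
      and eq: "\<forall>i<n. \<forall>j<r. lin d P z (i, j) = s i * lin q a x (i, j)"
    define u where "u c = (if c < d then z c else s (c - d))" for c
    have zu: "lin d P u = lin d P z" by (rule lin_cong) (simp add: u_def)
    have L0: "(\<Sum>c<?N. L x v c * u c) = 0" if "v \<in> I" for v
      using that s eq by (auto simp: I_def L1 L2 zu) (simp_all add: u_def)
    have "M x *\<^sub>v vec ?N u = 0\<^sub>v ?N"
    proof (rule eq_vecI)
      fix c assume "c < dim_vec (0\<^sub>v ?N :: 'b vec)"
      then have c: "c < ?N" by simp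
      have "(M x *\<^sub>v vec ?N u) $ c = (\<Sum>b<?N. (\<Sum>v\<in>I. Q c v * L x v b) * u b)"
        using c by (simp add: M_def scalar_prod_def atLeast0LessThan)
      also have "\<dots> = (\<Sum>v\<in>I. Q c v * (\<Sum>b<?N. L x v b * u b))"
        unfolding sum_distrib_right sum_distrib_left by (subst sum.swap) (simp only: mult_ac)
      also have "\<dots> = 0" by (rule sum.neutral) (simp add: L0)
      finally show "(M x *\<^sub>v vec ?N u) $ c = 0\<^sub>v ?N $ c" using c by simp
    qed (simp add: M_def)
    then have "vec ?N u = 0\<^sub>v ?N"
      using det det_0_iff_vec_prod_zero_field[OF M, of x] vec_carrier by metis
    then have "vec ?N u $ l = 0" using l by simp
    then show "z l = 0" using l by (simp add: u_def)
  qed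
qed

text \<open>Suppose \<open>f\<close> vanishes on the image of the subspace but not at a general
  \<open>x\<close>. By maximality of \<open>d\<close> the vector \<open>x\<close> cannot be added to
  \<open>W\<close>, so some nonzero \<open>z\<close> satisfies \<open>P z = s a x\<close>. The
  choice of \<open>x\<close> makes all \<open>s k\<close> nonzero, and by homogeneity
  \<open>f\<close> is then nonzero at \<open>P z\<close>, a contradiction.\<close>

lemma birational_restriction:
  fixes a :: "nat \<Rightarrow> nat \<Rightarrow> nat \<Rightarrow> 'b::field"
  assumes inf: "infinite (UNIV :: 'b set)" and n: "n > 0"
    and a: "\<And>i. i < n \<Longrightarrow> \<exists>j<r. \<exists>x. lin q a x (i, j) \<noteq> 0"
  shows "\<exists>d W w. transversal n r d (restrict_maps q a W) w \<and> (\<forall>f\<in>multiforms n r.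
    (\<forall>z. poly_at (lin d (restrict_maps q a W) z) f = 0) \<longrightarrow> (\<forall>x. poly_at (lin q a x) f = 0))"
proof -
  obtain jj where jj: "\<And>i. i < n \<Longrightarrow> jj i < r" "\<And>i. i < n \<Longrightarrow> \<exists>x. lin q a x (i, jj i) \<noteq> 0"
    using a by metis
  let ?Coord = "(\<lambda>i x. lin q a x (i, jj i)) ` {..<n}"
  have "\<exists>x. \<forall>\<phi>\<in>?Coord. \<phi> x \<noteq> 0"
    by (rule common_nonzero[OF inf]) (use jj(2) poly_on_lines_lin in auto)
  then obtain x1 where "\<forall>i<n. lin q a x1 (i, jj i) \<noteq> 0" by auto
  then have x1: "\<forall>i<n. \<exists>j<r. lin q a x1 (i, j) \<noteq> 0" using jj(1) by blast
  \<comment> \<open>In dimension 0 the condition on \<open>z\<close> is void, so the point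
    \<open>x1\<close> alone spans a transversal subspace of dimension 1.\<close>
  have ex: "\<exists>W w. transversal n r (Suc 0) (restrict_maps q a W) w"
    by (rule transversal_extend[OF x1]) simp
  define G where "G d \<longleftrightarrow> (\<exists>W w. transversal n r d (restrict_maps q a W) w)" for d
  have G1: "G (Suc 0)" using ex by (simp add: G_def)
  have Gq: "\<And>d. G d \<Longrightarrow> d \<le> q" using transversal_dim_le[OF n] by (auto simp: G_def)
  define d where "d = (GREATEST d. G d)"
  have "G d" unfolding d_def using G1 Gq by (rule GreatestI_nat)
  then have d: "\<exists>W w. transversal n r d (restrict_maps q a W) w" by (simp add: G_def)
  have max: "d' \<le> d" if "\<exists>W w. transversal n r d' (restrict_maps q a W) w" for d'
    unfolding d_def using that[folded G_def] Gq by (rule Greatest_le_nat)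
  obtain W w where t: "transversal n r d (restrict_maps q a W) w" using d by blast
  let ?P = "restrict_maps q a W"
  define x0 where "x0 = (\<lambda>e. \<Sum>l<d. W e l * w l)"
  have x0: "lin q a x0 = lin d ?P w" by (simp add: lin_restrict_maps x0_def)
  \<comment> \<open>\<open>\<delta> k\<close> is nonzero at \<open>x0\<close>, and where it is
    nonzero no solution with \<open>z\<close> nonzero has \<open>s k = 0\<close>.\<close>
  have "\<forall>k. \<exists>\<delta>. k < n \<longrightarrow> poly_on_lines \<delta> \<and> \<delta> x0 \<noteq> 0 \<and> (\<forall>x. \<delta> x \<noteq> 0 \<longrightarrow> (\<forall>z s. s k = 0 \<longrightarrow>
    (\<forall>i<n. \<forall>j<r. lin d ?P z (i, j) = s i * lin q a x (i, j)) \<longrightarrow> (\<forall>l<d. z l = 0)))"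
    using transversal_open[OF t, of q a x0] x0 by simp
  then obtain \<delta> where \<delta>: "\<And>k. k < n \<Longrightarrow> poly_on_lines (\<delta> k)" "\<And>k. k < n \<Longrightarrow> \<delta> k x0 \<noteq> 0"
    and \<delta>0: "\<And>k x z s. k < n \<Longrightarrow> \<delta> k x \<noteq> 0 \<Longrightarrow> s k = 0 \<Longrightarrow>
      \<forall>i<n. \<forall>j<r. lin d ?P z (i, j) = s i * lin q a x (i, j) \<Longrightarrow> \<forall>l<d. z l = 0"
    by metis
  have "\<forall>x. poly_at (lin q a x) f = 0"
    if f: "f \<in> multiforms n r" and f0: "\<And>z. poly_at (lin d ?P z) f = 0" for f
  proof (rule ccontr)
    assume "\<not> ?thesis"
    then have fx: "\<exists>x. poly_at (lin q a x) f \<noteq> 0" by blast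
    have "\<exists>x. \<forall>\<phi>\<in>insert (\<lambda>x. poly_at (lin q a x) f) (\<delta> ` {..<n} \<union> ?Coord). \<phi> x \<noteq> 0"
      by (rule common_nonzero[OF inf])
         (use jj(2) fx \<delta> poly_on_lines_lin poly_on_lines_form in auto)
    then obtain x where x: "\<forall>\<phi>\<in>insert (\<lambda>x. poly_at (lin q a x) f) (\<delta> ` {..<n} \<union> ?Coord). \<phi> x \<noteq> 0" ..
    have fx: "poly_at (lin q a x) f \<noteq> 0" using bspec[OF x insertI1] .
    have \<delta>x: "\<delta> k x \<noteq> 0" if "k < n" for k
      by (rule bspec[OF x]) (use that in auto)
    have cx: "lin q a x (i, jj i) \<noteq> 0" if "i < n" for i
    proof -
      have "(\<lambda>x. lin q a x (i, jj i)) \<in> ?Coord" using that by auto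
      then show ?thesis using bspec[OF x, of "\<lambda>x. lin q a x (i, jj i)"] by blast
    qed
    then have nz: "\<forall>i<n. \<exists>j<r. lin q a x (i, j) \<noteq> 0" using jj(1) cx by blast
    have "\<not> Suc d \<le> d" by simp
    then obtain z s where zs: "\<forall>i<n. \<forall>j<r. lin d ?P z (i, j) = s i * lin q a x (i, j)"
      and z: "\<not> (\<forall>l<d. z l = 0)"
      using max transversal_extend[OF nz, of d W] by blast
    have s: "s k \<noteq> 0" if "k < n" for k
      using \<delta>0[OF that \<delta>x[OF that] _ zs] z by blast
    obtain e where e: "multihomogeneous n r e f" using f by (auto simp: multiforms_def)
    have "poly_at (lin d ?P z) f = poly_at (\<lambda>(i, j). s i * lin q a x (i, j)) f"
      by (rule mpoly_eval_cong[OF multihomogeneous_carrier[OF e]]) (use zs in auto)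
    also have "\<dots> = (\<Prod>i<n. s i ^ e i) * poly_at (lin q a x) f"
      by (rule mpoly_eval_scale[OF e])
    finally show False using f0 fx s by simp
  qed
  with t show ?thesis by blast
qed

section \<open>Varieties in products of projective spaces\<close>

lemma proj_point_iff: "y \<in> proj_point m x \<longleftrightarrow> (\<forall>i<m. \<exists>c. c \<noteq> 0 \<and> y i = c \<cdot>\<^sub>v x i)"
  by (simp add: proj_point_def)

lemma proj_point_self: "x \<in> proj_point m x"
  unfolding proj_point_iff by (auto intro!: exI[of _ 1])

lemma proj_point_eqI:
  assumes y: "y \<in> proj_point m x"
  shows "proj_point m y = proj_point m x"
proof -
  have sub: "proj_point m y \<subseteq> proj_point m x" if y: "y \<in> proj_point m x" for x y :: "nat \<Rightarrow> 'a vec"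
  proof
    fix z assume z: "z \<in> proj_point m y"
    show "z \<in> proj_point m x"
      unfolding proj_point_iff
    proof (intro allI impI)
      fix i assume i: "i < m"
      obtain c where c: "c \<noteq> 0" "y i = c \<cdot>\<^sub>v x i" using y i unfolding proj_point_iff by blast
      obtain c' where c': "c' \<noteq> 0" "z i = c' \<cdot>\<^sub>v y i" using z i unfolding proj_point_iff by blast
      show "\<exists>c. c \<noteq> 0 \<and> z i = c \<cdot>\<^sub>v x i"
        by (rule exI[of _ "c' * c"]) (simp add: c c' smult_smult_assoc)
    qed
  qed
  have "x \<in> proj_point m y"
    unfolding proj_point_iff
  proof (intro allI impI)
    fix i assume i: "i < m"
    obtain c where c: "c \<noteq> 0" "y i = c \<cdot>\<^sub>v x i" using y i unfolding proj_point_iff by blast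
    show "\<exists>c. c \<noteq> 0 \<and> x i = c \<cdot>\<^sub>v y i"
      by (rule exI[of _ "inverse c"]) (simp add: c smult_smult_assoc)
  qed
  with sub[OF y] sub show ?thesis by blast
qed

lemma proj_point_coord_tuples:
  assumes x: "x \<in> coord_tuples m d" and y: "y \<in> proj_point m x"
  shows "y \<in> coord_tuples m d"
  unfolding coord_tuples_def
proof (intro CollectI allI impI)
  fix i assume i: "i < m"
  obtain c where c: "c \<noteq> 0" "y i = c \<cdot>\<^sub>v x i" using y i unfolding proj_point_iff by blast
  have "x i \<in> carrier_vec d" "x i \<noteq> 0\<^sub>v d" using x i by (auto simp: coord_tuples_def)
  moreover from this obtain j where "j < d" "x i $ j \<noteq> 0"
    by (metis carrier_vecD eq_vecI index_zero_vec(1) index_zero_vec(2))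
  ultimately have "y i $ j \<noteq> 0\<^sub>v d $ j" using c by simp
  then show "y i \<in> carrier_vec d \<and> y i \<noteq> 0\<^sub>v d" using \<open>x i \<in> carrier_vec d\<close> c by auto
qed

lemma proj_productE:
  assumes "p \<in> proj_product m d" "y \<in> p"
  shows "y \<in> coord_tuples m d" "p = proj_point m y"
proof -
  obtain x where x: "x \<in> coord_tuples m d" "p = proj_point m x"
    using assms(1) by (auto simp: proj_product_def)
  show "y \<in> coord_tuples m d" using proj_point_coord_tuples[OF x(1)] assms(2) x(2) by simp
  show "p = proj_point m y" using proj_point_eqI[of y m x] assms(2) x(2) by simp
qed

lemma proj_product_obtain:
  assumes "p \<in> proj_product m d"
  obtains x where "x \<in> coord_tuples m d" "p = proj_point m x"
  using assms by (auto simp: proj_product_def)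

lemma proj_point_in_product: "x \<in> coord_tuples m d \<Longrightarrow> proj_point m x \<in> proj_product m d"
  by (simp add: proj_product_def)

lemma form_at_proj_point:
  assumes f: "multihomogeneous m d e f" and x: "x \<in> coord_tuples m d" and y: "y \<in> proj_point m x"
  shows "\<exists>c. c \<noteq> 0 \<and> (\<forall>g. multihomogeneous m d e g \<longrightarrow> form_at g y = c * form_at g x)"
proof -
  obtain c where c: "\<And>i. i < m \<Longrightarrow> c i \<noteq> 0" "\<And>i. i < m \<Longrightarrow> y i = c i \<cdot>\<^sub>v x i"
    using y unfolding proj_point_iff by metis
  have "form_at g y = (\<Prod>i<m. c i ^ e i) * form_at g x" if g: "multihomogeneous m d e g" for g
  proof -
    have "form_at g y = poly_at (\<lambda>(i, j). c i * coords x (i, j)) g"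
      unfolding form_at_coords
      by (rule mpoly_eval_cong[OF multihomogeneous_carrier[OF g]])
         (use c x in \<open>auto simp: coords_def coord_tuples_def\<close>)
    then show ?thesis by (simp add: mpoly_eval_scale[OF g] form_at_coords)
  qed
  moreover have "(\<Prod>i<m. c i ^ e i) \<noteq> 0" using c(1) by simp
  ultimately show ?thesis by blast
qed

definition nonvanishing :: "nat \<Rightarrow> nat \<Rightarrow> 'k::field mpoly \<Rightarrow> (nat \<Rightarrow> 'k vec) set set" where
  "nonvanishing m d f = {p \<in> proj_product m d. \<forall>x\<in>p. form_at f x \<noteq> 0}"

lemma nonvanishing_iff:
  assumes f: "f \<in> multiforms m d" and x: "x \<in> coord_tuples m d"
  shows "proj_point m x \<in> nonvanishing m d f \<longleftrightarrow> form_at f x \<noteq> 0"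
proof -
  obtain e where e: "multihomogeneous m d e f" using f by (auto simp: multiforms_def)
  have "form_at f y \<noteq> 0" if "form_at f x \<noteq> 0" "y \<in> proj_point m x" for y
    using form_at_proj_point[OF e x that(2)] e that(1) by auto
  then show ?thesis
    unfolding nonvanishing_def using proj_point_self proj_point_in_product[OF x] by blast
qed

lemma form_at_mult: "form_at (f * g) x = form_at f x * form_at g x"
proof -
  interpret comm_ring_hom "poly_at (coords x)" by (rule mpoly_eval_hom[OF id_hom])
  show ?thesis by (simp add: form_at_coords hom_mult)
qed

lemma proj_zariski_eq: "proj_zariski m d = topology_generated_by (nonvanishing m d ` multiforms m d)"
  unfolding proj_zariski_def nonvanishing_def by (rule arg_cong[where f = "topology_generated_by"]) blast

lemma topspace_proj_zariski [simp]: "topspace (proj_zariski m d) =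
    (proj_product m d :: (nat \<Rightarrow> 'k::field vec) set set)"
proof -
  have "nonvanishing m d 1 = (proj_product m d :: (nat \<Rightarrow> 'k vec) set set)"
  proof -
    have "form_at 1 x = (1 :: 'k)" for x
    proof -
      interpret comm_ring_hom "poly_at (coords x)" by (rule mpoly_eval_hom[OF id_hom])
      show ?thesis by (simp add: form_at_coords)
    qed
    then show ?thesis by (simp add: nonvanishing_def)
  qed
  then have "proj_product m d \<subseteq> (\<Union>(nonvanishing m d ` multiforms m d) :: (nat \<Rightarrow> 'k vec) set set)"
    using multiforms_1 by blast
  moreover have "nonvanishing m d f \<subseteq> proj_product m d" for f :: "'k mpoly"
    by (auto simp: nonvanishing_def)
  ultimately show ?thesis
    unfolding proj_zariski_eq topology_generated_by_topspace by blast
qed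

lemma openin_nonvanishing: "f \<in> multiforms m d \<Longrightarrow> openin (proj_zariski m d) (nonvanishing m d f)"
  unfolding proj_zariski_eq by (rule topology_generated_by_Basis) blast

lemma proj_zariski_base:
  assumes "openin (proj_zariski m d) W" "p \<in> W"
  obtains f where "f \<in> multiforms m d" "p \<in> nonvanishing m d f" "nonvanishing m d f \<subseteq> W"
proof -
  have "\<exists>b\<in>nonvanishing m d ` multiforms m d. p \<in> b \<and> b \<subseteq> W"
  proof (rule generated_topology_base)
    show "openin (topology_generated_by (nonvanishing m d ` multiforms m d)) W"
      using assms(1) unfolding proj_zariski_eq .
    fix a b :: "(nat \<Rightarrow> 'a vec) set set"
    assume "a \<in> nonvanishing m d ` multiforms m d" "b \<in> nonvanishing m d ` multiforms m d"
    then obtain f g where fg: "f \<in> multiforms m d" "a = nonvanishing m d f" "g \<in> multiforms m d" "b =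
      nonvanishing m d g"
      by blast
    have "a \<inter> b = nonvanishing m d (f * g)"
      unfolding fg nonvanishing_def by (auto simp: form_at_mult)
    then show "a \<inter> b \<in> nonvanishing m d ` multiforms m d" using multiforms_mult[OF fg(1,3)] by blast
  qed (rule assms(2))
  then show thesis using that by blast
qed

section \<open>Closures of images of linear maps\<close>

lemma image_variety_iff:
  assumes "x \<in> coord_tuples m d"
  shows "proj_point m x \<in> image_variety q m d M \<longleftrightarrow>
    (\<forall>f\<in>multiforms m d. (\<forall>w. poly_at (lin q M w) f = 0) \<longrightarrow> form_at f x = 0)"
proof
  assume "proj_point m x \<in> image_variety q m d M"
  then obtain y where y: "proj_point m x = proj_point m y" "y \<in> coord_tuples m d"
    and van: "\<And>f. f \<in> multiforms m d \<Longrightarrow> (\<forall>w. poly_at (lin q M w) f = 0) \<Longrightarrow> form_at f y = 0"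
    unfolding image_variety_def by blast
  have "form_at f x = 0" if f: "f \<in> multiforms m d" "\<forall>w. poly_at (lin q M w) f = 0" for f
    using nonvanishing_iff[OF f(1) assms] nonvanishing_iff[OF f(1) y(2)] van[OF f] y(1) by simp
  then show "\<forall>f\<in>multiforms m d. (\<forall>w. poly_at (lin q M w) f = 0) \<longrightarrow> form_at f x = 0" by blast
next
  assume "\<forall>f\<in>multiforms m d. (\<forall>w. poly_at (lin q M w) f = 0) \<longrightarrow> form_at f x = 0"
  with assms show "proj_point m x \<in> image_variety q m d M" unfolding image_variety_def by blast
qed

lemma image_variety_subset: "image_variety q m d M \<subseteq> proj_product m d"
  unfolding image_variety_def proj_product_def by blast

text \<open>A form that is nonzero at a point of \<open>image_variety\<close> is nonzero at some
  \<open>lin 4 a w\<close>. Moving \<open>w\<close> into general position makes all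
  \<open>A i w\<close> nonzero too, so every basic neighbourhood of the point meets the actual
  image.\<close>

lemma multiview_variety_eq:
  fixes A :: "nat \<Rightarrow> 'k::field mat"
  assumes inf: "infinite (UNIV :: 'k set)" and A: "\<And>i. i < n \<Longrightarrow> A i \<in> carrier_mat 3 4"
    and nz: "\<And>i. i < n \<Longrightarrow> \<exists>j<3. \<exists>x. lin 4 (\<lambda>i j l. A i $$ (j, l)) x (i, j) \<noteq> 0"
  shows "multiview_variety n A = image_variety 4 n 3 (\<lambda>i j l. A i $$ (j, l))"
proof -
  let ?a = "\<lambda>i j l. A i $$ (j, l)"
  define S where "S = {proj_point n (\<lambda>i. A i *\<^sub>v x) | x. x \<in> carrier_vec 4 \<and> (\<forall>i<n. A i *\<^sub>v x \<noteq> 0\<^sub>v 3)}"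
  have Ax: "(A i *\<^sub>v x) $ j = lin 4 ?a (\<lambda>l. x $ l) (i, j)" if "i < n" "j < 3" "x \<in> carrier_vec 4" for i j x
    using A[OF that(1)] that by (simp add: lin_apply scalar_prod_def atLeast0LessThan)
  have tup: "(\<lambda>i. A i *\<^sub>v x) \<in> coord_tuples n 3" if "\<forall>i<n. A i *\<^sub>v x \<noteq> 0\<^sub>v 3" for x
    using that A by (auto simp: coord_tuples_def carrier_matD(1)[OF A] intro!: carrier_vecI)
  have form: "form_at f (\<lambda>i. A i *\<^sub>v x) = poly_at (lin 4 ?a (\<lambda>l. x $ l)) f"
    if "f \<in> multiforms n 3" "x \<in> carrier_vec 4" for f x
    unfolding form_at_coords
    by (rule mpoly_eval_cong[OF multiforms_carrier[OF that(1)]]) (simp add: coords_def Ax that(2))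
  have "multiview_variety n A = proj_zariski n 3 closure_of S"
    by (simp add: multiview_variety_def S_def)
  also have "\<dots> = image_variety 4 n 3 ?a"
  proof (intro subset_antisym subsetI)
    fix p assume p: "p \<in> proj_zariski n 3 closure_of S"
    then have pp: "p \<in> proj_product n 3" by (simp add: in_closure_of)
    then obtain x where x: "x \<in> coord_tuples n 3" "p = proj_point n x" by (rule proj_product_obtain)
    show "p \<in> image_variety 4 n 3 ?a"
      unfolding x(2) image_variety_iff[OF x(1)]
    proof (intro ballI impI, rule ccontr)
      fix f assume f: "f \<in> multiforms n 3" "\<forall>w. poly_at (lin 4 ?a w) f = 0" "form_at f x \<noteq> 0"
      then have "p \<in> nonvanishing n 3 f" using nonvanishing_iff[OF f(1) x(1)] x(2) by simp
      moreover have "openin (proj_zariski n 3) (nonvanishing n 3 f)" by (rule openin_nonvanishing[OF f(1)])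
      ultimately obtain y where "y \<in> S" "y \<in> nonvanishing n 3 f" using p unfolding in_closure_of by blast
      then obtain v where v: "v \<in> carrier_vec 4" "\<forall>i<n. A i *\<^sub>v v \<noteq> 0\<^sub>v 3"
        "proj_point n (\<lambda>i. A i *\<^sub>v v) \<in> nonvanishing n 3 f" unfolding S_def by blast
      then show False using nonvanishing_iff[OF f(1) tup[OF v(2)]] form[OF f(1) v(1)] f(2) by simp
    qed
  next
    fix p assume p: "p \<in> image_variety 4 n 3 ?a"
    then have pp: "p \<in> proj_product n 3" using image_variety_subset by blast
    then obtain x where x: "x \<in> coord_tuples n 3" "p = proj_point n x" by (rule proj_product_obtain)
    have "\<exists>y. y \<in> S \<and> y \<in> W" if W: "p \<in> W" "openin (proj_zariski n 3) W" for W
    proof -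
      obtain f where f: "f \<in> multiforms n 3" "p \<in> nonvanishing n 3 f" "nonvanishing n 3 f \<subseteq> W"
        using proj_zariski_base[OF W(2,1)] by blast
      have "form_at f x \<noteq> 0" using nonvanishing_iff[OF f(1) x(1)] f(2) x(2) by simp
      then have fx: "\<exists>w. poly_at (lin 4 ?a w) f \<noteq> 0"
        using p f(1) unfolding x(2) image_variety_iff[OF x(1)] by blast
      obtain jj where jj: "\<And>i. i < n \<Longrightarrow> jj i < 3" "\<And>i. i < n \<Longrightarrow> \<exists>x. lin 4 ?a x (i, jj i) \<noteq> 0"
        using nz by metis
      let ?\<Phi> = "insert (\<lambda>w. poly_at (lin 4 ?a w) f) ((\<lambda>i w. lin 4 ?a w (i, jj i)) ` {..<n})"
      have "\<exists>w. \<forall>\<phi>\<in>?\<Phi>. \<phi> w \<noteq> 0"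
        by (rule common_nonzero[OF inf]) (use jj(2) fx poly_on_lines_lin poly_on_lines_form in auto)
      then obtain w where w: "\<forall>\<phi>\<in>?\<Phi>. \<phi> w \<noteq> 0" ..
      define v where "v = vec 4 w"
      have v: "v \<in> carrier_vec 4" by (simp add: v_def)
      have vw: "lin 4 ?a (\<lambda>l. v $ l) = lin 4 ?a w" by (rule lin_cong) (simp add: v_def)
      have nzv: "\<forall>i<n. A i *\<^sub>v v \<noteq> 0\<^sub>v 3"
      proof (intro allI impI notI)
        fix i assume i: "i < n" "A i *\<^sub>v v = 0\<^sub>v 3"
        have "(A i *\<^sub>v v) $ jj i = lin 4 ?a w (i, jj i)" using Ax[OF i(1) jj(1)[OF i(1)] v] vw by simp
        moreover have "(\<lambda>w. lin 4 ?a w (i, jj i)) \<in> ?\<Phi>" using i(1) by auto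
        then have "lin 4 ?a w (i, jj i) \<noteq> 0" using bspec[OF w] by blast
        ultimately show False using i(2) jj(1)[OF i(1)] by simp
      qed
      have "proj_point n (\<lambda>i. A i *\<^sub>v v) \<in> nonvanishing n 3 f"
        using nonvanishing_iff[OF f(1) tup[OF nzv]] form[OF f(1) v] bspec[OF w insertI1] by (simp add: vw)
      moreover have "proj_point n (\<lambda>i. A i *\<^sub>v v) \<in> S" unfolding S_def using v nzv by blast
      ultimately show ?thesis using f(3) by blast
    qed
    with pp show "p \<in> proj_zariski n 3 closure_of S" by (simp add: in_closure_of)
  qed
  finally show ?thesis .
qed

section \<open>Morphisms given by linear maps between the factors\<close>

definition apply_maps :: "(nat \<Rightarrow> nat) \<Rightarrow> (nat \<Rightarrow> 'k::field mat) \<Rightarrow> (nat \<Rightarrow> 'k vec) \<Rightarrow> nat \<Rightarrow> 'k vec" where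
  "apply_maps \<sigma> N y = (\<lambda>i. N i *\<^sub>v y (\<sigma> i))"

text \<open>Factor \<open>i\<close> of the target is computed from factor \<open>\<sigma> i\<close>
  of the source. The matrices may have kernels, so nonvanishing of the result is demanded only over
  \<open>X\<close>.\<close>

locale linear_morphism =
  fixes m d m' d' :: nat and \<sigma> :: "nat \<Rightarrow> nat" and N :: "nat \<Rightarrow> 'k::field mat" and X X'
  assumes \<sigma>: "\<And>i. i < m' \<Longrightarrow> \<sigma> i < m" and N: "\<And>i. i < m' \<Longrightarrow> N i \<in> carrier_mat d' d"
    and X: "X \<subseteq> proj_product m d" and X': "X' \<subseteq> proj_product m' d'"
    and maps: "\<And>y. y \<in> coord_tuples m d \<Longrightarrow> proj_point m y \<in> X \<Longrightarrow>
      apply_maps \<sigma> N y \<in> coord_tuples m' d' \<and> proj_point m' (apply_maps \<sigma> N y) \<in> X'"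
begin

definition "point_map p = proj_point m' (apply_maps \<sigma> N (SOME y. y \<in> p))"

lemma point_map_proj_point:
  assumes y: "y \<in> coord_tuples m d"
  shows "point_map (proj_point m y) = proj_point m' (apply_maps \<sigma> N y)"
proof -
  define z where "z = (SOME z. z \<in> proj_point m y)"
  have z: "z \<in> proj_point m y" unfolding z_def by (rule someI[of "\<lambda>z. z
      \<in> proj_point m y", OF proj_point_self])
  have "apply_maps \<sigma> N z \<in> proj_point m' (apply_maps \<sigma> N y)"
    unfolding proj_point_iff
  proof (intro allI impI)
    fix i assume i: "i < m'"
    obtain c where c: "c \<noteq> 0" "z (\<sigma> i) = c \<cdot>\<^sub>v y (\<sigma> i)"
      using z \<sigma>[OF i] unfolding proj_point_iff by blast
    have "y (\<sigma> i) \<in> carrier_vec d" using y \<sigma>[OF i] by (auto simp: coord_tuples_def)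
    then show "\<exists>c. c \<noteq> 0 \<and> apply_maps \<sigma> N z i = c \<cdot>\<^sub>v apply_maps \<sigma> N y i"
      using c mult_mat_vec[OF N[OF i]] by (auto simp: apply_maps_def)
  qed
  then show ?thesis unfolding point_map_def z_def[symmetric] by (rule proj_point_eqI)
qed

text \<open>The pullback of forms, through which basic open sets and regular functions are
  transported.\<close>

definition "substitute = mpoly_eval Const (\<lambda>(i, j). \<Sum>l<d. Const (N i $$ (j, l)) * Var (\<sigma> i, l))"

lemma eval_substitute:
  assumes "f \<in> carrier (mpoly_ring m' d')"
    and "\<And>i j. i < m' \<Longrightarrow> j < d' \<Longrightarrow> u (i, j) = (\<Sum>l<d. N i $$ (j, l) * v (\<sigma> i, l))"
  shows "poly_at v (substitute f) = poly_at u f"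
proof -
  interpret e: comm_ring_hom "poly_at v" by (rule mpoly_eval_hom[OF id_hom])
  have "poly_at v (substitute f) = poly_at
      (\<lambda>w. poly_at v (case w of (i, j) \<Rightarrow> \<Sum>l<d. Const (N i $$ (j, l)) * Var (\<sigma> i, l))) f"
    unfolding substitute_def by (simp add: hom_mpoly_eval[OF e.comm_ring_hom_axioms] mpoly_eval_Const)
  also have "\<dots> = poly_at u f"
    by (rule mpoly_eval_cong[OF assms(1)])
       (simp add: assms(2) e.hom_sum e.hom_mult mpoly_eval_Const mpoly_eval_Var)
  finally show ?thesis .
qed

lemma form_at_substitute:
  assumes "f \<in> carrier (mpoly_ring m' d')" "y \<in> coord_tuples m d"
  shows "form_at (substitute f) y = form_at f (apply_maps \<sigma> N y)"
  unfolding form_at_coords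
proof (rule eval_substitute[OF assms(1)])
  fix i j assume ij: "i < m'" "j < d'"
  have "y (\<sigma> i) \<in> carrier_vec d" using assms(2) \<sigma>[OF ij(1)] by (auto simp: coord_tuples_def)
  then show "coords (apply_maps \<sigma> N y) (i, j) = (\<Sum>l<d. N i $$ (j, l) * coords y (\<sigma> i, l))"
    using N[OF ij(1)] ij(2) by (simp add: coords_def apply_maps_def scalar_prod_def atLeast0LessThan)
qed

lemma multihomogeneous_substitute:
  assumes "multihomogeneous m' d' e f"
  shows "multihomogeneous m d (\<lambda>a. \<Sum>i<m'. e i * (if a = \<sigma> i then 1 else 0)) (substitute f)"
  unfolding substitute_def
proof (rule multihomogeneous_mpoly_eval[OF assms, where \<epsilon> = "\<lambda>i a. if a = \<sigma> i then 1 else 0"])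
  fix i j assume "i < m'" "j < d'"
  then show "multihomogeneous m d (\<lambda>a. if a = \<sigma> i then 1 else 0)
      (case (i, j) of (i, j) \<Rightarrow> \<Sum>l<d. Const (N i $$ (j, l)) * Var (\<sigma> i, l))"
    using \<sigma> by (auto intro!: multihomogeneous_sum multihomogeneous_Const_mult multihomogeneous_Var)
qed simp

lemma multiforms_substitute: "f \<in> multiforms m' d' \<Longrightarrow> substitute f \<in> multiforms m d"
  unfolding multiforms_def using multihomogeneous_substitute by blast

lemma point_map_mem:
  assumes "p \<in> X"
  shows "point_map p \<in> X'"
proof -
  obtain y where y: "y \<in> coord_tuples m d" "p = proj_point m y"
    using assms X by (blast elim: proj_product_obtain)
  then show ?thesis using maps[OF y(1)] assms by (simp add: point_map_proj_point)
qed

lemma point_map_nonvanishing: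
  assumes f: "f \<in> multiforms m' d'" and p: "p \<in> X"
  shows "point_map p \<in> nonvanishing m' d' f \<longleftrightarrow> p \<in> nonvanishing m d (substitute f)"
proof -
  obtain y where y: "y \<in> coord_tuples m d" "p = proj_point m y"
    using p X by (blast elim: proj_product_obtain)
  have "apply_maps \<sigma> N y \<in> coord_tuples m' d'" using maps y p by blast
  then show ?thesis
    using nonvanishing_iff[OF f] nonvanishing_iff[OF multiforms_substitute[OF f] y(1)]
      form_at_substitute[OF multiforms_carrier[OF f] y(1)]
    by (simp add: y(2) point_map_proj_point[OF y(1)])
qed

lemma topspace_subs: "topspace (subtopology (proj_zariski m d) X) = X"
  "topspace (subtopology (proj_zariski m' d') X') = X'"
  using X X' by (auto simp: topspace_subtopology)

lemma continuous_point_map: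
  "continuous_map (subtopology (proj_zariski m d) X) (subtopology (proj_zariski m' d') X') point_map"
proof -
  have "continuous_map (subtopology (proj_zariski m d) X) (proj_zariski m' d') point_map"
    unfolding proj_zariski_eq[of m' d']
  proof (rule continuous_on_generated_topo)
    fix U :: "(nat \<Rightarrow> 'k vec) set set" assume "U \<in> nonvanishing m' d' ` multiforms m' d'"
    then obtain f where f: "f \<in> multiforms m' d'" "U = nonvanishing m' d' f" by blast
    have "point_map -` U \<inter> topspace (subtopology (proj_zariski m d) X) =
      nonvanishing m d (substitute f) \<inter> X"
      unfolding topspace_subs f(2) using point_map_nonvanishing[OF f(1)] by blast
    then show "openin (subtopology (proj_zariski m d) X) (point_map -` U \<inter> topspace (subtopology
      (proj_zariski m d) X))"
      using openin_nonvanishing[OF multiforms_substitute[OF f(1)]] by (auto simp: openin_subtopology)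
  next
    have "\<Union> (nonvanishing m' d' ` multiforms m' d') = (proj_product m' d' :: (nat \<Rightarrow> 'k vec) set set)"
      using topspace_proj_zariski[of m' d', where 'k =
        'k] unfolding proj_zariski_eq topology_generated_by_topspace .
    then show "point_map ` topspace (subtopology (proj_zariski m d) X) \<subseteq> \<Union> (nonvanishing m' d' `
      multiforms m' d')"
      using point_map_mem X' by (auto simp: topspace_subs)
  qed
  then show ?thesis
    by (rule continuous_map_into_subtopology) (use point_map_mem in \<open>auto simp: topspace_subs\<close>)
qed

text \<open>Numerator and denominator pull back to forms of one common multidegree. The
  neighbourhood is shrunk to a basic open set, whose preimage is cut out by the pullback of its
  form.\<close>

lemma regular_on_point_map:
  assumes "regular_on m' d' U f" "U \<subseteq> X'"
  shows "regular_on m d {p \<in> X. point_map p \<in> U} (f \<circ> point_map)"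
  unfolding regular_on_def
proof
  fix p assume p: "p \<in> {p \<in> X. point_map p \<in> U}"
  then have "point_map p \<in> U" by simp
  from bspec[OF assms(1)[unfolded regular_on_def] this]
  obtain W e g h where W: "openin (proj_zariski m' d') W" "point_map p \<in> W"
    and gh: "multihomogeneous m' d' e g" "multihomogeneous m' d' e h"
    and quot: "\<forall>q\<in>U \<inter> W. \<forall>x\<in>q. form_at h x \<noteq> 0 \<and> f q = form_at g x / form_at h x"
    by (elim exE conjE) (rule that)
  have q: "form_at h x \<noteq> 0 \<and> f q = form_at g x / form_at h x" if "q \<in> U \<inter> W" "x \<in> q" for q x
    by (rule bspec[OF bspec[OF quot that(1)] that(2)])
  obtain w where w: "w \<in> multiforms m' d'" "point_map p \<in> nonvanishing m' d' w" "nonvanishing m' d' w \<subseteq> W"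
    using proj_zariski_base[OF W] by blast
  show "\<exists>W e g h. openin (proj_zariski m d) W \<and> p \<in> W \<and> multihomogeneous m d e g \<and>
      multihomogeneous m d e h \<and>
     (\<forall>q\<in>{p \<in> X. point_map p \<in> U} \<inter> W. \<forall>x\<in>q. form_at h x \<noteq> 0 \<and> (f \<circ> point_map) q =
      form_at g x / form_at h x)"
  proof (intro exI conjI ballI)
    show "openin (proj_zariski m d) (nonvanishing m d (substitute w))"
      by (rule openin_nonvanishing[OF multiforms_substitute[OF w(1)]])
    show "p \<in> nonvanishing m d (substitute w)" using point_map_nonvanishing[OF w(1)] w(2) p by blast
    show "multihomogeneous m d (\<lambda>a. \<Sum>i<m'. e i * (if a = \<sigma> i then 1 else 0)) (substitute g)"
      "multihomogeneous m d (\<lambda>a. \<Sum>i<m'. e i * (if a = \<sigma> i then 1 else 0)) (substitute h)"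
      by (rule multihomogeneous_substitute, rule gh)+
    fix r x assume r: "r \<in> {p \<in> X. point_map p \<in> U} \<inter> nonvanishing m d (substitute w)" and x: "x \<in> r"
    have rX: "r \<in> X" using r by blast
    then have xr: "x \<in> coord_tuples m d" "r = proj_point m x" using proj_productE[OF _ x] X by blast+
    have "point_map r \<in> U \<inter> W" using r w(3) point_map_nonvanishing[OF w(1) rX] by blast
    moreover have "apply_maps \<sigma> N x \<in> point_map r"
      unfolding xr(2) point_map_proj_point[OF xr(1)] by (rule proj_point_self)
    ultimately have "form_at h (apply_maps \<sigma> N x) \<noteq> 0 \<and>
        f (point_map r) = form_at g (apply_maps \<sigma> N x) / form_at h (apply_maps \<sigma> N x)" by (rule q)
    then show "form_at (substitute h) x \<noteq> 0" "(f \<circ> point_map) r =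
      form_at (substitute g) x / form_at (substitute h) x"
      using form_at_substitute[OF multihomogeneous_carrier[OF gh(1)] xr(1)]
        form_at_substitute[OF multihomogeneous_carrier[OF gh(2)] xr(1)] by simp_all
  qed
qed

end

lemma regular_on_cong:
  assumes "regular_on m d U f" "\<And>p. p \<in> U \<Longrightarrow> f p = g p"
  shows "regular_on m d U g"
  unfolding regular_on_def
proof
  fix p assume "p \<in> U"
  from bspec[OF assms(1)[unfolded regular_on_def] this]
  obtain W e u v where W: "openin (proj_zariski m d) W" "p \<in> W" "multihomogeneous m d e u"
      "multihomogeneous m d e v"
    and quot: "\<forall>q\<in>U \<inter> W. \<forall>x\<in>q. form_at v x \<noteq> 0 \<and> f q = form_at u x / form_at v x"
    by (elim exE conjE) (rule that)
  have "\<forall>q\<in>U \<inter> W. \<forall>x\<in>q. form_at v x \<noteq> 0 \<and> g q = form_at u x / form_at v x"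
    using quot assms(2) by simp
  with W show "\<exists>W e u v. openin (proj_zariski m d) W \<and> p \<in> W \<and> multihomogeneous m d e u \<and>
      multihomogeneous m d e v \<and> (\<forall>q\<in>U \<inter> W. \<forall>x\<in>q. form_at v x \<noteq> 0 \<and> g q = form_at u x / form_at v x)"
    by (intro exI conjI)
qed

lemma isomorphic_varieties_linear:
  assumes F: "linear_morphism m d m' d' \<sigma> N X X'" and G: "linear_morphism m' d' m d \<tau> T X' X"
    and GF: "\<And>y. y \<in> coord_tuples m d \<Longrightarrow> proj_point m y \<in> X \<Longrightarrow>
      apply_maps \<tau> T (apply_maps \<sigma> N y) \<in> proj_point m y"
    and FG: "\<And>z. z \<in> coord_tuples m' d' \<Longrightarrow> proj_point m' z \<in> X' \<Longrightarrow>
      apply_maps \<sigma> N (apply_maps \<tau> T z) \<in> proj_point m' z"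
  shows "isomorphic_varieties m d X m' d' X'"
proof -
  interpret F: linear_morphism m d m' d' \<sigma> N X X' by (rule F)
  interpret G: linear_morphism m' d' m d \<tau> T X' X by (rule G)
  have gf: "G.point_map (F.point_map p) = p" if p: "p \<in> X" for p
  proof -
    obtain y where y: "y \<in> coord_tuples m d" "p = proj_point m y"
      using p F.X by (blast elim: proj_product_obtain)
    with p have "apply_maps \<sigma> N y \<in> coord_tuples m' d'" using F.maps by blast
    then show ?thesis
      using proj_point_eqI[OF GF[OF y(1)]] p y by (simp add: F.point_map_proj_point G.point_map_proj_point)
  qed
  have fg: "F.point_map (G.point_map p) = p" if p: "p \<in> X'" for p
  proof -
    obtain y where y: "y \<in> coord_tuples m' d'" "p = proj_point m' y"
      using p F.X' by (blast elim: proj_product_obtain)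
    with p have "apply_maps \<tau> T y \<in> coord_tuples m d" using G.maps by blast
    then show ?thesis
      using proj_point_eqI[OF FG[OF y(1)]] p y by (simp add: F.point_map_proj_point G.point_map_proj_point)
  qed
  have "homeomorphic_maps (subtopology (proj_zariski m d) X) (subtopology (proj_zariski m' d') X')
      F.point_map G.point_map"
    unfolding homeomorphic_maps_def F.topspace_subs
    using F.continuous_point_map G.continuous_point_map gf fg by blast
  then have "homeomorphic_map (subtopology (proj_zariski m d) X) (subtopology (proj_zariski m' d') X')
      F.point_map"
    by (rule homeomorphic_maps_imp_map)
  moreover have "regular_on m' d' U f \<longleftrightarrow> regular_on m d {p \<in> X. F.point_map p \<in> U} (f \<circ> F.point_map)"
    if U: "openin (subtopology (proj_zariski m' d') X') U" for U f
  proof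
    have UX: "U \<subseteq> X'" using openin_subset[OF U] F.topspace_subs by simp
    show "regular_on m d {p \<in> X. F.point_map p \<in> U} (f \<circ> F.point_map)" if "regular_on m' d' U f"
      by (rule F.regular_on_point_map[OF that UX])
    assume "regular_on m d {p \<in> X. F.point_map p \<in> U} (f \<circ> F.point_map)"
    then have "regular_on m' d' {p \<in> X'. G.point_map p \<in> {p \<in> X. F.point_map p
      \<in> U}} (f \<circ> F.point_map \<circ> G.point_map)"
      by (rule G.regular_on_point_map) blast
    also have "{p \<in> X'. G.point_map p \<in> {p \<in> X. F.point_map p \<in> U}} = U"
      using UX fg G.point_map_mem by auto
    finally show "regular_on m' d' U f"
      by (rule regular_on_cong) (use UX fg in auto)
  qed
  ultimately show ?thesis unfolding isomorphic_varieties_def by blast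
qed

lemma proportional_vectors:
  fixes u v :: "'k::field vec"
  assumes u: "u \<in> carrier_vec d" "u \<noteq> 0\<^sub>v d" and v: "v \<in> carrier_vec d" "v \<noteq> 0\<^sub>v d"
    and minors: "\<And>j l. j < d \<Longrightarrow> l < d \<Longrightarrow> u $ j * v $ l = u $ l * v $ j"
  shows "\<exists>c. c \<noteq> 0 \<and> u = c \<cdot>\<^sub>v v"
proof -
  obtain l where l: "l < d" "v $ l \<noteq> 0"
    using v by (metis carrier_vecD eq_vecI index_zero_vec(1) index_zero_vec(2))
  obtain j where j: "j < d" "u $ j \<noteq> 0"
    using u by (metis carrier_vecD eq_vecI index_zero_vec(1) index_zero_vec(2))
  have eq: "u = (u $ l / v $ l) \<cdot>\<^sub>v v"
    using u v l minors by (intro eq_vecI) (auto simp: field_simps)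
  moreover have "u $ l \<noteq> 0"
    using minors[OF j(1) l(1)] j(2) l(2) by auto
  ultimately show ?thesis using l(2) by (metis divide_eq_0_iff)
qed

lemma linear_morphism_image:
  fixes N :: "nat \<Rightarrow> 'k::field mat"
  assumes \<sigma>: "\<And>i. i < m' \<Longrightarrow> \<sigma> i < m" and N: "\<And>i. i < m' \<Longrightarrow> N i \<in> carrier_mat d' d"
    and rel: "\<And>i j w. i < m' \<Longrightarrow> j < d' \<Longrightarrow> (\<Sum>l<d. N i $$ (j, l) * lin q B w (\<sigma> i, l)) = lin q B' w (i, j)"
    and tup: "\<And>y. y \<in> coord_tuples m d \<Longrightarrow> proj_point m y \<in> image_variety q m d B \<Longrightarrow>
      apply_maps \<sigma> N y \<in> coord_tuples m' d'"
  shows "linear_morphism m d m' d' \<sigma> N (image_variety q m d B) (image_variety q m' d' B')"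
proof (unfold_locales, goal_cases)
  case (5 y)
  \<comment> \<open>With empty sets the condition on points is void, which makes
    \<open>substitute\<close> available before the image is known to lie in the target.\<close>
  interpret L: linear_morphism m d m' d' \<sigma> N "{}" "{}"
    by unfold_locales (use \<sigma> N in auto)
  note t = tup[OF 5]
  have "form_at f (apply_maps \<sigma> N y) = 0"
    if f: "f \<in> multiforms m' d'" "\<forall>w. poly_at (lin q B' w) f = 0" for f
  proof -
    have "poly_at (lin q B w) (L.substitute f) = 0" for w
      using f(2) L.eval_substitute[OF multiforms_carrier[OF f(1)], of "lin q B' w" "lin q B w"] rel by simp
    then have "form_at (L.substitute f) y = 0"
      using 5(2) L.multiforms_substitute[OF f(1)] unfolding image_variety_iff[OF 5(1)] by blast
    then show ?thesis by (simp add: L.form_at_substitute[OF multiforms_carrier[OF f(1)] 5(1)])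
  qed
  with t show ?case unfolding image_variety_iff[OF t] by blast
qed (auto intro: \<sigma> N subsetD[OF image_variety_subset])

text \<open>The products \<open>T i N i\<close> and \<open>N i T i\<close> need not be identity
  matrices, but they fix the images of the linear maps, and such linear equations pass to the
  closures. Several \<open>i\<close> may share the value \<open>\<tau> i\<close>; one factor of the
  target then determines all these factors of the source.\<close>

lemma image_varieties_isomorphic:
  fixes P :: "nat \<Rightarrow> nat \<Rightarrow> nat \<Rightarrow> 'k::field"
  assumes \<tau>: "\<And>i. i < n \<Longrightarrow> \<tau> i < m" and \<sigma>: "\<And>i. i < m \<Longrightarrow> \<sigma> i < n" "\<And>i. i < m \<Longrightarrow> \<tau> (\<sigma> i) = i"
    and N: "\<And>i. i < n \<Longrightarrow> N i \<in> carrier_mat d r" and T: "\<And>i. i < n \<Longrightarrow> T i \<in> carrier_mat r d"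
    and NP: "\<And>i j w. i < n \<Longrightarrow> j < d \<Longrightarrow> (\<Sum>l<r. N i $$ (j, l) * lin q P w (i, l)) = lin q M w (\<tau> i, j)"
    and TM: "\<And>i j w. i < n \<Longrightarrow> j < r \<Longrightarrow> (\<Sum>l<d. T i $$ (j, l) * lin q M w (\<tau> i, l)) = lin q P w (i, j)"
  shows "isomorphic_varieties n r (image_variety q n r P) m d (image_variety q m d M)"
proof -
  let ?X = "image_variety q n r P" and ?X' = "image_variety q m d M"
  have rel: "form_at f y = 0"
    if "y \<in> coord_tuples k s" "proj_point k y \<in> image_variety q k s B" "f \<in> multiforms k s"
      "\<forall>w. poly_at (lin q B w) f = 0" for k s y f and B :: "nat \<Rightarrow> nat \<Rightarrow> nat \<Rightarrow> 'k"
    using image_variety_iff[OF that(1)] that(2-4) by blast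
  define ell where "ell c i s = (\<Sum>l<s. Const (c l) * Var (i, l))" for c :: "nat \<Rightarrow> 'k" and i s :: nat
  have ell: "multihomogeneous k s (\<lambda>a. if a = i then 1 else 0) (ell c i s)" if "i < k" for c i k s
    unfolding ell_def by (intro multihomogeneous_sum multihomogeneous_Const_mult multihomogeneous_Var)
      (use that in auto)
  have ell_eval: "poly_at z (ell c i s) = (\<Sum>l<s. c l * z (i, l))" for z c i s
  proof -
    interpret e: comm_ring_hom "poly_at z" by (rule mpoly_eval_hom[OF id_hom])
    show ?thesis by (simp add: ell_def e.hom_sum e.hom_mult mpoly_eval_Const mpoly_eval_Var)
  qed
  \<comment> \<open>A linear relation among the coordinates of one factor is a form, so it passes
    from the image to its closure.\<close>
  have linrel: "(\<Sum>l<s. c l * y i $ l) = y i $ j"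
    if "y \<in> coord_tuples k s" "proj_point k y \<in> image_variety q k s B" "i < k" "j < s"
      "\<And>w. (\<Sum>l<s. c l * lin q B w (i, l)) = lin q B w (i, j)" for k s y i j c
        and B :: "nat \<Rightarrow> nat \<Rightarrow> nat \<Rightarrow> 'k"
  proof -
    have "multihomogeneous k s (\<lambda>a. if a = i then 1 else 0) (ell c i s - Var (i, j))"
      by (intro multihomogeneous_diff ell multihomogeneous_Var) (use that in auto)
    then have f: "ell c i s - Var (i, j) \<in> multiforms k s" by (auto simp: multiforms_def)
    have ev: "poly_at z (ell c i s - Var (i, j)) = (\<Sum>l<s. c l * z (i, l)) - z (i, j)" for z
    proof -
      interpret e: comm_ring_hom "poly_at z" by (rule mpoly_eval_hom[OF id_hom])
      show ?thesis by (simp add: e.hom_minus ell_eval mpoly_eval_Var)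
    qed
    have "form_at (ell c i s - Var (i, j)) y = 0"
      by (rule rel[OF that(1,2) f]) (simp add: ev that(5))
    then show ?thesis by (simp add: form_at_coords ev coords_def)
  qed
  have entry: "(B *\<^sub>v v) $ j = (\<Sum>l<s'. B $$ (j, l) * v $ l)"
    if "B \<in> carrier_mat s s'" "v \<in> carrier_vec s'" "j < s" for B :: "'k mat" and v s s' j
    using that by (simp add: scalar_prod_def atLeast0LessThan)
  have mult_entry: "(B *\<^sub>v (C *\<^sub>v v)) $ j = (\<Sum>l<s'. (\<Sum>a<s. B $$ (j, a) * C $$ (a, l)) * v $ l)"
    if B: "B \<in> carrier_mat t s" and C: "C \<in> carrier_mat s s'" and v: "v \<in> carrier_vec s'" and j: "j < t"
    for B C :: "'k mat" and v s s' t j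
  proof -
    have "(B *\<^sub>v (C *\<^sub>v v)) $ j = (\<Sum>a<s. B $$ (j, a) * (\<Sum>l<s'. C $$ (a, l) * v $ l))"
      unfolding entry[OF B mult_mat_vec_carrier[OF C v] j]
      by (intro sum.cong refl arg_cong2[where f = "(*)"] entry[OF C v]) simp
    also have "\<dots> = (\<Sum>l<s'. (\<Sum>a<s. B $$ (j, a) * C $$ (a, l)) * v $ l)"
      unfolding sum_distrib_left sum_distrib_right by (subst sum.swap) (simp add: mult.assoc)
    finally show ?thesis .
  qed
  have comp_sum: "(\<Sum>l<s'. (\<Sum>a<s. B $$ (j, a) * C $$ (a, l)) * z l) =
      (\<Sum>a<s. B $$ (j, a) * (\<Sum>l<s'. C $$ (a, l) * z l))"
    for B C :: "'k mat" and z s s' j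
    unfolding sum_distrib_left sum_distrib_right by (subst sum.swap) (simp add: mult.assoc)
  have TN: "T i *\<^sub>v (N i *\<^sub>v y i) = y i"
    if y: "y \<in> coord_tuples n r" "proj_point n y \<in> ?X" and i: "i < n" for y i
  proof (rule eq_vecI)
    have yi: "y i \<in> carrier_vec r" using y(1) i by (auto simp: coord_tuples_def)
    then show "dim_vec (T i *\<^sub>v (N i *\<^sub>v y i)) = dim_vec (y i)" using T[OF i] by auto
    fix j assume "j < dim_vec (y i)"
    then have j: "j < r" using yi by simp
    have "(\<Sum>l<r. (\<Sum>a<d. T i $$ (j, a) * N i $$ (a, l)) * y i $ l) = y i $ j"
      by (rule linrel[OF y i j]) (simp add: comp_sum NP[OF i] TM[OF i j])
    then show "(T i *\<^sub>v (N i *\<^sub>v y i)) $ j = y i $ j" by (simp add: mult_entry[OF T[OF i] N[OF i] yi j])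
  qed
  have NT: "N i *\<^sub>v (T i *\<^sub>v z (\<tau> i)) = z (\<tau> i)"
    if z: "z \<in> coord_tuples m d" "proj_point m z \<in> ?X'" and i: "i < n" for z i
  proof (rule eq_vecI)
    have zi: "z (\<tau> i) \<in> carrier_vec d" using z(1) \<tau>[OF i] by (auto simp: coord_tuples_def)
    then show "dim_vec (N i *\<^sub>v (T i *\<^sub>v z (\<tau> i))) = dim_vec (z (\<tau> i))" using N[OF i] by auto
    fix j assume "j < dim_vec (z (\<tau> i))"
    then have j: "j < d" using zi by simp
    have "(\<Sum>l<d. (\<Sum>a<r. N i $$ (j, a) * T i $$ (a, l)) * z (\<tau> i) $ l) = z (\<tau> i) $ j"
      by (rule linrel[OF z \<tau>[OF i] j]) (simp add: comp_sum NP[OF i j] TM[OF i])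
    then show "(N i *\<^sub>v (T i *\<^sub>v z (\<tau> i))) $ j = z (\<tau> i) $ j"
      by (simp add: mult_entry[OF N[OF i] T[OF i] zi j])
  qed
  have zero: "B *\<^sub>v 0\<^sub>v s' = 0\<^sub>v s" if "B \<in> carrier_mat s s'" for B :: "'k mat" and s s'
    using that by (intro eq_vecI) auto
  let ?F = "apply_maps \<sigma> (\<lambda>i. N (\<sigma> i))" and ?G = "apply_maps \<tau> T"
  have F_tup: "?F y \<in> coord_tuples m d" if y: "y \<in> coord_tuples n r" "proj_point n y \<in> ?X" for y
    unfolding coord_tuples_def
  proof (intro CollectI allI impI conjI)
    fix i assume i: "i < m"
    have yi: "y (\<sigma> i) \<in> carrier_vec r" "y (\<sigma> i) \<noteq> 0\<^sub>v r"
      using y(1) \<sigma>(1)[OF i] by (auto simp: coord_tuples_def)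
    show "?F y i \<in> carrier_vec d" using N[OF \<sigma>(1)[OF i]] yi(1) by (simp add: apply_maps_def)
    \<comment> \<open>A zero vector would be mapped to 0 by \<open>T\<close>, but \<open>T N\<close>
      fixes the nonzero vector \<open>y (\<sigma> i)\<close>.\<close>
    show "?F y i \<noteq> 0\<^sub>v d"
      using TN[OF y \<sigma>(1)[OF i]] zero[OF T[OF \<sigma>(1)[OF i]]] yi(2) by (auto simp: apply_maps_def)
  qed
  have G_tup: "?G z \<in> coord_tuples n r" if z: "z \<in> coord_tuples m d" "proj_point m z \<in> ?X'" for z
    unfolding coord_tuples_def
  proof (intro CollectI allI impI conjI)
    fix i assume i: "i < n"
    have zi: "z (\<tau> i) \<in> carrier_vec d" "z (\<tau> i) \<noteq> 0\<^sub>v d"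
      using z(1) \<tau>[OF i] by (auto simp: coord_tuples_def)
    show "?G z i \<in> carrier_vec r" using T[OF i] zi(1) by (simp add: apply_maps_def)
    show "?G z i \<noteq> 0\<^sub>v r"
      using NT[OF z i] zero[OF N[OF i]] zi(2) by (auto simp: apply_maps_def)
  qed
  have mF: "linear_morphism n r m d \<sigma> (\<lambda>i. N (\<sigma> i)) ?X ?X'"
    by (rule linear_morphism_image) (use \<sigma> N NP F_tup in auto)
  have mG: "linear_morphism m d n r \<tau> T ?X' ?X"
    by (rule linear_morphism_image) (use \<tau> T TM G_tup in auto)
  show ?thesis
  proof (rule isomorphic_varieties_linear[OF mF mG])
    fix z assume z: "z \<in> coord_tuples m d" "proj_point m z \<in> ?X'"
    have "?F (?G z) i = z i" if i: "i < m" for i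
      using NT[OF z \<sigma>(1)[OF i]] \<sigma>(2)[OF i] by (simp add: apply_maps_def)
    then show "?F (?G z) \<in> proj_point m z"
      unfolding proj_point_iff by (auto intro!: exI[of _ 1])
  next
    fix y assume y: "y \<in> coord_tuples n r" "proj_point n y \<in> ?X"
    note Fy = F_tup[OF y] linear_morphism.maps[OF mF y, THEN conjunct2]
    show "?G (?F y) \<in> proj_point n y"
      unfolding proj_point_iff
    proof (intro allI impI)
      fix i assume i: "i < n"
      define k where "k = \<sigma> (\<tau> i)"
      have k: "k < n" "\<tau> k = \<tau> i" using \<sigma> \<tau>[OF i] by (auto simp: k_def)
      have yk: "y k \<in> carrier_vec r" and yi: "y i \<in> carrier_vec r" "y i \<noteq> 0\<^sub>v r"
        using y(1) k i by (auto simp: coord_tuples_def)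
      have GF: "?G (?F y) i = T i *\<^sub>v (N k *\<^sub>v y k)" by (simp add: apply_maps_def k_def)
      have nz: "?G (?F y) i \<in> carrier_vec r" "?G (?F y) i \<noteq> 0\<^sub>v r"
        using G_tup[OF Fy] i by (auto simp: coord_tuples_def)
      define c where "c j l = (\<Sum>a<d. T i $$ (j, a) * N k $$ (a, l))" for j l
      have ent: "?G (?F y) i $ j = (\<Sum>l<r. c j l * y k $ l)" if "j < r" for j
        unfolding GF c_def by (rule mult_entry[OF T[OF i] N[OF k(1)] yk that])
      have clin: "(\<Sum>l<r. c j l * lin q P w (k, l)) = lin q P w (i, j)" if "j < r" for j w
        unfolding c_def comp_sum by (simp add: NP[OF k(1)] k(2) TM[OF i that])
      have "?G (?F y) i $ j * y i $ l = ?G (?F y) i $ l * y i $ j" if jl: "j < r" "l < r" for j l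
      proof -
        \<comment> \<open>The equation \<open>T i N k y k = y i\<close> holds on the image, but in
          general it is not multihomogeneous, since the factors \<open>i\<close> and
          \<open>k\<close> scale independently. Its 2x2 minors are, and they pass to the
          closure.\<close>
        define f where "f = ell (c j) k r * Var (i, l) - ell (c l) k r * Var (i, j)"
        have "multihomogeneous n r (\<lambda>a. (if a = k then 1 else 0) + (if a = i then 1 else 0)) f"
          unfolding f_def
          by (intro multihomogeneous_diff multihomogeneous_mult[OF ell multihomogeneous_Var])
             (use i k jl in auto)
        then have f: "f \<in> multiforms n r" by (auto simp: multiforms_def)
        have ev: "poly_at z f = (\<Sum>a<r. c j a * z (k, a)) * z (i, l) - (\<Sum>a<r. c l a * z (k, a)) * z (i,
          j)" for z
        proof -
          interpret e: comm_ring_hom "poly_at z" by (rule mpoly_eval_hom[OF id_hom])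
          show ?thesis by (simp add: f_def e.hom_minus e.hom_mult ell_eval mpoly_eval_Var)
        qed
        have "form_at f y = 0"
          by (rule rel[OF y f]) (simp add: ev clin jl)
        then show ?thesis using jl by (simp add: form_at_coords ev coords_def ent)
      qed
      then show "\<exists>c. c \<noteq> 0 \<and> ?G (?F y) i = c \<cdot>\<^sub>v y i"
        by (rule proportional_vectors[OF nz yi])
    qed
  qed
qed

section \<open>Lattices with prescribed reductions\<close>

lemma infinite_alg_closed: "infinite (UNIV :: 'k::alg_closed_field set)"
proof
  assume fin: "finite (UNIV :: 'k set)"
  \<comment> \<open>Over a finite field this polynomial takes the value 1 everywhere.\<close>
  define p :: "'k poly" where "p = (\<Prod>a\<in>UNIV. [:- a, 1:]) + 1"
  have root: "poly p x = 1" for x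
    using fin by (simp add: p_def poly_prod prod_zero_iff)
  have "degree (\<Prod>a\<in>(UNIV :: 'k set). [:- a, 1:]) = card (UNIV :: 'k set)"
    by (subst degree_prod_eq_sum_degree) simp_all
  moreover have "card (UNIV :: 'k set) > 0" using fin by (simp add: card_gt_0_iff)
  ultimately have "degree p > 0" unfolding p_def by (subst degree_add_eq_left) simp_all
  then obtain x where "poly p x = 0" using alg_closed_imp_poly_has_root by blast
  with root[of x] show False by simp
qed

lemma class_ring_simps' [simp]:
  "carrier class_ring = UNIV" "mult class_ring = (*)" "one class_ring = 1" "zero class_ring = 0"
      "add class_ring = (+)"
  by (simp_all add: class_ring_simps)

text \<open>A nonzero element \<open>a\<close> of the nonzero prime serves if its residue is 0.
  Otherwise let \<open>b\<close> lift the inverse of its residue: \<open>b * a - 1\<close> has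
  residue 0, and it is nonzero because the prime does not contain 1.\<close>

lemma dvr_residue_kernel:
  fixes res :: "'r::idom \<Rightarrow> 'k::field"
  assumes "is_dvr TYPE('r)" "residue_map res"
  obtains \<pi> where "\<pi> \<noteq> 0" "res \<pi> = 0"
proof -
  interpret res: comm_ring_hom res using assms(2) by (simp add: residue_map_def)
  have surj: "surj res" using assms(2) by (simp add: residue_map_def)
  obtain P where P: "primeideal P (class_ring :: 'r ring)" "P \<noteq> {0}"
    using assms(1) unfolding is_dvr_def by blast
  interpret primeideal P "class_ring :: 'r ring" by (rule P(1))
  have "0 \<in> P" using additive_subgroup.zero_closed[OF is_additive_subgroup] by simp
  with P(2) obtain a where a: "a \<in> P" "a \<noteq> 0" by blast
  show thesis
  proof (cases "res a = 0")
    case True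
    with a(2) that show ?thesis by blast
  next
    case False
    obtain b where b: "res b = inverse (res a)" using surj by (metis surjD)
    then have 0: "res (b * a - 1) = 0" using False by (simp add: res.hom_minus res.hom_mult)
    have "b * a \<in> P" using I_l_closed[OF a(1), of b] by simp
    have "1 \<notin> P" using I_notcarr one_imp_carrier by auto
    with \<open>b * a \<in> P\<close> have "b * a - 1 \<noteq> 0" by auto
    with 0 that show ?thesis by blast
  qed
qed

text \<open>The ideal of all \<open>r * a + s * b\<close> is generated by some \<open>g\<close>, and
  cancelling \<open>g\<close> from its own representation leaves coprime cofactors.\<close>

lemma pid_bezout:
  fixes a b :: "'r::idom"
  assumes pd: "principal_domain (class_ring :: 'r ring)" and ab: "b \<noteq> 0"
  obtains \<alpha> \<beta> g r s where "a = g * \<alpha>" "b = g * \<beta>" "r * \<alpha> + s * \<beta> = 1"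
proof -
  have dom: "domain (class_ring :: 'r ring)" using pd by (rule principal_domain.axioms(1))
  have ri: "ring (class_ring :: 'r ring)" using dom by (intro cring.axioms(1) domain.axioms(1))
  have ag: "abelian_group (class_ring :: 'r ring)" using ri by (rule ring.is_abelian_group)
  define I where "I = {r * a + s * b | r s. True}"
  have neg: "\<ominus>\<^bsub>class_ring\<^esub> x = - x" for x :: 'r
    by (rule abelian_group.minus_equality[OF ag]) auto
  have "ideal I (class_ring :: 'r ring)"
  proof (rule idealI)
    show "subgroup I (add_monoid (class_ring :: 'r ring))"
    proof (rule group.subgroupI[OF abelian_group.a_group[OF ag]])
      show "I \<noteq> {}" unfolding I_def by blast
      fix x assume "x \<in> I"
      then obtain r s where "x = r * a + s * b" unfolding I_def by blast
      then have "- x = (- r) * a + (- s) * b" by (simp add: algebra_simps)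
      then show "inv\<^bsub>add_monoid class_ring\<^esub> x \<in> I" unfolding a_inv_def[symmetric] neg I_def by blast
      fix y assume "y \<in> I"
      then obtain r' s' where "y = r' * a + s' * b" unfolding I_def by blast
      with \<open>x = r * a + s * b\<close> have "x + y = (r + r') * a + (s + s') * b" by (simp add: algebra_simps)
      then show "x \<otimes>\<^bsub>add_monoid class_ring\<^esub> y \<in> I" unfolding I_def by auto
    qed simp
    fix x y :: 'r assume "x \<in> I"
    then obtain r s where "x = r * a + s * b" unfolding I_def by blast
    then have "y * x = (y * r) * a + (y * s) * b" by (simp add: algebra_simps)
    then have "y * x \<in> I" unfolding I_def by blast
    then show "y \<otimes>\<^bsub>class_ring\<^esub> x \<in> I" "x \<otimes>\<^bsub>class_ring\<^esub> y \<in> I" by (simp_all add: mult.commute)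
  qed (rule ri)
  then obtain g where g: "I = PIdl\<^bsub>class_ring\<^esub> g" using principal_domain.exists_gen[OF pd] by blast
  then have Ig: "I = {x * g | x. True}" by (simp add: cgenideal_def)
  have "a = 1 * a + 0 * b" "b = 0 * a + 1 * b" by simp_all
  then have "a \<in> I" "b \<in> I" unfolding I_def by blast+
  then obtain \<alpha> \<beta> where ab': "a = \<alpha> * g" "b = \<beta> * g" unfolding Ig by blast
  have "g = 1 * g" by simp
  then have "g \<in> I" unfolding Ig by blast
  then obtain r s where "g = r * a + s * b" unfolding I_def by blast
  then have "g * (r * \<alpha> + s * \<beta>) = g * 1" using ab' by (simp add: algebra_simps)
  moreover have "g \<noteq> 0" using ab ab' by auto
  ultimately have "r * \<alpha> + s * \<beta> = 1" by simp
  with ab' that[of g \<alpha> \<beta> r s] show thesis by (simp add: mult.commute)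
qed

text \<open>Subtracting from a lift a scalar matrix with entry in the kernel of \<open>res\<close>
  keeps the reduction. Infinitely many powers of \<open>\<pi>\<close> are available, so one of them
  is not an eigenvalue of the lift over K.\<close>

lemma invertible_lift:
  fixes res :: "'r::idom \<Rightarrow> 'k::field" and B :: "nat \<Rightarrow> nat \<Rightarrow> 'k"
  assumes res: "comm_ring_hom res" "surj res" and \<pi>: "\<pi> \<noteq> 0" "res \<pi> = 0"
  obtains M where "\<And>j l. res (M j l) = B j l" "det (mat d d (\<lambda>(j, l). to_fract (M j l))) \<noteq> 0"
proof -
  interpret res: comm_ring_hom res by (rule res(1))
  define M0 where "M0 j l = inv_into UNIV res (B j l)" for j l
  have M0: "res (M0 j l) = B j l" for j l unfolding M0_def by (rule surj_f_inv_f[OF res(2)])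
  define A where "A = mat d d (\<lambda>(j, l). to_fract (M0 j l))"
  have A: "A \<in> carrier_mat d d" by (simp add: A_def)
  have "char_poly A \<noteq> 0" using degree_monic_char_poly[OF A] by auto
  then have fin: "finite {t. poly (char_poly A) t = 0}" by (rule poly_roots_finite)
  \<comment> \<open>Equal powers would give \<open>1 = \<pi> ^ Suc k\<close>, against
    \<open>res \<pi> = 0\<close>. Exponents start at 1 because \<open>\<pi> ^ 0\<close> does not
    reduce to 0.\<close>
  have inj: "inj (\<lambda>e. to_fract (\<pi> ^ Suc e))"
  proof (rule linorder_injI)
    fix e e' :: nat assume "e < e'"
    then obtain k where k: "e' = Suc (e + k)" using less_iff_Suc_add by auto
    show "to_fract (\<pi> ^ Suc e) \<noteq> to_fract (\<pi> ^ Suc e')"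
    proof
      assume "to_fract (\<pi> ^ Suc e) = to_fract (\<pi> ^ Suc e')"
      then have "\<pi> ^ Suc e = \<pi> ^ Suc e'" by (simp only: to_fract_eq_iff)
      also have "e' = e + Suc k" by (simp add: k)
      also have "\<pi> ^ Suc (e + Suc k) = \<pi> ^ Suc e * \<pi> ^ Suc k"
        by (simp only: power_add[symmetric] add_Suc)
      finally have "\<pi> ^ Suc e * 1 = \<pi> ^ Suc e * \<pi> ^ Suc k" by (simp only: mult_1_right)
      then have "1 = \<pi> ^ Suc k" using \<pi>(1) mult_left_cancel[of "\<pi> ^ Suc e" 1 "\<pi> ^ Suc k"] by simp
      then have "res 1 = res (\<pi> ^ Suc k)" by simp
      then show False by (simp add: res.hom_mult \<pi>(2))
    qed
  qed
  have "\<not> range (\<lambda>e. to_fract (\<pi> ^ Suc e)) \<subseteq> {t. poly (char_poly A) t = 0}"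
    using fin inj range_inj_infinite finite_subset by blast
  then obtain e where e: "poly (char_poly A) (to_fract (\<pi> ^ Suc e)) \<noteq> 0" by blast
  define M where "M j l = M0 j l - (if j = l then \<pi> ^ Suc e else 0)" for j l
  have "det (char_matrix A (to_fract (\<pi> ^ Suc e))) \<noteq> 0"
    using e eigenvalue_root_char_poly[OF A] eigenvalue_det[OF A] by blast
  also have "char_matrix A (to_fract (\<pi> ^ Suc e)) = mat d d (\<lambda>(j, l). to_fract (M j l))"
    by (rule eq_matI) (auto simp: char_matrix_def A_def M_def)
  finally have "det (mat d d (\<lambda>(j, l). to_fract (M j l))) \<noteq> 0" .
  moreover have "res (M j l) = B j l" for j l
    by (simp add: M_def res.hom_minus M0 res.hom_mult \<pi>(2))
  ultimately show thesis using that by blast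
qed

section \<open>Lattices, their duals and homothety\<close>

lemma lattice_from_dual:
  fixes A :: "'r::idom fract mat"
  assumes A: "A \<in> carrier_mat d d" "det A \<noteq> 0"
  obtains L where "is_lattice d L" "is_lattice_basis d (dual_lattice d L) A\<^sup>T"
proof -
  define B where "B = (1 / det A) \<cdot>\<^sub>m adj_mat A"
  have B: "B \<in> carrier_mat d d" unfolding B_def using adj_mat(1)[OF A(1)] by simp
  have AB: "A * B = 1\<^sub>m d"
    unfolding B_def mult_smult_distrib[OF A(1) adj_mat(1)[OF A(1)]] adj_mat(2)[OF A(1)]
    using A(2) by (intro eq_matI) auto
  have BA: "B * A = 1\<^sub>m d"
    unfolding B_def mult_smult_assoc_mat[OF adj_mat(1)[OF A(1)] A(1)] adj_mat(3)[OF A(1)]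
    using A(2) by (intro eq_matI) auto
  \<comment> \<open>The columns of \<open>B\<close>, the inverse of \<open>A\<close>, form the basis
    dual to the rows of \<open>A\<close>.\<close>
  define L where "L = (\<lambda>c. B *\<^sub>v map_vec to_fract c) ` (carrier_vec d :: 'r vec set)"
  have map_inj: "c = c'" if "map_vec to_fract c = map_vec to_fract (c' :: 'r vec)" for c c'
    using that by (auto simp: vec_eq_iff)
  have "inj_on (\<lambda>c. B *\<^sub>v map_vec to_fract c) (carrier_vec d :: 'r vec set)"
  proof (rule inj_onI)
    fix c c' :: "'r vec" assume c: "c \<in> carrier_vec d" "c' \<in> carrier_vec d"
      and eq: "B *\<^sub>v map_vec to_fract c = B *\<^sub>v map_vec to_fract c'"
    have "map_vec to_fract c = A *\<^sub>v (B *\<^sub>v map_vec to_fract c)"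
      using c by (simp add: assoc_mult_mat_vec[OF A(1) B, symmetric] AB)
    also have "\<dots> = map_vec to_fract c'"
      unfolding eq using c by (simp add: assoc_mult_mat_vec[OF A(1) B, symmetric] AB)
    finally show "c = c'" by (rule map_inj)
  qed
  then have basis: "is_lattice_basis d L B" unfolding is_lattice_basis_def L_def using B by simp
  have AT: "A\<^sup>T \<in> carrier_mat d d" and BT: "B\<^sup>T \<in> carrier_mat d d" using A B by auto
  have ATBT: "A\<^sup>T * B\<^sup>T = 1\<^sub>m d"
    unfolding transpose_mult[OF B A(1), symmetric] BA by simp
  have BTAT: "B\<^sup>T * A\<^sup>T = 1\<^sub>m d"
    unfolding transpose_mult[OF A(1) B, symmetric] AB by simp
  have adj: "\<phi> \<bullet> (B *\<^sub>v v) = (B\<^sup>T *\<^sub>v \<phi>) \<bullet> v" if "\<phi> \<in> carrier_vec d" "v \<in> carrier_vec d" for \<phi> v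
    by (rule transpose_vec_mult_scalar[OF B that(2,1), symmetric])
  have "dual_lattice d L = (\<lambda>c. A\<^sup>T *\<^sub>v map_vec to_fract c) ` (carrier_vec d :: 'r vec set)"
  proof (intro subset_antisym subsetI)
    fix \<phi> assume "\<phi> \<in> dual_lattice d L"
    then have \<phi>: "\<phi> \<in> carrier_vec d" and int: "\<And>c. c \<in> carrier_vec d \<Longrightarrow>
      \<phi> \<bullet> (B *\<^sub>v map_vec to_fract (c :: 'r vec)) \<in> range to_fract"
      by (auto simp: dual_lattice_def L_def)
    have "\<exists>a. (B\<^sup>T *\<^sub>v \<phi>) $ l = to_fract a" if l: "l < d" for l
    proof -
      have u: "map_vec to_fract (unit_vec d l :: 'r vec) = unit_vec d l"
        using l by (intro eq_vecI) (auto simp: unit_vec_def)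
      have "\<phi> \<bullet> (B *\<^sub>v map_vec to_fract (unit_vec d l :: 'r vec)) = (B\<^sup>T *\<^sub>v \<phi>) $ l"
        unfolding u using adj[OF \<phi>, of "unit_vec d l"] BT \<phi> l by simp
      with int[of "unit_vec d l"] show ?thesis by auto
    qed
    then obtain a where a: "\<And>l. l < d \<Longrightarrow> (B\<^sup>T *\<^sub>v \<phi>) $ l = to_fract (a l)" by metis
    have "B\<^sup>T *\<^sub>v \<phi> = map_vec to_fract (vec d a)"
      using BT by (intro eq_vecI) (auto simp: a simp del: index_mult_mat_vec)
    moreover have "\<phi> = A\<^sup>T *\<^sub>v (B\<^sup>T *\<^sub>v \<phi>)"
      using \<phi> by (simp add: assoc_mult_mat_vec[OF AT BT, symmetric] ATBT)
    ultimately show "\<phi> \<in> (\<lambda>c. A\<^sup>T *\<^sub>v map_vec to_fract c) ` (carrier_vec d :: 'r vec set)"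
      by (metis image_eqI vec_carrier)
  next
    fix \<phi> assume "\<phi> \<in> (\<lambda>c. A\<^sup>T *\<^sub>v map_vec to_fract c) ` (carrier_vec d :: 'r vec set)"
    then obtain u :: "'r vec" where u: "u \<in> carrier_vec d" "\<phi> = A\<^sup>T *\<^sub>v map_vec to_fract u" by blast
    have \<phi>: "\<phi> \<in> carrier_vec d" using AT u by simp
    have Bu: "B\<^sup>T *\<^sub>v \<phi> = map_vec to_fract u"
      unfolding u(2) using u(1) by (simp add: assoc_mult_mat_vec[OF BT AT, symmetric] BTAT)
    have "\<phi> \<bullet> (B *\<^sub>v map_vec to_fract c) = to_fract (u \<bullet> c)" if c: "c \<in> carrier_vec d" for c
    proof -
      interpret f: comm_ring_hom "to_fract :: 'r \<Rightarrow> 'r fract" by (rule to_fract_hom)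
      have "\<phi> \<bullet> (B *\<^sub>v map_vec to_fract c) = map_vec to_fract u \<bullet> map_vec to_fract c"
        using adj[OF \<phi>, of "map_vec to_fract c"] c by (simp add: Bu)
      also have "\<dots> = to_fract (u \<bullet> c)"
        using c u(1) by (simp add: scalar_prod_def f.hom_sum f.hom_mult)
      finally show ?thesis .
    qed
    with \<phi> show "\<phi> \<in> dual_lattice d L" by (auto simp: dual_lattice_def L_def)
  qed
  moreover have "inj_on (\<lambda>c. A\<^sup>T *\<^sub>v map_vec to_fract c) (carrier_vec d :: 'r vec set)"
  proof (rule inj_onI)
    fix c c' :: "'r vec" assume c: "c \<in> carrier_vec d" "c' \<in> carrier_vec d"
      and eq: "A\<^sup>T *\<^sub>v map_vec to_fract c = A\<^sup>T *\<^sub>v map_vec to_fract c'"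
    have "map_vec to_fract c = B\<^sup>T *\<^sub>v (A\<^sup>T *\<^sub>v map_vec to_fract c)"
      using c by (simp add: assoc_mult_mat_vec[OF BT AT, symmetric] BTAT)
    also have "\<dots> = map_vec to_fract c'"
      unfolding eq using c by (simp add: assoc_mult_mat_vec[OF BT AT, symmetric] BTAT)
    finally show "c = c'" by (rule map_inj)
  qed
  ultimately have "is_lattice_basis d (dual_lattice d L) A\<^sup>T"
    unfolding is_lattice_basis_def using AT by blast
  with basis that show thesis unfolding is_lattice_def by blast
qed

lemma lattice_basis_col:
  assumes "is_lattice_basis d L (B :: 'r::idom fract mat)" "j < d"
  shows "col B j \<in> L"
proof -
  have B: "B \<in> carrier_mat d d" using assms(1) by (simp add: is_lattice_basis_def)
  have u: "map_vec to_fract (unit_vec d j :: 'r vec) = unit_vec d j"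
    using assms(2) by (intro eq_vecI) (auto simp: unit_vec_def)
  have "B *\<^sub>v map_vec to_fract (unit_vec d j :: 'r vec) = col B j"
    unfolding u using B assms(2) by (intro eq_vecI) auto
  moreover have "unit_vec d j \<in> (carrier_vec d :: 'r vec set)" by simp
  ultimately show ?thesis using assms(1) unfolding is_lattice_basis_def by (metis image_eqI)
qed

lemma lattice_basis_coordinates:
  assumes "is_lattice_basis d L (B :: 'r::idom fract mat)" "v \<in> L"
  obtains u where "\<And>l. l < d \<Longrightarrow> v $ l = (\<Sum>a<d. B $$ (l, a) * to_fract (u a))"
proof -
  obtain c :: "'r vec" where c: "c \<in> carrier_vec d" "v = B *\<^sub>v map_vec to_fract c"
      and B: "B \<in> carrier_mat d d"
    using assms unfolding is_lattice_basis_def by blast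
  have "v $ l = (\<Sum>a<d. B $$ (l, a) * to_fract (c $ a))" if "l < d" for l
    using that c B by (simp add: scalar_prod_def atLeast0LessThan)
  then show thesis by (rule that)
qed

lemma dual_lattice_smult:
  assumes "L \<subseteq> carrier_vec d"
  shows "dual_lattice d ((\<lambda>v. c \<cdot>\<^sub>v v) ` L) = {\<phi> \<in> carrier_vec d. c \<cdot>\<^sub>v \<phi> \<in> dual_lattice d L}"
proof -
  have "\<phi> \<bullet> (c \<cdot>\<^sub>v v) = (c \<cdot>\<^sub>v \<phi>) \<bullet> v" if "\<phi> \<in> carrier_vec d" "v \<in> L" for \<phi> v
  proof -
    have "v \<in> carrier_vec d" using that(2) assms by blast
    with that(1) show ?thesis by simp
  qed
  then show ?thesis by (auto simp: dual_lattice_def)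
qed

lemma is_lattice_carrier: "is_lattice d L \<Longrightarrow> L \<subseteq> carrier_vec d"
  unfolding is_lattice_def is_lattice_basis_def by auto

lemma homothety_class_self:
  assumes "L \<subseteq> carrier_vec d"
  shows "L \<in> homothety_class L"
proof -
  have "(\<lambda>v. 1 \<cdot>\<^sub>v v) ` L = L" by simp
  then show ?thesis unfolding homothety_class_def by (metis (mono_tags, lifting) CollectI one_neq_zero)
qed

lemma fract_coprime:
  fixes c :: "'r::idom fract"
  assumes pd: "principal_domain (class_ring :: 'r ring)"
  obtains \<alpha> \<beta> r s where "c * to_fract \<beta> = to_fract \<alpha>" "r * \<alpha> + s * \<beta> = 1"
proof -
  obtain a b where ab: "c = Fract a b" "b \<noteq> 0" by (cases c) auto
  obtain \<alpha> \<beta> g r s where g: "a = g * \<alpha>" "b = g * \<beta>" "r * \<alpha> + s * \<beta> = 1"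
    using pid_bezout[OF pd ab(2), of a thesis] by blast
  have "c * to_fract \<beta> = to_fract \<alpha>"
    using ab g(1,2) by (auto simp: to_fract_def eq_fract)
  with g(3) that show thesis by blast
qed

text \<open>With \<open>c = \<alpha> / \<beta>\<close> in lowest terms the dual bases satisfy
  \<open>\<alpha> M = \<beta> u b\<close> and \<open>\<beta> b = \<alpha> v M\<close> over R. If
  \<open>\<alpha>\<close> reduced to 0, then \<open>\<beta>\<close> would not, and \<open>b\<close>
  would reduce to 0, against \<open>nzB\<close>; symmetrically for \<open>\<beta>\<close>. So both
  have nonzero residues, and the reductions of \<open>M\<close> and \<open>b\<close> have the same
  row space.\<close>

lemma homothetic_reductions:
  fixes res :: "'r::idom \<Rightarrow> 'k::field" and M b :: "nat \<Rightarrow> nat \<Rightarrow> 'r"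
  assumes pd: "principal_domain (class_ring :: 'r ring)" and res: "comm_ring_hom res"
    and L': "L' \<subseteq> carrier_vec d" and L: "L = (\<lambda>v. c \<cdot>\<^sub>v v) ` L'" and c: "c \<noteq> 0"
    and A: "is_lattice_basis d (dual_lattice d L) A" "\<And>j l. j < d \<Longrightarrow> l < d \<Longrightarrow> A $$ (l, j) = to_fract (M j l)"
    and B: "is_lattice_basis d (dual_lattice d L') B" "\<And>j l. j < d \<Longrightarrow> l < d \<Longrightarrow> B $$ (l, j) = to_fract (b j l)"
    and nzA: "\<exists>j<d. \<exists>l<d. res (M j l) \<noteq> 0" and nzB: "\<exists>j<d. \<exists>l<d. res (b j l) \<noteq> 0"
  obtains u v :: "nat \<Rightarrow> nat \<Rightarrow> 'k" where
    "\<And>j l. j < d \<Longrightarrow> l < d \<Longrightarrow> res (b j l) = (\<Sum>a<d. v j a * res (M a l))"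
    "\<And>j l. j < d \<Longrightarrow> l < d \<Longrightarrow> res (M j l) = (\<Sum>a<d. u j a * res (b a l))"
proof -
  interpret res: comm_ring_hom res by (rule res)
  interpret f: comm_ring_hom "to_fract :: 'r \<Rightarrow> 'r fract" by (rule to_fract_hom)
  have carr: "A \<in> carrier_mat d d" "B \<in> carrier_mat d d" using A(1) B(1)
      by (auto simp: is_lattice_basis_def)
  have dual: "dual_lattice d L = {\<phi> \<in> carrier_vec d. c \<cdot>\<^sub>v \<phi> \<in> dual_lattice d L'}"
    unfolding L by (rule dual_lattice_smult[OF L'])
  obtain \<alpha> \<beta> r s where \<alpha>\<beta>: "c * to_fract \<beta> = to_fract \<alpha>" "r * \<alpha> + s * \<beta> = 1"
    by (rule fract_coprime[OF pd, of c])
  \<comment> \<open>Multiplication by \<open>c\<close> takes the dual of \<open>L = c L'\<close>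
    into the dual of \<open>L'\<close>.\<close>
  have "\<exists>u. \<forall>l<d. \<alpha> * M j l = \<beta> * (\<Sum>a<d. b a l * u a)" if j: "j < d" for j
  proof -
    have "c \<cdot>\<^sub>v col A j \<in> dual_lattice d L'" using lattice_basis_col[OF A(1) j] unfolding dual by blast
    then obtain u where u: "\<And>l. l < d \<Longrightarrow> (c \<cdot>\<^sub>v col A j) $ l = (\<Sum>a<d. B $$ (l, a) * to_fract (u a))"
      using lattice_basis_coordinates[OF B(1)] by blast
    have "\<alpha> * M j l = \<beta> * (\<Sum>a<d. b a l * u a)" if l: "l < d" for l
    proof -
      have "to_fract (\<alpha> * M j l) = to_fract \<beta> * (c * to_fract (M j l))"
        by (simp add: f.hom_mult \<alpha>\<beta>(1)[symmetric] mult_ac)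
      also have "c * to_fract (M j l) = (c \<cdot>\<^sub>v col A j) $ l" using carr j l by (simp add: A(2))
      also have "\<dots> = to_fract (\<Sum>a<d. b a l * u a)"
        unfolding u[OF l] using l by (simp add: B(2) f.hom_sum f.hom_mult)
      finally show ?thesis by (simp only: to_fract_mult[symmetric] to_fract_eq_iff)
    qed
    then show ?thesis by blast
  qed
  then obtain u where u: "\<And>j l. j < d \<Longrightarrow> l < d \<Longrightarrow> \<alpha> * M j l = \<beta> * (\<Sum>a<d. b a l * u j a)" by metis
  have "\<exists>v. \<forall>l<d. \<beta> * b j l = \<alpha> * (\<Sum>a<d. M a l * v a)" if j: "j < d" for j
  proof -
    have "inverse c \<cdot>\<^sub>v col B j \<in> dual_lattice d L"
      unfolding dual using lattice_basis_col[OF B(1) j] carr c by (auto simp: smult_smult_assoc)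
    then obtain v where v: "\<And>l. l < d \<Longrightarrow> (inverse c \<cdot>\<^sub>v col B j) $ l = (\<Sum>a<d. A $$ (l, a) * to_fract (v a))"
      using lattice_basis_coordinates[OF A(1)] by blast
    have "\<beta> * b j l = \<alpha> * (\<Sum>a<d. M a l * v a)" if l: "l < d" for l
    proof -
      have "to_fract (\<beta> * b j l) = to_fract \<alpha> * (inverse c * to_fract (b j l))"
        using c by (simp add: f.hom_mult \<alpha>\<beta>(1)[symmetric] mult_ac)
      also have "inverse c * to_fract (b j l) = (inverse c \<cdot>\<^sub>v col B j) $ l" using carr j l
        by (simp add: B(2))
      also have "\<dots> = to_fract (\<Sum>a<d. M a l * v a)"
        unfolding v[OF l] using l by (simp add: A(2) f.hom_sum f.hom_mult)
      finally show ?thesis by (simp only: to_fract_mult[symmetric] to_fract_eq_iff)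
    qed
    then show ?thesis by blast
  qed
  then obtain v where v: "\<And>j l. j < d \<Longrightarrow> l < d \<Longrightarrow> \<beta> * b j l = \<alpha> * (\<Sum>a<d. M a l * v j a)" by metis
  have u': "res \<alpha> * res (M j l) = res \<beta> * (\<Sum>a<d. res (u j a) * res (b a l))" if "j < d" "l < d" for j l
    using arg_cong[OF u[OF that], of res] by (simp add: res.hom_mult res.hom_sum mult.commute)
  have v': "res \<beta> * res (b j l) = res \<alpha> * (\<Sum>a<d. res (v j a) * res (M a l))" if "j < d" "l < d" for j l
    using arg_cong[OF v[OF that], of res] by (simp add: res.hom_mult res.hom_sum mult.commute)
  have one: "res r * res \<alpha> + res s * res \<beta> = 1"
    using arg_cong[OF \<alpha>\<beta>(2), of res] by (simp add: res.hom_mult res.hom_add)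
  have "res \<alpha> \<noteq> 0"
  proof
    assume 0: "res \<alpha> = 0"
    with one have "res \<beta> \<noteq> 0" by auto
    with v' 0 nzB show False by auto
  qed
  moreover have "res \<beta> \<noteq> 0"
  proof
    assume 0: "res \<beta> = 0"
    with one have "res \<alpha> \<noteq> 0" by auto
    with u' 0 nzA show False by auto
  qed
  ultimately have "res (b j l) = res \<alpha> / res \<beta> * (\<Sum>a<d. res (v j a) * res (M a l))"
      "res (M j l) = res \<beta> / res \<alpha> * (\<Sum>a<d. res (u j a) * res (b a l))" if "j < d" "l < d" for j l
    using u'[OF that] v'[OF that] by (simp_all add: field_simps)
  then have "res (b j l) = (\<Sum>a<d. (res \<alpha> / res \<beta> * res (v j a)) * res (M a l))"
      "res (M j l) = (\<Sum>a<d. (res \<beta> / res \<alpha> * res (u j a)) * res (b a l))" if "j < d" "l < d" for j l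
    using that by (simp_all only: sum_distrib_left mult.assoc)
  then show thesis by (rule that)
qed

text \<open>Different matrices may give homothetic lattices, whereas the list of lattices has to run
  through a set of classes without repetition.\<close>

lemma distinct_representatives:
  assumes "finite X"
  obtains xs where "set xs \<subseteq> X" "distinct (map f xs)" "f ` set xs = f ` X"
proof -
  obtain ys where ys: "set ys = f ` X" "distinct ys" using finite_distinct_list[of "f ` X"] assms by auto
  define xs where "xs = map (inv_into X f) ys"
  have "map f xs = ys"
    unfolding xs_def map_map using ys(1) by (intro map_idI) (simp add: f_inv_into_f)
  moreover have "set xs \<subseteq> X" unfolding xs_def using ys(1) by (auto intro: inv_into_into)
  moreover have "f ` set xs = f ` X" using \<open>map f xs = ys\<close> ys(1) by (metis set_map)
  ultimately show thesis using ys(2) that by metis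
qed

lemma lin_factor:
  assumes "\<And>l. l < d \<Longrightarrow> B i' a l = (\<Sum>j<r. N j * P i j l)"
  shows "lin d B w (i', a) = (\<Sum>j<r. N j * lin d P w (i, j))"
proof -
  have "lin d B w (i', a) = (\<Sum>l<d. \<Sum>j<r. N j * P i j l * w l)"
    by (simp add: lin_apply assms sum_distrib_right)
  also have "\<dots> = (\<Sum>j<r. N j * lin d P w (i, j))"
    unfolding lin_apply sum_distrib_left by (subst sum.swap) (simp add: mult.assoc)
  finally show ?thesis .
qed

text \<open>\<open>N\<close> and \<open>T\<close> translate between the given maps and the
  reductions of the dual bases, as the isomorphism of image varieties requires.
  \<open>\<tau>\<close> sends an index to the position of its homothety class, and
  \<open>\<sigma>\<close> picks an index for each position.\<close>

lemma reduction_lattices: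
  fixes res :: "'r::idom \<Rightarrow> 'k::field" and P :: "nat \<Rightarrow> nat \<Rightarrow> nat \<Rightarrow> 'k"
  assumes dvr: "is_dvr TYPE('r)" and resm: "residue_map res"
    and nz: "\<And>i. i < n \<Longrightarrow> \<exists>j<r. \<exists>l<d. P i j l \<noteq> 0"
  obtains Ls :: "'r fract vec set list" and b :: "nat \<Rightarrow> nat \<Rightarrow> nat \<Rightarrow> 'r" and \<tau> \<sigma> N T where
    "\<And>L. L \<in> set Ls \<Longrightarrow> is_lattice d L" "distinct (map homothety_class Ls)"
    "\<And>k. k < length Ls \<Longrightarrow> dual_basis d (Ls ! k) \<in> carrier_mat d d"
    "\<And>k j l. k < length Ls \<Longrightarrow> j < d \<Longrightarrow> l < d \<Longrightarrow> dual_basis d (Ls ! k) $$ (l, j) = to_fract (b k j l)"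
    "\<And>i. i < n \<Longrightarrow> \<tau> i < length Ls" "\<And>k. k < length Ls \<Longrightarrow> \<sigma> k < n" "\<And>k. k < length Ls \<Longrightarrow> \<tau> (\<sigma> k) = k"
    "\<And>i a l. i < n \<Longrightarrow> a < d \<Longrightarrow> l < d \<Longrightarrow> res (b (\<tau> i) a l) = (\<Sum>j<r. N i a j * P i j l)"
    "\<And>i j l. i < n \<Longrightarrow> j < r \<Longrightarrow> l < d \<Longrightarrow> P i j l = (\<Sum>a<d. T i j a * res (b (\<tau> i) a l))"
proof -
  have res: "comm_ring_hom res" "surj res" using resm by (simp_all add: residue_map_def)
  have pd: "principal_domain (class_ring :: 'r ring)" using dvr by (simp add: is_dvr_def)
  interpret res: comm_ring_hom res by (rule res(1))
  interpret f: comm_ring_hom "to_fract :: 'r \<Rightarrow> 'r fract" by (rule to_fract_hom)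
  obtain \<pi> where \<pi>: "\<pi> \<noteq> 0" "res \<pi> = 0" by (rule dvr_residue_kernel[OF dvr resm])
  have "\<forall>i. \<exists>G. \<forall>j\<in>{..<r}. \<forall>l\<in>{..<d}. (\<Sum>a\<in>{..<d}. \<Sum>s\<in>{..<r}. P i j a * G a s * P i s l) = P i j l"
    by (intro allI generalized_inverse) simp_all
  from choice[OF this] obtain G where
    "\<forall>i. \<forall>j\<in>{..<r}. \<forall>l\<in>{..<d}. (\<Sum>a<d. \<Sum>s<r. P i j a * G i a s * P i s l) = P i j l" ..
  then have G: "(\<Sum>a<d. \<Sum>s<r. P i j a * G i a s * P i s l) = P i j l" if "j < r" "l < d" for i j l
    using that by simp
  \<comment> \<open>\<open>R i = G i P i\<close> is the square matrix with the row space of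
    \<open>P i\<close>; conversely \<open>P i = P i R i\<close>.\<close>
  define R where "R i a l = (\<Sum>s<r. G i a s * P i s l)" for i a l
  have PR: "P i j l = (\<Sum>a<d. P i j a * R i a l)" if "j < r" "l < d" for i j l
    using G[OF that, of i] by (simp add: R_def sum_distrib_left mult.assoc)
  have R_nz: "\<exists>a<d. \<exists>l<d. R i a l \<noteq> 0" if i: "i < n" for i
  proof (rule ccontr)
    assume "\<not> ?thesis"
    then have "P i j l = 0" if "j < r" "l < d" for j l using PR[OF that, of i] that by simp
    with nz[OF i] show False by blast
  qed
  have "\<forall>i. \<exists>M. (\<forall>j l. res (M j l) = R i j l) \<and> det (mat d d (\<lambda>(j, l). to_fract (M j l))) \<noteq> 0"
  proof
    fix i show "\<exists>M. (\<forall>j l. res (M j l) = R i j l) \<and> det (mat d d (\<lambda>(j, l). to_fract (M j l))) \<noteq> 0"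
      by (rule invertible_lift[OF res \<pi>, of "R i" d]) blast
  qed
  from choice[OF this] obtain M where
    "\<forall>i. (\<forall>j l. res (M i j l) = R i j l) \<and> det (mat d d (\<lambda>(j, l). to_fract (M i j l))) \<noteq> 0" ..
  then have M: "\<And>i j l. res (M i j l) = R i j l" "\<And>i. det (mat d d (\<lambda>(j, l). to_fract (M i j l))) \<noteq> 0"
    by simp_all
  define A where "A i = mat d d (\<lambda>(l, j). to_fract (M i j l))" for i
  have "\<forall>i. \<exists>L. is_lattice d L \<and> is_lattice_basis d (dual_lattice d L) (A i)"
  proof
    fix i
    have "(mat d d (\<lambda>(j, l). to_fract (M i j l)))\<^sup>T = A i"
      by (rule eq_matI) (auto simp: A_def)
    with lattice_from_dual[OF mat_carrier M(2)[of i]]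
    show "\<exists>L. is_lattice d L \<and> is_lattice_basis d (dual_lattice d L) (A i)" by auto
  qed
  from choice[OF this] obtain L where
    "\<forall>i. is_lattice d (L i) \<and> is_lattice_basis d (dual_lattice d (L i)) (A i)" ..
  then have L: "\<And>i. is_lattice d (L i)" "\<And>i. is_lattice_basis d (dual_lattice d (L i)) (A i)"
    by simp_all
  note Lc = is_lattice_carrier[OF L(1)]
  have A: "A i $$ (l, j) = to_fract (M i j l)" if "j < d" "l < d" for i j l
    using that by (simp add: A_def)
  obtain Ls where Ls: "set Ls \<subseteq> L ` {..<n}" "distinct (map homothety_class Ls)"
    "homothety_class ` set Ls = homothety_class ` L ` {..<n}"
    using distinct_representatives[of "L ` {..<n}" homothety_class] by blast
  have "\<exists>i. i < n \<and> Ls ! k = L i" if "k < length Ls" for k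
    using Ls(1) nth_mem[OF that] by auto
  then obtain \<sigma> where \<sigma>: "\<And>k. k < length Ls \<Longrightarrow> \<sigma> k < n" "\<And>k. k < length Ls \<Longrightarrow> Ls ! k = L (\<sigma> k)" by metis
  have "\<exists>k. k < length Ls \<and> homothety_class (Ls ! k) = homothety_class (L i)" if "i < n" for i
  proof -
    have "homothety_class (L i) \<in> homothety_class ` set Ls" unfolding Ls(3) using that by blast
    then show ?thesis by (metis image_iff in_set_conv_nth)
  qed
  then obtain \<tau> where \<tau>: "\<And>i. i < n \<Longrightarrow> \<tau> i < length Ls"
    "\<And>i. i < n \<Longrightarrow> homothety_class (Ls ! \<tau> i) = homothety_class (L i)" by metis
  have \<tau>\<sigma>: "\<tau> (\<sigma> k) = k" if k: "k < length Ls" for k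
  proof -
    have "map homothety_class Ls ! \<tau> (\<sigma> k) = map homothety_class Ls ! k"
      using \<tau>[OF \<sigma>(1)[OF k]] \<sigma>(2)[OF k] k by simp
    then show ?thesis
      using nth_eq_iff_index_eq[OF Ls(2)] \<tau>(1)[OF \<sigma>(1)[OF k]] k by simp
  qed
  have basis: "is_lattice_basis d (dual_lattice d (Ls ! k)) (dual_basis d (Ls ! k))"
      if k: "k < length Ls" for k
    unfolding dual_basis_def \<sigma>(2)[OF k] by (rule someI[of
      "is_lattice_basis d (dual_lattice d (L (\<sigma> k)))", OF L(2)])
  then have carr: "dual_basis d (Ls ! k) \<in> carrier_mat d d" if "k < length Ls" for k
    using that unfolding is_lattice_basis_def by blast
  \<comment> \<open>The vectors of the chosen dual basis are R-combinations of the columns of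
    \<open>A (\<sigma> k)\<close>, which are integral.\<close>
  have int: "\<exists>u. dual_basis d (Ls ! k) $$ (l, j) = to_fract u" if k: "k < length Ls"
      and jl: "j < d" "l < d" for k j l
  proof -
    have "col (dual_basis d (Ls ! k)) j \<in> dual_lattice d (L (\<sigma> k))"
      using lattice_basis_col[OF basis[OF k] jl(1)] \<sigma>(2)[OF k] by simp
    then obtain u where "\<And>l. l < d \<Longrightarrow> col (dual_basis d (Ls ! k)) j $ l =
      (\<Sum>a<d. A (\<sigma> k) $$ (l, a) * to_fract (u a))"
      using lattice_basis_coordinates[OF L(2)] by blast
    from this[OF jl(2)] have "dual_basis d (Ls ! k) $$ (l, j) = to_fract (\<Sum>a<d. M (\<sigma> k) a l * u a)"
      using carr[OF k] jl by (simp add: A f.hom_sum f.hom_mult)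
    then show ?thesis by blast
  qed
  define b where "b k j l = (SOME u. dual_basis d (Ls ! k) $$ (l, j) = to_fract u)" for k j l
  have b: "dual_basis d (Ls ! k) $$ (l, j) = to_fract (b k j l)" if "k < length Ls" "j < d" "l < d"
      for k j l
    unfolding b_def by (rule someI_ex[OF int[OF that]])
  \<comment> \<open>If the chosen basis reduced to 0, so would the columns of
    \<open>A (\<sigma> k)\<close>, but their reduction \<open>R (\<sigma> k)\<close> is
    nonzero.\<close>
  have b_nz: "\<exists>j<d. \<exists>l<d. res (b k j l) \<noteq> 0" if k: "k < length Ls" for k
  proof (rule ccontr)
    assume "\<not> ?thesis"
    then have b0: "res (b k j l) = 0" if "j < d" "l < d" for j l using that by blast
    have "R (\<sigma> k) a l = 0" if al: "a < d" "l < d" for a l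
    proof -
      have "col (A (\<sigma> k)) a \<in> dual_lattice d (Ls ! k)"
        using lattice_basis_col[OF L(2) al(1), of "\<sigma> k"] \<sigma>(2)[OF k] by simp
      then obtain u where "\<And>l. l < d \<Longrightarrow> col (A (\<sigma> k)) a $ l =
        (\<Sum>j<d. dual_basis d (Ls ! k) $$ (l, j) * to_fract (u j))"
        using lattice_basis_coordinates[OF basis[OF k]] by blast
      from this[OF al(2)] have "to_fract (M (\<sigma> k) a l) = to_fract (\<Sum>j<d. b k j l * u j)"
        using al k by (simp add: A_def b f.hom_sum f.hom_mult)
      then have "M (\<sigma> k) a l = (\<Sum>j<d. b k j l * u j)" by (simp only: to_fract_eq_iff)
      then have "res (M (\<sigma> k) a l) = (\<Sum>j<d. res (b k j l) * res (u j))"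
        by (simp add: res.hom_sum res.hom_mult)
      with al show ?thesis by (simp add: M(1) b0)
    qed
    with R_nz[OF \<sigma>(1)[OF k]] show False by blast
  qed
  \<comment> \<open>Two changes are covered at once: from \<open>L i\<close> to the representative
    of its class, and from the basis \<open>A i\<close> to the chosen dual basis.\<close>
  have "\<forall>i. \<exists>uv. i < n \<longrightarrow> (\<forall>j<d. \<forall>l<d. res (b (\<tau> i) j l) = (\<Sum>a<d. snd uv j a * R i a l)) \<and>
      (\<forall>j<d. \<forall>l<d. R i j l = (\<Sum>a<d. fst uv j a * res (b (\<tau> i) a l)))"
  proof (intro allI, unfold ex_simps, rule impI)
    fix i assume i: "i < n"
    note k = \<tau>(1)[OF i]
    have "L i \<in> homothety_class (Ls ! \<tau> i)" unfolding \<tau>(2)[OF i] by (rule homothety_class_self[OF Lc])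
    then obtain c where c: "c \<noteq> 0" "L i = (\<lambda>v. c \<cdot>\<^sub>v v) ` (Ls ! \<tau> i)" unfolding homothety_class_def by blast
    have nzM: "\<exists>j<d. \<exists>l<d. res (M i j l) \<noteq> 0" using R_nz[OF i] by (simp add: M(1))
    have Lsc: "Ls ! \<tau> i \<subseteq> carrier_vec d" using Lc \<sigma>(2)[OF k] by simp
    show "\<exists>uv. (\<forall>j<d. \<forall>l<d. res (b (\<tau> i) j l) = (\<Sum>a<d. snd uv j a * R i a l)) \<and>
      (\<forall>j<d. \<forall>l<d. R i j l = (\<Sum>a<d. fst uv j a * res (b (\<tau> i) a l)))"
    proof (rule homothetic_reductions[where d = d and L = "L i" and A = "A i" and M = "M i"
            and B = "dual_basis d (Ls ! \<tau> i)" and b = "b (\<tau> i)", OF pd res(1) Lsc c(2,1) L(2)])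
      show "A i $$ (l, j) = to_fract (M i j l)" if "j < d" "l < d" for j l using that by (rule A)
      show "is_lattice_basis d (dual_lattice d (Ls ! \<tau> i)) (dual_basis d (Ls ! \<tau> i))" by (rule basis[OF k])
      show "dual_basis d (Ls ! \<tau> i) $$ (l, j) = to_fract (b (\<tau> i) j l)" if "j < d" "l < d" for j l
        using k that by (rule b)
      show "\<exists>j<d. \<exists>l<d. res (M i j l) \<noteq> 0" by (rule nzM)
      show "\<exists>j<d. \<exists>l<d. res (b (\<tau> i) j l) \<noteq> 0" by (rule b_nz[OF k])
      fix v u
      assume vu: "\<And>j l. j < d \<Longrightarrow> l < d \<Longrightarrow> res (b (\<tau> i) j l) = (\<Sum>a<d. v j a * res (M i a l))"
        "\<And>j l. j < d \<Longrightarrow> l < d \<Longrightarrow> res (M i j l) = (\<Sum>a<d. u j a * res (b (\<tau> i) a l))"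
      show "\<exists>uv. (\<forall>j<d. \<forall>l<d. res (b (\<tau> i) j l) = (\<Sum>a<d. snd uv j a * R i a l)) \<and>
          (\<forall>j<d. \<forall>l<d. R i j l = (\<Sum>a<d. fst uv j a * res (b (\<tau> i) a l)))"
      proof (intro exI[of _ "(u, v)"] conjI, unfold fst_conv snd_conv)
        show "\<forall>j<d. \<forall>l<d. res (b (\<tau> i) j l) = (\<Sum>a<d. v j a * R i a l)"
          using vu(1) unfolding M(1) by blast
        show "\<forall>j<d. \<forall>l<d. R i j l = (\<Sum>a<d. u j a * res (b (\<tau> i) a l))"
          using vu(2) unfolding M(1) by blast
      qed
    qed
  qed
  from choice[OF this] obtain uv where uv:
    "\<forall>i. i < n \<longrightarrow> (\<forall>j<d. \<forall>l<d. res (b (\<tau> i) j l) = (\<Sum>a<d. snd (uv i) j a * R i a l)) \<and>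
      (\<forall>j<d. \<forall>l<d. R i j l = (\<Sum>a<d. fst (uv i) j a * res (b (\<tau> i) a l)))" ..
  define u v where "u i = fst (uv i)" and "v i = snd (uv i)" for i
  have v: "res (b (\<tau> i) j l) = (\<Sum>a<d. v i j a * R i a l)"
    and u: "R i j l = (\<Sum>a<d. u i j a * res (b (\<tau> i) a l))" if "i < n" "j < d" "l < d" for i j l
    using uv[rule_format, OF that(1)] that(2,3) unfolding u_def v_def by blast+
  \<comment> \<open>With \<open>b\<close> reduced, \<open>b = v R = v G P\<close> gives
    \<open>N = v G\<close>, and \<open>P = P R = P u b\<close> gives \<open>T = P u\<close>.\<close>
  show thesis
  proof (rule that[of Ls b \<tau> \<sigma> "\<lambda>i a j. \<Sum>c<d. v i a c * G i c j" "\<lambda>i j a. \<Sum>c<d. P i j c * u i c a"])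
    show "is_lattice d K" if "K \<in> set Ls" for K using that Ls(1) L(1) by auto
    fix i l assume i: "i < n" and l: "l < d"
    show "res (b (\<tau> i) a l) = (\<Sum>j<r. (\<Sum>c<d. v i a c * G i c j) * P i j l)" if a: "a < d" for a
      unfolding v[OF i a l] R_def sum_distrib_left sum_distrib_right
      by (subst sum.swap) (simp add: mult.assoc)
    show "P i j l = (\<Sum>a<d. (\<Sum>c<d. P i j c * u i c a) * res (b (\<tau> i) a l))" if j: "j < r" for j
    proof -
      have "P i j l = (\<Sum>c<d. P i j c * (\<Sum>a<d. u i c a * res (b (\<tau> i) a l)))"
        unfolding PR[OF j l, of i] using u[OF i _ l] by (intro sum.cong) auto
      also have "\<dots> = (\<Sum>a<d. (\<Sum>c<d. P i j c * u i c a) * res (b (\<tau> i) a l))"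
        unfolding sum_distrib_left sum_distrib_right by (subst sum.swap) (simp add: mult.assoc)
      finally show ?thesis .
    qed
  qed (use Ls(2) carr b \<tau>(1) \<sigma>(1) \<tau>\<sigma> in auto)
qed

theorem corollary3p16:
  fixes res :: "'r::idom \<Rightarrow> 'k::alg_closed_field"
    and n :: nat
    and A :: "nat \<Rightarrow> 'k mat"
  assumes "is_dvr TYPE('r)"
    and "residue_map res"
    and "n > 2"
    and "\<And>i. i < n \<Longrightarrow> A i \<in> carrier_mat 3 4"
    and "\<And>i. i < n \<Longrightarrow> A i \<noteq> 0\<^sub>m 3 4"
  shows "\<exists>(d::nat) (\<Gamma> :: 'r fract vec set set set) (Ls :: 'r fract vec set list) Z.
    finite \<Gamma> \<and> \<Gamma> \<noteq> {} \<and>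
    (\<forall>L\<in>set Ls. is_lattice d L) \<and>
    distinct (map homothety_class Ls) \<and> set (map homothety_class Ls) = \<Gamma> \<and>
    irreducible_component_of (special_fiber res d Ls) Z \<and>
    isomorphic_varieties n 3 (multiview_variety n A)
      (length Ls) d (rational_points res (length Ls) d Z)"
proof -
  note inf = infinite_alg_closed[where 'k = 'k]
  have n: "n > 0" using assms(3) by simp
  have res: "comm_ring_hom res" "surj res" using assms(2) by (simp_all add: residue_map_def)
  define a where "a = (\<lambda>i j l. A i $$ (j, l))"
  have a_nz: "\<exists>j<3. \<exists>x. lin 4 a x (i, j) \<noteq> 0" if i: "i < n" for i
  proof -
    have "\<exists>j<3. \<exists>l<4. A i $$ (j, l) \<noteq> 0"
    proof (rule ccontr)
      assume "\<not> ?thesis"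
      then have "A i = 0\<^sub>m 3 4" using assms(4)[OF i] by (intro eq_matI) auto
      with assms(5)[OF i] show False by blast
    qed
    then obtain j l where jl: "j < 3" "l < 4" "A i $$ (j, l) \<noteq> 0" by blast
    have "lin 4 a (\<lambda>e. if e = l then 1 else 0) (i, j) = A i $$ (j, l)"
      using jl(2) by (simp add: lin_apply a_def if_distrib cong: if_cong)
    with jl show ?thesis by metis
  qed
  obtain d W w where t: "transversal n 3 d (restrict_maps 4 a W) w"
    and dom: "\<forall>f\<in>multiforms n 3. (\<forall>z. poly_at (lin d (restrict_maps 4 a W) z) f = 0) \<longrightarrow>
      (\<forall>x. poly_at (lin 4 a x) f = 0)"
    using birational_restriction[OF inf n a_nz] by blast
  define P where "P = restrict_maps 4 a W"
  \<comment> \<open>The image of the subspace lies in the full image, so vanishing on the latter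
    implies vanishing on the former; the converse is \<open>dom\<close>.\<close>
  have "image_variety 4 n 3 a = image_variety d n 3 P"
  proof -
    have "(\<forall>z. poly_at (lin d P z) f = 0) \<longleftrightarrow> (\<forall>x. poly_at (lin 4 a x) f = 0)"
      if "f \<in> multiforms n 3" for f
      using dom that unfolding P_def lin_restrict_maps by blast
    then show ?thesis unfolding image_variety_def by (metis (no_types, lifting))
  qed
  with multiview_variety_eq[OF inf assms(4) a_nz[unfolded a_def]]
  have Y: "multiview_variety n A = image_variety d n 3 P" by (simp add: a_def)
  have P_nz: "\<exists>j<3. \<exists>l<d. P i j l \<noteq> 0" if i: "i < n" for i
  proof (rule ccontr)
    assume "\<not> ?thesis"
    then have "lin d P w (i, j) = 0" if "j < 3" for j using that by (simp add: lin_apply)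
    with transversal_nonzero[OF t i] show False unfolding P_def by blast
  qed
  obtain Ls :: "'r fract vec set list" and b :: "nat \<Rightarrow> nat \<Rightarrow> nat \<Rightarrow> 'r" and \<tau> \<sigma> N T where
    lat: "\<And>L. L \<in> set Ls \<Longrightarrow> is_lattice d L" "distinct (map homothety_class Ls)"
    and dual: "\<And>k. k < length Ls \<Longrightarrow> dual_basis d (Ls ! k) \<in> carrier_mat d d"
      "\<And>k j l. k < length Ls \<Longrightarrow> j < d \<Longrightarrow> l < d \<Longrightarrow> dual_basis d (Ls ! k) $$ (l, j) = to_fract (b k j l)"
    and idx: "\<And>i. i < n \<Longrightarrow> \<tau> i < length Ls" "\<And>k. k < length Ls \<Longrightarrow> \<sigma> k < n" "\<And>k. k < length Ls \<Longrightarrow> \<tau> (\<sigma> k) = k"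
    and NT: "\<And>i a l. i < n \<Longrightarrow> a < d \<Longrightarrow> l < d \<Longrightarrow> res (b (\<tau> i) a l) = (\<Sum>j<3. N i a j * P i j l)"
      "\<And>i j l. i < n \<Longrightarrow> j < 3 \<Longrightarrow> l < d \<Longrightarrow> P i j l = (\<Sum>a<d. T i j a * res (b (\<tau> i) a l))"
    by (rule reduction_lattices[where n = n and r = 3 and d = d
      and P = P, OF assms(1,2) P_nz], assumption, rule that)
  let ?rb = "\<lambda>i j l. res (b i j l)" and ?m = "length Ls"
  have NP: "(\<Sum>l<3. N i j l * lin d P z (i, l)) = lin d ?rb z (\<tau> i, j)" if "i < n" "j < d" for i j z
    by (rule lin_factor[symmetric]) (rule NT(1)[OF that])
  have TR: "(\<Sum>l<d. T i j l * lin d ?rb z (\<tau> i, l)) = lin d P z (i, j)" if "i < n" "j < 3" for i j z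
    by (rule lin_factor[symmetric]) (rule NT(2)[OF that])
  have m: "?m > 0" using idx(1)[OF n] by linarith
  \<comment> \<open>The point \<open>w\<close> also serves for the reductions: \<open>T\<close>
    recovers \<open>P\<close> from them, so a zero coordinate vector or a second point of the closed
    fibre would carry over to \<open>P\<close>.\<close>
  interpret mustafin_reduction res d ?m b w Ls
  proof (intro mustafin_reduction.intro linear_reduction.intro mustafin_reduction_axioms.intro)
    show "\<exists>j<d. lin d ?rb w (k, j) \<noteq> 0" if k: "k < ?m" for k
    proof (rule ccontr)
      assume "\<not> ?thesis"
      then have "lin d P w (\<sigma> k, j) = 0" if "j < 3" for j
        using TR[OF idx(2)[OF k] that, of w] idx(3)[OF k] by simp
      with transversal_nonzero[OF t idx(2)[OF k]] show False unfolding P_def by blast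
    qed
    fix z s assume eq: "\<And>k j. k < ?m \<Longrightarrow> j < d \<Longrightarrow> lin d ?rb z (k, j) = s k * lin d ?rb w (k, j)"
    show "\<exists>c. \<forall>l<d. z l = c * w l"
    proof (rule transversal_unique[OF t, where s = "\<lambda>i. s (\<tau> i)"], fold P_def)
      fix i j :: nat assume ij: "i < n" "j < 3"
      have "lin d P z (i, j) = (\<Sum>l<d. T i j l * (s (\<tau> i) * lin d ?rb w (\<tau> i, l)))"
        unfolding TR[OF ij, symmetric] using eq idx(1)[OF ij(1)] by (intro sum.cong) auto
      also have "\<dots> = s (\<tau> i) * lin d P w (i, j)"
        unfolding TR[OF ij, symmetric] by (simp add: sum_distrib_left mult.left_commute)
      finally show "lin d P z (i, j) = s (\<tau> i) * lin d P w (i, j)" .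
    qed
  qed (use res inf m dual in auto)
  have "isomorphic_varieties n 3 (image_variety d n 3 P) ?m d (image_variety d ?m d ?rb)"
  proof (rule image_varieties_isomorphic[where \<tau> = \<tau> and \<sigma> = \<sigma> and
      N = "\<lambda>i. mat d 3 (\<lambda>(j, l). N i j l)" and T = "\<lambda>i. mat 3 d (\<lambda>(j, l). T i j l)"])
    fix i j :: nat and z :: "nat \<Rightarrow> 'k" assume "i < n" "j < d"
    then show "(\<Sum>l<3. mat d 3 (\<lambda>(j, l). N i j l) $$ (j, l) * lin d P z (i, l)) = lin d ?rb z (\<tau> i, j)"
      using NP by simp
  next
    fix i j :: nat and z :: "nat \<Rightarrow> 'k" assume ij: "i < n" "j < 3"
    then show "(\<Sum>l<d. mat 3 d (\<lambda>(j, l). T i j l) $$ (j, l) * lin d ?rb z (\<tau> i, l)) = lin d P z (i, j)"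
      using TR by simp
  qed (use idx in auto)
  then have "isomorphic_varieties n 3 (multiview_variety n A) ?m d (rational_points res ?m d
      generic_component)"
    by (simp add: Y rational_points_generic_component)
  then show ?thesis
    using irreducible_generic_component lat m
    by (intro exI[of _ d] exI[of _ "set (map homothety_class Ls)"] exI[of _ Ls] exI[of _
      generic_component]) auto
qed

end
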